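(* Let $L\in\mathcal{O}[\partial]$ be a linear differential operator with holomorphic coefficients at $0$, with initial form $L_0$ and shift $\tau=0$. Let $\Omega=\{\rho_1,\ldots,\rho_r\}$ be a set of local exponents of $L$ with integer differences (a full class of local exponents modulo $\mathbb{Z}$), increasingly ordered, with multiplicities $m_k$ of $\rho_k$. Set $n_k=m_1+\ldots+m_k$ and $\mathcal{F}=\sum_{k=1}^r\mathcal{O}x^{\rho_k}[z]_{<n_k}$. Let $L$ and $L_0$ act on $\mathcal{F}$ via $\partial x=1$ and $\partial z=x^{-1}$. Assume that $L$ has a regular singularity at $0$. Let $$\mathcal{H}=\bigoplus_{k=2}^r\bigoplus_{i=m_k}^{n_k-1}\mathbb{C}x^{\rho_k}z^i\ \oplus\ \bigoplus_{k=1}^{r-1}\bigoplus_{e=1}^{\rho_{k+1}-\rho_k-1}\bigoplus_{i=0}^{n_k-1}\mathbb{C}x^{\rho_k+e}z^i\ \oplus\ \bigoplus_{i=0}^{n_r-1}\mathcal{O}x^{\rho_r+1}z^i\subseteq\mathcal{F}.$$ (a) The composition of the inverse $(L_0|_{\mathcal{H}})^{-1}:\mathcal{F}x\to\mathcal{H}$ of $L_0|_{\mathcal{H}}$ with the inclusion $\mathcal{H}\subseteq\mathcal{F}$ defines a right inverse $S_0:\mathcal{F}x\to\mathcal{F}$ of $L_0$. Let $T:\mathcal{F}\to\mathcal{F}x$ be the map induced on $\mathcal{F}$ by $T=L_0-L$. Then the map $$u=\mathrm{Id}_{\mathcal{F}}-S_0\circ T:\mathcal{F}\to\mathcal{F}$$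 is a linear automorphism of $\mathcal{F}$, with inverse $v=u^{-1}=\sum_{k=0}^\infty(S_0\circ T)^k:\mathcal{F}\to\mathcal{F}$. (b) The automorphism $v$ of $\mathcal{F}$ transforms $L$ into $L_0$, i.e. $L\circ v=L_0$. (c) If $0$ is an arbitrary (i.e., regular or irregular) singularity of $L$, statements (a) and (b) hold true with $\mathcal{O}$ replaced by the ring $\widehat{\mathcal{O}}$ of formal power series in $x$ over $\mathbb{C}$ or over an arbitrary algebraically closed field $K$ of characteristic $0$.
   Context: $\mathcal{O}$ is the ring of germs at $0$ of holomorphic functions in one variable $x$, and $\partial=\frac{d}{dx}$. Write $L=\sum_{j=0}^n p_j\partial^j=\sum_{j=0}^n\sum_{i\ge0}c_{ij}x^i\partial^j$ with $p_n\neq0$. The shift $\tau$ of $L$ is the minimal value of $i-j$ with $c_{ij}\neq0$; the initial form is $L_0=\sum_{i-j=\tau}c_{ij}x^i\partial^j$. For $\tau=0$ one has $L_0=\sum_{i=0}^nc_{ii}x^i\partial^i$. The indicial polynomial is $\chi(s)=\sum_{i=0}^nc_{ii}\,s(s-1)\cdots(s-i+1)$; its roots are the local exponents of $L$ at $0$, and the multiplicity of a local exponent is its multiplicity as a root of $\chi$. $L$ has a regular singularity at $0$ if $L_0$ has the same order $n$ as $L$, i.e. $c_{nn}\neq0$. Sets of exponents: the set of all local exponents is partitioned into classes $\Omega$ such that the elements of $\Omega$ differ by integers and no local exponent outside $\Omega$ has integer difference with an element of $\Omega$; the elements of $\Omega$ are ordered as $\rho_1<\rho_2<\cdots<\rho_r$,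 meaning $\rho_{k+1}-\rho_k\in\mathbb{N}_{>0}$. Extension of operators: $z$ is a new variable (standing for $\log x$) and $x^\rho$ is subject to $\partial x^\rho=\rho x^{\rho-1}$; $\mathcal{O}x^\rho[z]$ denotes polynomials in $z$ with coefficients in $\mathcal{O}x^\rho$, with the derivation determined by $\partial x=1$, $\partial z=x^{-1}$, and $L$ acts through this derivation. $[z]_{<m}$ means polynomials in $z$ of degree $<m$. $\mathcal{O}x^{\rho+j}\subseteq \mathcal{O}x^\rho$ for $j\in\mathbb{N}$, and $\mathcal{F}x=\sum_{k=1}^r\mathcal{O}x^{\rho_k+1}[z]_{<n_k}$. In (c) the operator has coefficients in $\widehat{\mathcal{O}}$, the base field $\mathbb{C}$ is replaced by $K$ throughout, and $x^\rho$ ($\rho\in K$) are symbols with $\partial x^\rho=\rho x^{\rho-1}$ and $\widehat{\mathcal{O}}x^{\rho+j}\subseteq\widehat{\mathcal{O}}x^\rho$ for $j\in\mathbb{N}$ (via $x^j\cdot x^\rho=x^{\rho+j}$), the derivation on $\widehat{\mathcal{O}}x^\rho[z]$ being determined by this together with $\partial x=1$ and $\partial z=x^{-1}$. *)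

theory Defs
  imports "HOL-Complex_Analysis.Complex_Analysis"
begin

section \<open>Germs of holomorphic functions\<close>

text \<open>A germ at 0 of a holomorphic function is identified with its Taylor expansion; thus the
  ring of germs becomes the ring of convergent power series, see \<open>hol_germs_eq\<close>.\<close>

definition hol_germs :: "complex fps set" where
  "hol_germs = {fps_expansion f 0 | f. f analytic_on {0}}"

lemma hol_germs_eq: "hol_germs = {g. fps_conv_radius g > 0}"
proof (intro equalityI subsetI)
  fix g assume "g \<in> hol_germs"
  then obtain f where "f analytic_on {0}" "g = fps_expansion f 0"
    by (auto simp: hol_germs_def)
  then show "g \<in> {g. fps_conv_radius g > 0}"
    using analytic_at_imp_has_fps_expansion_0[of f] by (auto simp: has_fps_expansion_def)
next
  fix g :: "complex fps" assume "g \<in> {g. fps_conv_radius g > 0}"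
  then have *: "eval_fps g has_fps_expansion g"
    by (simp add: eval_fps_has_fps_expansion)
  then have "eval_fps g analytic_on {0}" "fps_expansion (eval_fps g) 0 = g"
    using has_fps_expansion_imp_analytic_0 fps_expansion_eqI by auto
  then show "g \<in> hol_germs"
    unfolding hol_germs_def by force
qed


section \<open>Differential operators\<close>

text \<open>The operator $\sum_j p_j \partial^j$ is stored as the polynomial over the power series ring
  with coefficients $p_j$, so that its order is the degree and \<open>coeff L j $ i\<close> is $c_{ij}$. The
  commutative product of polynomials plays no role; composition of operators is
  composition of the maps \<open>act b L\<close> below.\<close>

type_synonym 'k diffop = "'k fps poly"

definition shift :: "'k::zero diffop \<Rightarrow> int" where
  "shift L = (LEAST t. \<exists>i j. coeff L j $ i \<noteq> 0 \<and> t = int i - int j)"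

definition initial_form :: "'k::comm_monoid_add diffop \<Rightarrow> 'k diffop" where
  "initial_form L =
     (\<Sum>j\<le>degree L. monom (Abs_fps (\<lambda>i. if int i - int j = shift L then coeff L j $ i else 0)) j)"

text \<open>This is the indicial polynomial of an operator with shift 0.\<close>

definition indicial_poly :: "'k::field diffop \<Rightarrow> 'k poly" where
  "indicial_poly L = (\<Sum>i\<le>degree L. smult (coeff L i $ i) (\<Prod>j<i. [:- of_nat j, 1:]))"

definition regular_singularity :: "'k::comm_monoid_add diffop \<Rightarrow> bool" where
  "regular_singularity L \<longleftrightarrow> degree (initial_form L) = degree L"

text \<open>$\rho_1 < \dots < \rho_r$ lists a full class modulo the integers of local exponents.\<close>

definition exponent_class :: "'k::field diffop \<Rightarrow> (nat \<Rightarrow> 'k) \<Rightarrow> nat \<Rightarrow> bool" where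
  "exponent_class L \<rho> r \<longleftrightarrow>
     r \<ge> 1 \<and>
     (\<forall>k\<in>{1..<r}. \<exists>d::nat. d > 0 \<and> \<rho> (k + 1) - \<rho> k = of_nat d) \<and>
     \<rho> ` {1..r} = {\<sigma>. poly (indicial_poly L) \<sigma> = 0 \<and> \<sigma> - \<rho> 1 \<in> \<int>}"

definition exp_mult :: "'k::field diffop \<Rightarrow> (nat \<Rightarrow> 'k) \<Rightarrow> nat \<Rightarrow> nat" where
  "exp_mult L \<rho> k = order (\<rho> k) (indicial_poly L)"

definition mult_sum :: "'k::field diffop \<Rightarrow> (nat \<Rightarrow> 'k) \<Rightarrow> nat \<Rightarrow> nat" where
  "mult_sum L \<rho> k = (\<Sum>j=1..k. exp_mult L \<rho> j)"


section \<open>Extension by powers of \<open>x\<close> and by the logarithm\<close>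

text \<open>For a fixed base exponent \<open>b\<close>, the polynomial $h = \sum_i h_i z^i$ over the field of formal
  Laurent series stands for the element $x^b h$ of $x^b K((x))[z]$. This space contains
  all $x^\sigma$ with $\sigma - b$ an integer, represented by the Laurent monomial
  $x^{\sigma - b}$; the identifications $x^j x^\rho = x^{\rho + j}$ are thereby built in.\<close>

definition int_diff :: "'k::field \<Rightarrow> 'k \<Rightarrow> int" where
  "int_diff \<sigma> b = (THE k. \<sigma> - b = of_int k)"

definition xpow :: "'k::field \<Rightarrow> 'k \<Rightarrow> 'k fls" where
  "xpow b \<sigma> = fls_X_intpow (int_diff \<sigma> b)"

text \<open>The derivation of $x^b h$, divided by $x^b$; it is determined by $\partial x = 1$,
  $\partial z = x^{-1}$ and $\partial x^b = b x^{b-1}$, as the lemmas below confirm.\<close>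

definition deriv_at :: "'k::field \<Rightarrow> 'k fls poly \<Rightarrow> 'k fls poly" where
  "deriv_at b h = map_poly fls_deriv h + smult (fls_const b * fls_X_inv) h
                    + smult fls_X_inv (pderiv h)"

definition act :: "'k::field \<Rightarrow> 'k diffop \<Rightarrow> 'k fls poly \<Rightarrow> 'k fls poly" where
  "act b L h = (\<Sum>j\<le>degree L. smult (fps_to_fls (coeff L j)) ((deriv_at b ^^ j) h))"

lemma coeff_deriv_at:
  "coeff (deriv_at b h) i =
     fls_deriv (coeff h i) + fls_const b * fls_X_inv * coeff h i
       + fls_X_inv * (of_nat (Suc i) * coeff h (Suc i))"
  by (simp add: deriv_at_def coeff_map_poly coeff_pderiv)

lemma deriv_at_x: "deriv_at 0 [:fls_X:] = (1 :: 'k::field fls poly)"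
  by (simp add: deriv_at_def map_poly_pCons)

lemma deriv_at_z: "deriv_at 0 [:0, 1:] = ([:fls_X_inv:] :: 'k::field fls poly)"
  by (rule poly_eqI) (simp add: coeff_deriv_at coeff_pCons split: nat.split)

lemma deriv_at_mult:
  "deriv_at b (f * h) = deriv_at 0 f * h + f * deriv_at b (h :: 'k::field fls poly)"
proof -
  have "map_poly fls_deriv (f * h) = map_poly fls_deriv f * h + f * map_poly fls_deriv h"
    by (rule poly_eqI)
      (simp add: coeff_map_poly coeff_mult fls_deriv_sum sum.distrib add.commute)
  then show ?thesis
    by (simp add: deriv_at_def pderiv_mult smult_add_right algebra_simps)
qed

lemma int_diff_eq:
  assumes "\<sigma> - b = of_int k"
  shows   "int_diff \<sigma> (b :: 'k::field_char_0) = k"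
  unfolding int_diff_def using assms by (intro the_equality) auto

lemma deriv_at_xpow:
  assumes "\<sigma> - b \<in> \<int>"
  shows   "deriv_at b [:xpow b \<sigma>:] = [:fls_const \<sigma> * xpow b (\<sigma> - 1) :: 'k::field_char_0 fls:]"
proof -
  obtain k where k: "\<sigma> - b = of_int k"
    using assms by (auto elim: Ints_cases)
  then have "(\<sigma> - 1) - b = of_int (k - 1)"
    by simp
  from int_diff_eq[OF k] int_diff_eq[OF this]
  have *: "xpow b \<sigma> = fls_X_intpow k" "xpow b (\<sigma> - 1) = fls_X_intpow (k - 1)"
    by (simp_all add: xpow_def)
  have "\<sigma> = b + of_int k"
    using k by (simp add: algebra_simps)
  moreover have "of_int x + 1 = (of_int k :: 'k)" if "x + (1 - k) = 0" for x
  proof -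
    have "k = x + 1"
      using that by simp
    then show ?thesis
      by simp
  qed
  ultimately have "fls_deriv (xpow b \<sigma>) + fls_const b * fls_X_inv * xpow b \<sigma>
               = fls_const \<sigma> * xpow b (\<sigma> - 1)"
    unfolding * by (intro fls_eqI)
      (auto simp: fls_X_inv_times_conv_shift mult.assoc fls_X_intpow_times_conv_shift)
  then show ?thesis
    by (simp add: deriv_at_def map_poly_pCons)
qed

text \<open>In the following, \<open>A\<close> is the ring of coefficients: either \<^const>\<open>hol_germs\<close> or all power
  series. The base exponent is always \<open>\<rho> 1\<close>.

  \<open>Ox A b \<sigma> m\<close> is $A x^\sigma [z]_{<m}$.\<close>

definition Ox :: "'k::field fps set \<Rightarrow> 'k \<Rightarrow> 'k \<Rightarrow> nat \<Rightarrow> 'k fls poly set" where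
  "Ox A b \<sigma> m = {\<Sum>i<m. monom (fps_to_fls (g i) * xpow b \<sigma>) i | g. \<forall>i<m. g i \<in> A}"

definition space_F :: "'k::field fps set \<Rightarrow> 'k diffop \<Rightarrow> (nat \<Rightarrow> 'k) \<Rightarrow> nat \<Rightarrow> 'k fls poly set" where
  "space_F A L \<rho> r =
     {\<Sum>k=1..r. h k | h. \<forall>k\<in>{1..r}. h k \<in> Ox A (\<rho> 1) (\<rho> k) (mult_sum L \<rho> k)}"

definition space_Fx :: "'k::field fps set \<Rightarrow> 'k diffop \<Rightarrow> (nat \<Rightarrow> 'k) \<Rightarrow> nat \<Rightarrow> 'k fls poly set" where
  "space_Fx A L \<rho> r =
     {\<Sum>k=1..r. h k | h. \<forall>k\<in>{1..r}. h k \<in> Ox A (\<rho> 1) (\<rho> k + 1) (mult_sum L \<rho> k)}"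

text \<open>The sum is direct because the summands involve pairwise different monomials
  $x^\sigma z^i$.\<close>

definition space_H :: "'k::field fps set \<Rightarrow> 'k diffop \<Rightarrow> (nat \<Rightarrow> 'k) \<Rightarrow> nat \<Rightarrow> 'k fls poly set" where
  "space_H A L \<rho> r =
     {(\<Sum>k=2..r. \<Sum>i\<in>{exp_mult L \<rho> k..<mult_sum L \<rho> k}.
          monom (fls_const (a k i) * xpow (\<rho> 1) (\<rho> k)) i)
      + (\<Sum>k\<in>{1..<r}. \<Sum>e\<in>{1..<nat (int_diff (\<rho> (k + 1)) (\<rho> k))}. \<Sum>i<mult_sum L \<rho> k.
          monom (fls_const (c k e i) * xpow (\<rho> 1) (\<rho> k + of_nat e)) i)
      + h | a c h. h \<in> Ox A (\<rho> 1) (\<rho> r + 1) (mult_sum L \<rho> r)}"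


section \<open>The normalizing automorphism\<close>

definition op_L :: "'k::field diffop \<Rightarrow> (nat \<Rightarrow> 'k) \<Rightarrow> 'k fls poly \<Rightarrow> 'k fls poly" where
  "op_L L \<rho> = act (\<rho> 1) L"

definition op_L0 :: "'k::field diffop \<Rightarrow> (nat \<Rightarrow> 'k) \<Rightarrow> 'k fls poly \<Rightarrow> 'k fls poly" where
  "op_L0 L \<rho> = act (\<rho> 1) (initial_form L)"

definition op_T :: "'k::field diffop \<Rightarrow> (nat \<Rightarrow> 'k) \<Rightarrow> 'k fls poly \<Rightarrow> 'k fls poly" where
  "op_T L \<rho> f = op_L0 L \<rho> f - op_L L \<rho> f"

text \<open>The inverse of the restriction of $L_0$ to $\mathcal{H}$; meaningful on \<^const>\<open>space_Fx\<close>.\<close>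

definition op_S0 ::
  "'k::field fps set \<Rightarrow> 'k diffop \<Rightarrow> (nat \<Rightarrow> 'k) \<Rightarrow> nat \<Rightarrow> 'k fls poly \<Rightarrow> 'k fls poly" where
  "op_S0 A L \<rho> r = the_inv_into (space_H A L \<rho> r) (op_L0 L \<rho>)"

definition op_u ::
  "'k::field fps set \<Rightarrow> 'k diffop \<Rightarrow> (nat \<Rightarrow> 'k) \<Rightarrow> nat \<Rightarrow> 'k fls poly \<Rightarrow> 'k fls poly" where
  "op_u A L \<rho> r f = f - (op_S0 A L \<rho> r \<circ> op_T L \<rho>) f"

definition op_v ::
  "'k::field fps set \<Rightarrow> 'k diffop \<Rightarrow> (nat \<Rightarrow> 'k) \<Rightarrow> nat \<Rightarrow> 'k fls poly \<Rightarrow> 'k fls poly" where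
  "op_v A L \<rho> r = the_inv_into (space_F A L \<rho> r) (op_u A L \<rho> r)"

definition linear_automorphism :: "'k::field fls poly set \<Rightarrow> ('k fls poly \<Rightarrow> 'k fls poly) \<Rightarrow> bool" where
  "linear_automorphism F u \<longleftrightarrow>
     bij_betw u F F \<and>
     (\<forall>f\<in>F. \<forall>g\<in>F. u (f + g) = u f + u g) \<and>
     (\<forall>c. \<forall>f\<in>F. u (smult (fls_const c) f) = smult (fls_const c) (u f))"

text \<open>Coefficientwise convergence of a series with respect to the $x$-adic topology, which is the
  topology of the type of formal Laurent series.\<close>

definition xadic_sums :: "(nat \<Rightarrow> 'k::field fls poly) \<Rightarrow> 'k fls poly \<Rightarrow> bool" where
  "xadic_sums g h \<longleftrightarrow> (\<forall>i. (\<lambda>k. coeff (g k) i) sums coeff h i)"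

text \<open>Convergence of a series of germs: all terms and the sum are holomorphic on a common disc and
  the partial sums converge uniformly there. It is used only for elements of
  $\mathcal{O} x^b [z]$, whose coefficients coincide with their regular parts.\<close>

definition germ_sums :: "(nat \<Rightarrow> complex fls poly) \<Rightarrow> complex fls poly \<Rightarrow> bool" where
  "germ_sums g h \<longleftrightarrow> (\<exists>s>0. \<forall>i.
     (\<forall>k. ereal s \<le> fps_conv_radius (fls_regpart (coeff (g k) i))) \<and>
     ereal s \<le> fps_conv_radius (fls_regpart (coeff h i)) \<and>
     uniform_limit (ball 0 s)
       (\<lambda>N x. \<Sum>k<N. eval_fps (fls_regpart (coeff (g k) i)) x)
       (eval_fps (fls_regpart (coeff h i))) sequentially)"

end

theory Submission
  imports Defs
begin

text \<open>
  Expand an element of $\mathcal{F}$ as $\sum_d x^{\rho_1 + d} h_d(z)$. Since $x\partial$ acts on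
  $x^\sigma h(z)$ as $\sigma + \partial_z$, the operator $L_0$ acts on the slice $h_d$ as
  $\chi(\rho_1 + d + \partial_z)$, and $T$ strictly raises $d$. If $m(d)$ is the multiplicity of
  $\rho_1 + d$ as a root of $\chi$ and $N(d) = \sum_{t \le d} m(t)$, then the slices are the
  polynomials of degree below $N(d)$ for $\mathcal{F}$, those of degree below $N(d-1)$ for
  $\mathcal{F}x$, and those spanned by $z^{m(d)}, \ldots, z^{N(d)-1}$ for $\mathcal{H}$.
  As $\chi(\rho_1 + d + \partial_z)$ is $\partial_z^{m(d)}$ times an invertible power series in
  $\partial_z$, it maps the third space bijectively onto the second. Hence $S_0$ exists, $S_0 T$ is
  $x$-adically contracting and $u$ is invertible; $L = L_0 \circ u$ follows from $L_0 S_0 = 1$.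
  In the holomorphic case regularity gives $\chi$ the degree $n$ of $L$, so the inverse of
  $\chi(\rho_1 + d + \partial_z)$ decays like $d^{-n}$ and compensates the growth caused by the
  derivatives in $T$. Therefore $S_0 T$ halves the norm $\sup_d |h_d| Q^{-d}$ once $Q$ is large.
\<close>

unbundle no vec_syntax

section \<open>Operators $w(\partial_z)$ and slices\<close>

text \<open>The holomorphic and the formal case share one argument, run on sequences of slices
  instead of series. An equation in \<open>F\<close> becomes a recursion in which slice d depends on
  earlier slices only, so solutions exist and are unique without any completeness of
  \<open>F\<close>. The coefficient ring enters only when a sequence of slices has to assemble to
  series with coefficients in \<open>A\<close>; three closure conditions collect these places. For
  all power series they are trivial, for germs they are the analytic content. The obstacle there is
  that derivatives cost a factor of order d^n at slice d. Left alone, it would accumulate along the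
  recursion to about (d!)^n, which no geometric bound absorbs; it has to be cancelled at every
  single step. No single Q serves all of \<open>F\<close>, since each element has its own radius of
  convergence. The contraction is therefore proved for every Q above a bound that depends only on
  the operator and its exponents, and Q is then chosen for each element.\<close>

lemma coeff_pderiv_pow:
  fixes p :: "'k::field_char_0 poly"
  shows "coeff ((pderiv ^^ l) p) i = pochhammer (of_nat (Suc i)) l * coeff p (i + l)"
proof (induction l arbitrary: i)
  case (Suc l)
  then show ?case
    by (simp add: coeff_pderiv pochhammer_rec algebra_simps)
qed auto

lemma pderiv_pow_eq_0:
  fixes p :: "'k::field_char_0 poly"
  assumes "degree p < l"
  shows "(pderiv ^^ l) p = 0"
  using assms by (intro poly_eqI) (simp add: coeff_pderiv_pow coeff_eq_0)

lemma pderiv_pow_add: "(pderiv ^^ l) (p + q) = (pderiv ^^ l) p + (pderiv ^^ l) (q :: 'k::field_char_0 poly)"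
  by (induction l) (auto simp: pderiv_add)

lemma pderiv_pow_smult: "(pderiv ^^ l) (smult c p) = smult c ((pderiv ^^ l) (p :: 'k::field_char_0 poly))"
  by (induction l) (auto simp: pderiv_smult)

lemma pderiv_pow_0 [simp]: "(pderiv ^^ l) 0 = (0 :: 'k::field_char_0 poly)"
  by (induction l) auto

lemma pderiv_pow_sum: "(pderiv ^^ l) (sum f A) = (\<Sum>x\<in>A. (pderiv ^^ l) (f x :: 'k::field_char_0 poly))"
  by (induction A rule: infinite_finite_induct) (auto simp: pderiv_pow_add)

lemma smult_sum_right: "smult c (sum f A) = (\<Sum>x\<in>A. smult c (f x))"
  by (induction A rule: infinite_finite_induct) (auto simp: smult_add_right)

definition series_D :: "'k::field_char_0 fps \<Rightarrow> 'k poly \<Rightarrow> 'k poly" where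
  "series_D w p = (\<Sum>l\<le>degree p. smult (w $ l) ((pderiv ^^ l) p))"

lemma series_D_bound:
  assumes "degree p \<le> n"
  shows "series_D w p = (\<Sum>l\<le>n. smult (w $ l) ((pderiv ^^ l) p))"
  unfolding series_D_def using assms
  by (intro sum.mono_neutral_left) (auto simp: pderiv_pow_eq_0)

lemma series_D_bound':
  assumes "\<And>i. i \<ge> n \<Longrightarrow> coeff p i = 0"
  shows "series_D w p = (\<Sum>l<n. smult (w $ l) ((pderiv ^^ l) p))"
proof (cases "p = 0")
  case False
  then have "degree p < n"
    using assms[of "degree p"] by (metis leading_coeff_0_iff not_le)
  then show ?thesis
    unfolding series_D_def
    by (intro sum.mono_neutral_left) (auto simp: pderiv_pow_eq_0)
qed (simp add: series_D_def)

lemma series_D_0_right [simp]: "series_D w 0 = 0"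
  by (simp add: series_D_def)

lemma series_D_0_left [simp]: "series_D 0 p = 0"
  by (simp add: series_D_def)

lemma series_D_1 [simp]: "series_D 1 p = p"
proof -
  have "series_D 1 p = (\<Sum>l\<in>{0}. smult (1 $ l) ((pderiv ^^ l) p))"
    unfolding series_D_def by (intro sum.mono_neutral_right) auto
  then show ?thesis by simp
qed

lemma series_D_add_right: "series_D w (p + q) = series_D w p + series_D w q"
proof -
  define n where "n = max (degree p) (degree q)"
  have "degree (p + q) \<le> n" "degree p \<le> n" "degree q \<le> n"
    by (auto simp: n_def degree_add_le)
  then show ?thesis
    by (simp add: series_D_bound pderiv_pow_add smult_add_right sum.distrib)
qed

lemma series_D_smult_right: "series_D w (smult c p) = smult c (series_D w p)"
  by (simp add: series_D_bound[of "smult c p" "degree p"] series_D_bound[of p "degree p"] degree_smult_le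
        pderiv_pow_smult smult_sum_right mult.commute)

lemma series_D_minus_right: "series_D w (- p) = - series_D w p"
  using series_D_smult_right[of w "-1" p] by simp

lemma series_D_diff_right: "series_D w (p - q) = series_D w p - series_D w q"
  using series_D_add_right[of w p "-q"] by (simp add: series_D_minus_right)

lemma series_D_add_left: "series_D (v + w) p = series_D v p + series_D w p"
  by (simp add: series_D_def smult_add_left sum.distrib)

lemma series_D_const_mult_left: "series_D (fps_const c * w) p = smult c (series_D w p)"
  by (simp add: series_D_def smult_sum_right)

lemma series_D_sum_left: "series_D (sum f A) p = (\<Sum>x\<in>A. series_D (f x) p)"
  by (induction A rule: infinite_finite_induct) (auto simp: series_D_add_left)

lemma degree_pderiv_pow_le: "degree ((pderiv ^^ l) p) \<le> degree (p :: 'k::field_char_0 poly)"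
  by (induction l) (auto simp: degree_pderiv)

text \<open>The Cauchy product matches composition because \<partial>^(i+j) p = 0 once i + j exceeds
  the degree of p. Polynomials thus become a module over the power series ring, and a series with
  nonzero constant term acts invertibly.\<close>

lemma series_D_mult_left: "series_D (v * w) p = series_D v (series_D w p)"
proof -
  define n where "n = degree p"
  have zero: "l \<le> n" if "(pderiv ^^ l) p \<noteq> 0" for l
    using that pderiv_pow_eq_0[of p l] by (auto simp: n_def not_less[symmetric])
  have "degree (series_D w p) \<le> n"
    unfolding series_D_def
    by (intro degree_sum_le) (auto simp: n_def intro: degree_pderiv_pow_le)
  then have "series_D v (series_D w p) = (\<Sum>i\<le>n. \<Sum>j\<le>n. smult (v $ i * w $ j) ((pderiv ^^ (i + j)) p))"
    by (subst series_D_bound[of "series_D w p" n])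
      (simp_all add: series_D_bound[of p n] n_def pderiv_pow_sum pderiv_pow_smult smult_sum_right funpow_add)
  also have "\<dots> = (\<Sum>(i, j)\<in>{..n} \<times> {..n}. smult (v $ i * w $ j) ((pderiv ^^ (i + j)) p))"
    by (simp add: sum.cartesian_product)
  also have "\<dots> = (\<Sum>(i, j)\<in>{(i, j). i + j \<le> n}. smult (v $ i * w $ j) ((pderiv ^^ (i + j)) p))"
    by (intro sum.mono_neutral_right) (auto intro: zero)
  also have "\<dots> = (\<Sum>l\<le>n. \<Sum>i\<le>l. smult (v $ i * w $ (l - i)) ((pderiv ^^ l) p))"
    by (subst sum.triangle_reindex_eq) (auto intro!: sum.cong)
  also have "\<dots> = series_D (v * w) p"
    by (simp add: series_D_bound[of p n] n_def fps_mult_nth smult_sum atLeast0AtMost)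
  finally show ?thesis ..
qed

lemma coeff_series_D_eq_0:
  assumes "\<And>i. i \<ge> n \<Longrightarrow> coeff p i = 0" "i \<ge> n"
  shows "coeff (series_D w p) i = 0"
  using assms by (simp add: series_D_def coeff_sum coeff_pderiv_pow)

lemma series_D_X_power: "series_D (fps_X ^ m) p = (pderiv ^^ m) p"
proof -
  define n where "n = max (degree p) m"
  have "series_D (fps_X ^ m) p = (\<Sum>l\<in>{m}. smult ((fps_X ^ m) $ l) ((pderiv ^^ l) p))"
    by (subst series_D_bound[of p n], simp add: n_def, intro sum.mono_neutral_right)
      (auto simp: n_def fps_X_power_nth)
  then show ?thesis by simp
qed

text \<open>The antiderivative without constant term: its m-th iterate has values divisible by z^m,
  which is the condition that \<open>space_H\<close> puts on a slice.\<close>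

definition poly_integral :: "'k::field_char_0 poly \<Rightarrow> 'k poly" where
  "poly_integral p = pCons 0 (\<Sum>i\<le>degree p. monom (coeff p i / of_nat (Suc i)) i)"

lemma coeff_poly_integral:
  "coeff (poly_integral p) i = (case i of 0 \<Rightarrow> 0 | Suc j \<Rightarrow> coeff p j / of_nat (Suc j))"
  by (cases i) (auto simp: poly_integral_def coeff_sum coeff_eq_0)

lemma pderiv_poly_integral [simp]: "pderiv (poly_integral p) = p"
  by (rule poly_eqI) (simp add: coeff_pderiv coeff_poly_integral del: of_nat_Suc)

lemma pderiv_pow_poly_integral_pow [simp]: "(pderiv ^^ m) ((poly_integral ^^ m) p) = p"
proof (induction m arbitrary: p)
  case (Suc m)
  have "(pderiv ^^ Suc m) ((poly_integral ^^ Suc m) p)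
        = pderiv ((pderiv ^^ m) ((poly_integral ^^ m) (poly_integral p)))"
    by (simp add: funpow_swap1)
  then show ?case by (simp add: Suc)
qed simp

lemma coeff_poly_integral_pow_low: "i < m \<Longrightarrow> coeff ((poly_integral ^^ m) p) i = 0"
  by (induction m arbitrary: i) (auto simp: coeff_poly_integral split: nat.split)

lemma coeff_poly_integral_pow_high:
  assumes "\<And>i. i \<ge> n \<Longrightarrow> coeff p i = 0" "i \<ge> n + m"
  shows "coeff ((poly_integral ^^ m) p) i = 0"
  using assms(2) 
  by (induction m arbitrary: i) (auto simp: coeff_poly_integral assms(1) split: nat.split)

text \<open>The operator $q(\sigma + \partial_z)$.\<close>

definition shifted_D :: "'k::field_char_0 poly \<Rightarrow> 'k \<Rightarrow> 'k poly \<Rightarrow> 'k poly" where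
  "shifted_D q \<sigma> = series_D (fps_of_poly (q \<circ>\<^sub>p [:\<sigma>, 1:]))"

lemma shifted_D_mult: "shifted_D (q1 * q2) \<sigma> p = shifted_D q1 \<sigma> (shifted_D q2 \<sigma> p)"
  by (simp add: shifted_D_def pcompose_mult fps_of_poly_mult series_D_mult_left)

lemma shifted_D_smult_left: "shifted_D (smult c q) \<sigma> p = smult c (shifted_D q \<sigma> p)"
  by (simp add: shifted_D_def pcompose_smult fps_of_poly_smult series_D_const_mult_left)

lemma shifted_D_sum_left: "shifted_D (sum f A) \<sigma> p = (\<Sum>x\<in>A. shifted_D (f x) \<sigma> p)"
  by (simp add: shifted_D_def pcompose_sum fps_of_poly_sum series_D_sum_left)

lemma shifted_D_0_left [simp]: "shifted_D 0 \<sigma> p = 0"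
  by (simp add: shifted_D_def)

lemma shifted_D_1 [simp]: "shifted_D 1 \<sigma> p = p"
  by (simp add: shifted_D_def pcompose_1)

lemma shifted_D_linear: "shifted_D [:c, 1:] \<sigma> p = smult (\<sigma> + c) p + pderiv p"
proof -
  have "fps_of_poly ([:c, 1:] \<circ>\<^sub>p [:\<sigma>, 1:]) = fps_const (\<sigma> + c) * 1 + fps_X ^ 1"
    by (simp add: pcompose_pCons fps_of_poly_linear algebra_simps)
  then show ?thesis
    unfolding shifted_D_def by (simp only: series_D_add_left series_D_const_mult_left series_D_X_power) simp
qed

lemma coeff_shifted_D_eq_0:
  assumes "\<And>i. i \<ge> n \<Longrightarrow> coeff p i = 0" "i \<ge> n"
  shows "coeff (shifted_D q \<sigma> p) i = 0"
  using coeff_series_D_eq_0[OF assms] by (simp add: shifted_D_def)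

lemma shifted_D_0_right [simp]: "shifted_D q \<sigma> 0 = 0"
  by (simp add: shifted_D_def)

text \<open>The falling factorial s(s-1)...(s-j+1), by which x^j \<partial>^j acts on x^s.\<close>

definition falling_poly :: "nat \<Rightarrow> 'k::field_char_0 poly" where
  "falling_poly j = (\<Prod>l<j. [:- of_nat l, 1:])"

text \<open>This is x^(j+1) \<partial>^(j+1) = (x \<partial> - j) x^j \<partial>^j. As a recursion
  it drives both the formula for iterated derivatives and the norm estimates.\<close>

lemma shifted_D_falling_poly_Suc:
  "shifted_D (falling_poly (Suc j)) \<sigma> p = smult (\<sigma> - of_nat j) (shifted_D (falling_poly j) \<sigma> p) + pderiv (shifted_D (falling_poly j) \<sigma> p)"
proof -
  have "falling_poly (Suc j) = [:- of_nat j, 1:] * (falling_poly j :: 'a poly)"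
    by (simp add: falling_poly_def mult.commute del: mult_pCons_left mult_pCons_right)
  then show ?thesis
    by (simp add: shifted_D_mult shifted_D_linear del: mult_pCons_left)
qed

section \<open>Slices: the coefficients of the powers of x, as polynomials in z\<close>

definition slice :: "int \<Rightarrow> 'k::zero fls poly \<Rightarrow> 'k poly" where
  "slice d = map_poly (\<lambda>c. fls_nth c d)"

lemma coeff_slice [simp]: "coeff (slice d h) i = fls_nth (coeff h i) d"
  by (simp add: slice_def coeff_map_poly)

lemma slice_eqI: "(\<And>d. slice d g = slice d h) \<Longrightarrow> g = h"
  by (intro poly_eqI fls_eqI) (metis coeff_slice)

lemma slice_add: "slice d (g + h) = slice d g + slice d h"
  and slice_diff: "slice d (f' - h') = slice d f' - slice d h'"
  by (auto intro!: poly_eqI)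

lemma slice_0 [simp]: "slice d 0 = 0"
  by (auto intro!: poly_eqI)

lemma fls_nth_sum: "fls_nth (sum f A) d = (\<Sum>x\<in>A. fls_nth (f x) d)"
  by (induction A rule: infinite_finite_induct) auto

lemma slice_sum: "slice d (sum f A) = (\<Sum>x\<in>A. slice d (f x))"
  by (induction A rule: infinite_finite_induct) (auto simp: slice_add)

lemma slice_smult_const: "slice d (smult (fls_const c) h) = smult c (slice d (h :: 'k::field fls poly))"
  by (auto intro!: poly_eqI)

text \<open>Because \<partial> z = 1/x, the derivative of x^(b+d+1) g(z) is x^(b+d) ((b+d+1) g +
  g'); slice d therefore comes from slice d + 1.\<close>

lemma slice_deriv_at:
  fixes h :: "'k::field_char_0 fls poly"
  shows "slice d (deriv_at b h)
           = smult (b + of_int (d + 1)) (slice (d + 1) h) + pderiv (slice (d + 1) h)"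
proof (rule poly_eqI)
  fix i
  have "fls_nth (fls_const b * fls_X_inv * coeff h i) d = b * fls_nth (coeff h i) (d + 1)"
    by (subst mult.assoc) (simp add: fls_X_inv_times_conv_shift del: mult.assoc)
  moreover have "fls_nth (fls_X_inv * (of_nat (Suc i) * coeff h (Suc i))) d
                   = of_nat (Suc i) * fls_nth (coeff h (Suc i)) (d + 1)"
    by (simp only: fls_X_inv_times_conv_shift fls_shift_nth fls_mult_of_nat_nth)
  ultimately show "coeff (slice d (deriv_at b h)) i
    = coeff (smult (b + of_int (d + 1)) (slice (d + 1) h) + pderiv (slice (d + 1) h)) i"
    by (simp add: coeff_deriv_at coeff_pderiv distrib_right del: of_nat_Suc)
qed

lemma slice_deriv_at_pow:
  fixes h :: "'k::field_char_0 fls poly"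
  shows "slice d ((deriv_at b ^^ j) h) = shifted_D (falling_poly j) (b + of_int (d + int j)) (slice (d + int j) h)"
proof (induction j arbitrary: d)
  case 0
  then show ?case by (simp add: falling_poly_def)
next
  case (Suc j)
  then show ?case
    by (simp add: slice_deriv_at shifted_D_falling_poly_Suc algebra_simps)
qed

text \<open>A Laurent series with support bounded below is a shifted power series, so the product is
  a finite convolution. The bound \<open>lo\<close> will be -j, since j derivatives lower the
  exponents by j.\<close>

lemma fls_nth_fps_mult:
  fixes f :: "'k::field fls"
  assumes "\<And>d. d < lo \<Longrightarrow> fls_nth f d = 0"
  shows "fls_nth (fps_to_fls c * f) d = (if d < lo then 0 else \<Sum>k\<le>nat (d - lo). c $ k * fls_nth f (d - int k))"
proof -
  define F where "F = Abs_fps (\<lambda>i. fls_nth f (int i + lo))"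
  have f: "f = fls_shift (-lo) (fps_to_fls F)"
    by (rule fls_eqI) (auto simp: F_def assms)
  have "fps_to_fls c * f = fls_shift (-lo) (fps_to_fls (c * F))"
    unfolding f by (simp add: fls_shifted_times_simps fls_times_fps_to_fls)
  then show ?thesis
    by (auto simp: fps_mult_nth F_def atLeast0AtMost of_nat_diff intro!: sum.cong)
qed

text \<open>The part of $M$ raising powers of $x$ by $e$ maps $x^\sigma h(z)$ to
  $x^{\sigma + e}$ times \<open>shifted_D (chi M e) \<sigma> h\<close>.\<close>

definition chi :: "'k::field_char_0 diffop \<Rightarrow> nat \<Rightarrow> 'k poly" where
  "chi M e = (\<Sum>j\<le>degree M. smult (coeff M j $ (j + e)) (falling_poly j))"

lemma slice_smult_fps:
  fixes f :: "'k::field fls poly"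
  assumes "\<And>d. d < lo \<Longrightarrow> slice d f = 0"
  shows "slice d (smult (fps_to_fls c) f)
           = (if d < lo then 0 else \<Sum>k\<le>nat (d - lo). smult (c $ k) (slice (d - int k) f))"
proof (rule poly_eqI)
  fix i
  have "fls_nth (coeff f i) d = 0" if "d < lo" for d
    using assms[OF that] by (metis coeff_0 coeff_slice)
  from fls_nth_fps_mult[OF this]
  show "coeff (slice d (smult (fps_to_fls c) f)) i
      = coeff (if d < lo then 0 else \<Sum>k\<le>nat (d - lo). smult (c $ k) (slice (d - int k) f)) i"
    by (simp add: coeff_sum)
qed

text \<open>The derivatives lower exponents by j and c has order at least j, so nothing falls below
  exponent 0. The surviving indices of c are k = j + e, where e is the net rise.\<close>

lemma slice_act_aux:
  fixes h :: "'k::field_char_0 fls poly" and c :: "'k fps"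
  assumes "\<And>d. d < 0 \<Longrightarrow> slice d h = 0" and c: "\<And>i. i < j \<Longrightarrow> c $ i = 0"
  shows "slice d (smult (fps_to_fls c) ((deriv_at b ^^ j) h)) = (if d < 0 then 0 else
           (\<Sum>e\<le>nat d. smult (c $ (j + e))
              (shifted_D (falling_poly j) (b + of_nat (nat d - e)) (slice (int (nat d - e)) h))))"
proof (cases "d < - int j")
  case True
  have "slice d' ((deriv_at b ^^ j) h) = 0" if "d' < - int j" for d'
    using that assms by (simp add: slice_deriv_at_pow)
  from slice_smult_fps[OF this] True show ?thesis by auto
next
  case False
  have "slice d' ((deriv_at b ^^ j) h) = 0" if "d' < - int j" for d'
    using that assms by (simp add: slice_deriv_at_pow)
  from slice_smult_fps[OF this] False
  have *: "slice d (smult (fps_to_fls c) ((deriv_at b ^^ j) h))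
     = (\<Sum>k\<le>nat (d + int j). smult (c $ k) (slice (d - int k) ((deriv_at b ^^ j) h)))"
    by auto
  show ?thesis
  proof (cases "d < 0")
    case True
    have "(\<Sum>k\<le>nat (d + int j). smult (c $ k) (slice (d - int k) ((deriv_at b ^^ j) h))) = 0"
      using True False by (intro sum.neutral) (auto intro!: c)
    then show ?thesis using * True by simp
  next
    case nn: False
    have "(\<Sum>k\<le>nat (d + int j). smult (c $ k) (slice (d - int k) ((deriv_at b ^^ j) h)))
        = (\<Sum>k\<in>(\<lambda>e. j + e) ` {..nat d}. smult (c $ k) (slice (d - int k) ((deriv_at b ^^ j) h)))"
    proof (rule sum.mono_neutral_right)
      have "k < j" if "k \<le> nat (d + int j)" "k \<notin> (\<lambda>e. j + e) ` {..nat d}" for k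
      proof (rule ccontr)
        assume "\<not> k < j"
        then have "k = j + (k - j)" "k - j \<le> nat d" using that nn by auto
        with that show False by blast
      qed
      then show "\<forall>k\<in>{..nat (d + int j)} - (\<lambda>e. j + e) ` {..nat d}.
          smult (c $ k) (slice (d - int k) ((deriv_at b ^^ j) h)) = 0"
        using c by auto
    qed (use nn in auto)
    also have "\<dots> = (\<Sum>e\<le>nat d. smult (c $ (j + e)) (slice (d - int (j + e)) ((deriv_at b ^^ j) h)))"
      by (subst sum.reindex) (auto simp: inj_on_def)
    also have "\<dots> = (\<Sum>e\<le>nat d. smult (c $ (j + e))
              (shifted_D (falling_poly j) (b + of_nat (nat d - e)) (slice (int (nat d - e)) h)))"
    proof (intro sum.cong refl)
      fix e assume "e \<in> {..nat d}"
      then have e: "int (nat d - e) = d - int e" using nn by auto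
      then have "of_nat (nat d - e) = (of_int (d - int e) :: 'k)"
        by (metis of_int_of_nat_eq)
      then show "smult (c $ (j + e)) (slice (d - int (j + e)) ((deriv_at b ^^ j) h)) =
          smult (c $ (j + e)) (shifted_D (falling_poly j) (b + of_nat (nat d - e)) (slice (int (nat d - e)) h))"
        by (simp add: slice_deriv_at_pow e)
    qed
    finally show ?thesis using * nn by simp
  qed
qed

lemma slice_act_neg:
  fixes h :: "'k::field_char_0 fls poly"
  assumes "\<And>d. d < 0 \<Longrightarrow> slice d h = 0" "\<And>i j. i < j \<Longrightarrow> coeff M j $ i = 0" "d < 0"
  shows "slice d (act b M h) = 0"
  using assms by (simp add: act_def slice_sum slice_act_aux)

lemma slice_act:
  fixes h :: "'k::field_char_0 fls poly"
  assumes "\<And>d. d < 0 \<Longrightarrow> slice d h = 0" "\<And>i j. i < j \<Longrightarrow> coeff M j $ i = 0"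
  shows "slice (int d) (act b M h)
           = (\<Sum>e\<le>d. shifted_D (chi M e) (b + of_nat (d - e)) (slice (int (d - e)) h))"
proof -
  have "slice (int d) (act b M h) = (\<Sum>j\<le>degree M. \<Sum>e\<le>d. smult (coeff M j $ (j + e))
              (shifted_D (falling_poly j) (b + of_nat (d - e)) (slice (int (d - e)) h)))"
    using assms by (simp add: act_def slice_sum slice_act_aux)
  also have "\<dots> = (\<Sum>e\<le>d. \<Sum>j\<le>degree M. smult (coeff M j $ (j + e))
              (shifted_D (falling_poly j) (b + of_nat (d - e)) (slice (int (d - e)) h)))"
    by (rule sum.swap)
  finally show ?thesis
    by (simp add: chi_def shifted_D_sum_left shifted_D_smult_left)
qed

section \<open>The indicial polynomial and the exponents\<close>

text \<open>\<open>shift\<close> is a \<open>LEAST\<close> over the integers, whose existence is not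
  automatic. The differences i - j are at least minus the order of L, so adding the order moves the
  search to the naturals, where the minimum is attained.\<close>

lemma
  assumes "L \<noteq> 0" "shift (L :: 'k::field_char_0 diffop) = 0"
  shows shift_eq_0D_below: "i < j \<Longrightarrow> coeff L j $ i = 0"
    and shift_eq_0D_ex: "\<exists>j. coeff L j $ j \<noteq> 0"
proof -
  define P where "P t \<longleftrightarrow> (\<exists>i j. coeff L j $ i \<noteq> 0 \<and> t = int i - int j)" for t :: int
  have lower: "- int (degree L) \<le> t" if t: "P t" for t
  proof -
    obtain i j where "coeff L j $ i \<noteq> 0" "t = int i - int j"
      using t unfolding P_def by blast
    moreover from this have "j \<le> degree L"
      by (intro le_degree) auto
    ultimately show ?thesis by simp
  qed
  have "coeff L (degree L) \<noteq> 0"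
    using assms by simp
  then obtain i0 where "coeff L (degree L) $ i0 \<noteq> 0"
    by (meson fps_nonzero_nth)
  then have ex: "P (int i0 - int (degree L))"
    by (auto simp: P_def)
  define m where "m = (LEAST m. P (int m - int (degree L)))"
  have Pm: "P (int m - int (degree L))"
    unfolding m_def using ex by (rule LeastI)
  have min: "int m - int (degree L) \<le> t" if "P t" for t
  proof -
    have "P (int (nat (t + int (degree L))) - int (degree L))"
      using that lower[OF that] by simp
    then have "m \<le> nat (t + int (degree L))"
      unfolding m_def by (rule Least_le)
    then show ?thesis
      using lower[OF that] by linarith
  qed
  have "shift L = int m - int (degree L)"
    unfolding shift_def P_def[symmetric] using Pm min by (rule Least_equality)
  show "coeff L j $ i = 0" if "i < j"
  proof (rule ccontr)
    assume "coeff L j $ i \<noteq> 0"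
    then have "P (int i - int j)" by (auto simp: P_def)
    from min[OF this] that \<open>shift L = int m - int (degree L)\<close> assms(2) show False by simp
  qed
  from \<open>shift L = int m - int (degree L)\<close> Pm assms have "P 0" by simp
  then show "\<exists>j. coeff L j $ j \<noteq> 0"
    by (auto simp: P_def)
qed

lemma degree_falling_poly: "degree (falling_poly j :: 'k::field_char_0 poly) = j"
  and lead_coeff_falling_poly: "coeff (falling_poly j :: 'k::field_char_0 poly) j = 1"
proof -
  show "degree (falling_poly j :: 'k poly) = j"
    unfolding falling_poly_def by (subst degree_prod_eq_sum_degree) auto
  moreover have "lead_coeff (falling_poly j :: 'k poly) = 1"
    unfolding falling_poly_def by (simp add: lead_coeff_prod)
  ultimately show "coeff (falling_poly j :: 'k poly) j = 1"
    by metis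
qed

lemma indicial_poly_eq_chi: "indicial_poly L = chi L 0"
  by (simp add: indicial_poly_def chi_def falling_poly_def)

text \<open>The j-th falling factorial is monic of degree j, so summands with j < m do not reach
  degree m.\<close>

lemma coeff_indicial_poly_top:
  fixes L :: "'k::field_char_0 diffop"
  assumes "\<And>j. j > m \<Longrightarrow> coeff L j $ j = 0" "m \<le> degree L"
  shows "coeff (indicial_poly L) m = coeff L m $ m"
proof -
  have "coeff (indicial_poly L) m
      = (\<Sum>j\<le>degree L. coeff L j $ j * coeff (falling_poly j) m)"
    by (simp add: indicial_poly_eq_chi chi_def coeff_sum)
  also have "\<dots> = (\<Sum>j\<in>{m}. coeff L j $ j * coeff (falling_poly j) m)"
  proof (intro sum.mono_neutral_right ballI)
    fix j assume "j \<in> {..degree L} - {m}"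
    then consider "j < m" | "j > m" by force
    then show "coeff L j $ j * coeff (falling_poly j) m = 0"
      using assms(1)[of j] by cases (auto simp: coeff_eq_0 degree_falling_poly)
  qed (use assms in auto)
  finally show ?thesis
    by (simp add: lead_coeff_falling_poly)
qed

text \<open>Falling factorials are linearly independent: at the largest j with nonzero diagonal
  coefficient nothing can cancel.\<close>

lemma indicial_poly_nonzero:
  fixes L :: "'k::field_char_0 diffop"
  assumes "coeff L j $ j \<noteq> 0"
  shows "indicial_poly L \<noteq> 0"
proof -
  define m where "m = Max {j. coeff L j $ j \<noteq> 0}"
  have sub: "{j. coeff L j $ j \<noteq> 0} \<subseteq> {..degree L}"
    by (auto intro!: le_degree)
  then have fin: "finite {j. coeff L j $ j \<noteq> 0}"
    by (rule finite_subset) auto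
  then have "m \<in> {j. coeff L j $ j \<noteq> 0}"
    unfolding m_def using assms by (intro Max_in) auto
  moreover have "coeff L j $ j = 0" if "j > m" for j
    using Max_ge[OF fin, of j] that unfolding m_def by (auto simp: not_less[symmetric])
  ultimately have "coeff (indicial_poly L) m \<noteq> 0"
    using sub coeff_indicial_poly_top[of m L] by auto
  then show ?thesis by auto
qed

lemma coeff_initial_form:
  fixes L :: "'k::field_char_0 diffop"
  assumes "shift L = 0"
  shows "coeff (initial_form L) j = fps_const (coeff L j $ j) * fps_X ^ j"
proof (cases "j \<le> degree L")
  case True
  have "coeff (initial_form L) j = Abs_fps (\<lambda>i. if i = j then coeff L j $ i else 0)"
    using True by (simp add: initial_form_def coeff_sum assms)
  also have "\<dots> = fps_const (coeff L j $ j) * fps_X ^ j"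
    by (rule fps_ext) (auto simp: fps_X_power_nth)
  finally show ?thesis .
next
  case False
  then show ?thesis
    by (simp add: initial_form_def coeff_sum coeff_eq_0)
qed

lemma degree_initial_form_le: "degree (initial_form L) \<le> degree L"
  unfolding initial_form_def by (intro degree_sum_le) (auto intro: order_trans[OF degree_monom_le])

text \<open>The initial form is homogeneous, hence acts on each slice separately.\<close>

lemma chi_initial_form:
  fixes L :: "'k::field_char_0 diffop"
  assumes "shift L = 0"
  shows "chi (initial_form L) e = (if e = 0 then indicial_poly L else 0)"
proof -
  have "chi (initial_form L) e = (\<Sum>j\<le>degree L. smult (coeff (initial_form L) j $ (j + e)) (falling_poly j))"
    unfolding chi_def using degree_initial_form_le[of L]
    by (intro sum.mono_neutral_left) (auto simp: coeff_eq_0)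
  then show ?thesis
    using assms by (auto simp: coeff_initial_form fps_X_power_nth indicial_poly_eq_chi chi_def)
qed

section \<open>Subspaces cut out by a set of admissible monomials x^(\<rho> 1 + d) z^i\<close>

definition supp_space :: "'k::field fps set \<Rightarrow> (nat \<Rightarrow> nat \<Rightarrow> bool) \<Rightarrow> 'k fls poly set" where
  "supp_space A S = {h. (\<forall>d<0. slice d h = 0) \<and> (\<forall>i. fls_regpart (coeff h i) \<in> A) \<and>
                 (\<forall>d i. coeff (slice (int d) h) i \<noteq> 0 \<longrightarrow> S d i)}"

lemma supp_spaceD:
  assumes "h \<in> supp_space A S"
  shows "d < 0 \<Longrightarrow> slice d h = 0" "fls_regpart (coeff h i) \<in> A"
        "\<not> S n i \<Longrightarrow> coeff (slice (int n) h) i = 0"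
  using assms by (auto simp: supp_space_def)

lemma fps_to_fls_regpart:
  assumes "\<And>d. d < 0 \<Longrightarrow> fls_nth f d = 0"
  shows "fps_to_fls (fls_regpart f) = f"
  by (rule fls_eqI) (use assms in auto)

text \<open>Negative slices vanish, so the regular part loses nothing; this is why membership in
  \<open>A\<close> can be stated for power series.\<close>

lemma supp_space_coeff:
  assumes "h \<in> supp_space A S"
  shows "coeff h i = fps_to_fls (fls_regpart (coeff h i))"
proof -
  have "fls_nth (coeff h i) d = 0" if "d < 0" for d
    using supp_spaceD(1)[OF assms that] by (metis coeff_0 coeff_slice)
  then show ?thesis by (simp add: fps_to_fls_regpart)
qed

lemma supp_spaceI:
  assumes "\<And>i. \<exists>g\<in>A. coeff h i = fps_to_fls g"
    "\<And>d i. \<not> S d i \<Longrightarrow> fls_nth (coeff h i) (int d) = 0"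
  shows "h \<in> supp_space A S"
proof -
  have "fls_nth (coeff h i) d = 0" if "d < 0" for d i
    using assms(1)[of i] that by auto
  moreover have "fls_regpart (coeff h i) \<in> A" for i
    using assms(1)[of i] by auto
  ultimately show ?thesis
    using assms(2) by (fastforce simp: supp_space_def intro!: poly_eqI)
qed

lemma fps_shift_times_X_power:
  fixes g :: "'k::field fps"
  assumes "\<And>i. i < d \<Longrightarrow> g $ i = 0"
  shows "fps_shift d g * fps_X ^ d = g"
  by (rule fps_ext) (use assms in \<open>auto simp: fps_X_power_mult_right_nth\<close>)

text \<open>What the convergent and the formal power series share. Multiplication and division by x
  convert between A x^\<sigma> and series that start at the base exponent.\<close>

locale coeff_ring =
  fixes A :: "'k::field_char_0 fps set"
  assumes A_const: "fps_const c \<in> A"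
    and A_diff: "f \<in> A \<Longrightarrow> g \<in> A \<Longrightarrow> f - g \<in> A"
    and A_cmult: "f \<in> A \<Longrightarrow> fps_const c * f \<in> A"
    and A_X_mult: "f \<in> A \<Longrightarrow> f * fps_X \<in> A"
    and A_shift: "f \<in> A \<Longrightarrow> fps_shift 1 f \<in> A"
begin

lemma A_0: "0 \<in> A"
  using A_const[of 0] by simp

lemma A_add: "f \<in> A \<Longrightarrow> g \<in> A \<Longrightarrow> f + g \<in> A"
  using A_diff[of f "0 - g"] A_diff[of 0 g] A_0 by simp

lemma A_X_power_mult: "f \<in> A \<Longrightarrow> f * fps_X ^ n \<in> A"
proof (induction n arbitrary: f)
  case (Suc n)
  from Suc.IH[OF A_X_mult[OF Suc.prems]] show ?case
    by (simp add: mult.assoc)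
qed auto

lemma A_fps_shift: "f \<in> A \<Longrightarrow> fps_shift n f \<in> A"
proof (induction n)
  case (Suc n)
  from A_shift[OF Suc.IH[OF Suc.prems]] show ?case
    by (simp add: fps_shift_fps_shift[symmetric])
qed auto

lemma supp_space_diff: "g \<in> supp_space A S \<Longrightarrow> h \<in> supp_space A S \<Longrightarrow> g - h \<in> supp_space A S"
  and supp_space_add: "g' \<in> supp_space A S \<Longrightarrow> h' \<in> supp_space A S \<Longrightarrow> g' + h' \<in> supp_space A S"
  and supp_space_0: "0 \<in> supp_space A S"
  by (auto simp: supp_space_def slice_add slice_diff A_add A_diff A_0) (metis diff_zero add_0)+

lemma supp_space_sum: "(\<And>x. x \<in> B \<Longrightarrow> f x \<in> supp_space A S) \<Longrightarrow> sum f B \<in> supp_space A S"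
  by (induction B rule: infinite_finite_induct) (auto simp: supp_space_0 supp_space_add)

lemma supp_space_smult: "h \<in> supp_space A S \<Longrightarrow> smult (fls_const c) h \<in> supp_space A S"
proof (intro supp_spaceI)
  fix i assume h: "h \<in> supp_space A S"
  have "coeff (smult (fls_const c) h) i = fps_to_fls (fps_const c * fls_regpart (coeff h i))"
    by (subst fls_times_fps_to_fls) (simp flip: supp_space_coeff[OF h])
  then show "\<exists>g\<in>A. coeff (smult (fls_const c) h) i = fps_to_fls g"
    using supp_spaceD(2)[OF h] A_cmult by blast
next
  fix d i assume "h \<in> supp_space A S" "\<not> S d i"
  then show "fls_nth (coeff (smult (fls_const c) h) i) (int d) = 0"
    using supp_spaceD(3)[of h A S d i] by simp
qed

end

lemma supp_space_mono: "(\<And>d i. S d i \<Longrightarrow> S' d i) \<Longrightarrow> supp_space A S \<subseteq> supp_space A S'"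
  by (auto simp: supp_space_def)

lemma xpow_of_nat: 
  fixes b :: "'k::field_char_0"
  shows "xpow b (b + of_nat d) = fps_to_fls (fps_X ^ d)"
proof -
  have "int_diff (b + of_nat d) b = int d"
    by (rule int_diff_eq) auto
  moreover have "fls_X_intpow (int d) = (fps_to_fls (fps_X ^ d) :: 'k fls)"
  proof (rule fls_eqI)
    fix n show "fls_nth (fls_X_intpow (int d)) n = fls_nth (fps_to_fls (fps_X ^ d) :: 'k fls) n"
      by (cases "0 \<le> n") (auto simp: fps_X_power_nth)
  qed
  ultimately show ?thesis by (simp add: xpow_def)
qed

lemma coeff_Ox_elem:
  "coeff (\<Sum>i<m. monom (fps_to_fls (g i) * xpow b (b + of_nat d)) i) i
     = fps_to_fls (if i < m then g i * fps_X ^ d else 0 :: 'k::field_char_0 fps)"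
  by (auto simp: coeff_sum xpow_of_nat fls_times_fps_to_fls)

section \<open>Exponents as natural offsets from the smallest one\<close>

locale exponents =
  fixes L :: "'k::field_char_0 diffop" and \<rho> :: "nat \<Rightarrow> 'k" and r :: nat
  assumes L_nonzero: "L \<noteq> 0" and shift_0: "shift L = 0" and cls: "exponent_class L \<rho> r"
begin

definition \<delta> :: "nat \<Rightarrow> nat" where
  "\<delta> k = nat (int_diff (\<rho> k) (\<rho> 1))"

text \<open>Multiplicities are indexed by all offsets and are zero away from the exponents, which
  frees the later arguments from case distinctions over k.\<close>

definition mlt :: "nat \<Rightarrow> nat" where
  "mlt t = order (\<rho> 1 + of_nat t) (indicial_poly L)"

definition N :: "nat \<Rightarrow> nat" where
  "N d = (\<Sum>t\<le>d. mlt t)"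

lemma r_ge_1: "1 \<le> r"
  using cls by (simp add: exponent_class_def)

lemma \<rho>_eq_\<delta>: "k \<in> {1..r} \<Longrightarrow> \<rho> k = \<rho> 1 + of_nat (\<delta> k)"
proof -
  have "\<exists>d::nat. \<rho> k = \<rho> 1 + of_nat d" if "1 \<le> k" "k \<le> r" for k
    using that
  proof (induction k rule: dec_induct)
    case base
    show ?case by (rule exI[of _ 0]) simp
  next
    case (step k)
    then obtain d where "\<rho> k = \<rho> 1 + of_nat d" by auto
    moreover obtain e :: nat where "\<rho> (k + 1) - \<rho> k = of_nat e"
      using cls step unfolding exponent_class_def by fastforce
    ultimately have "\<rho> (Suc k) = \<rho> 1 + of_nat (d + e)"
      by (simp add: algebra_simps)
    then show ?case ..
  qed
  moreover assume "k \<in> {1..r}"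
  ultimately obtain d :: nat where d: "\<rho> k = \<rho> 1 + of_nat d" by auto
  then have "int_diff (\<rho> k) (\<rho> 1) = int d"
    by (intro int_diff_eq) simp
  with d show ?thesis by (simp add: \<delta>_def)
qed

lemma \<delta>_1: "\<delta> 1 = 0"
  using \<rho>_eq_\<delta>[of 1] r_ge_1 by simp

lemma \<delta>_Suc: 
  assumes "k \<in> {1..<r}"
  shows "\<delta> k < \<delta> (Suc k)" "nat (int_diff (\<rho> (Suc k)) (\<rho> k)) = \<delta> (Suc k) - \<delta> k"
proof -
  obtain e :: nat where e: "e > 0" "\<rho> (k + 1) - \<rho> k = of_nat e"
    using cls assms unfolding exponent_class_def by blast
  then have "of_nat (\<delta> (Suc k)) = (of_nat (\<delta> k + e) :: 'k)"
    using \<rho>_eq_\<delta>[of k] \<rho>_eq_\<delta>[of "Suc k"] assms by (simp add: algebra_simps)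
  then have *: "\<delta> (Suc k) = \<delta> k + e"
    using of_nat_eq_iff by blast
  then show "\<delta> k < \<delta> (Suc k)" using e by simp
  have "int_diff (\<rho> (Suc k)) (\<rho> k) = int e"
    using e by (intro int_diff_eq) simp
  with * show "nat (int_diff (\<rho> (Suc k)) (\<rho> k)) = \<delta> (Suc k) - \<delta> k" by simp
qed

lemma \<delta>_less: "1 \<le> j \<Longrightarrow> j < k \<Longrightarrow> k \<le> r \<Longrightarrow> \<delta> j < \<delta> k"
proof (induction k)
  case (Suc k)
  then show ?case
    using \<delta>_Suc(1)[of k] by (cases "j = k") auto
qed auto

lemma \<delta>_le: "1 \<le> j \<Longrightarrow> j \<le> k \<Longrightarrow> k \<le> r \<Longrightarrow> \<delta> j \<le> \<delta> k"
  using \<delta>_less[of j k] by (cases "j = k") auto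

lemma inj_on_\<delta>: "inj_on \<delta> {1..r}"
  by (rule inj_onI) (metis \<delta>_less atLeastAtMost_iff less_irrefl linorder_neqE_nat)

lemma indicial_nonzero: "indicial_poly L \<noteq> 0"
  using shift_eq_0D_ex[OF L_nonzero shift_0] indicial_poly_nonzero by blast

text \<open>Completeness of the class is used here: a root of the form \<rho> 1 + t differs from
  \<rho> 1 by an integer and is therefore listed.\<close>

lemma mlt_nonzero_iff: "mlt t \<noteq> 0 \<longleftrightarrow> t \<in> \<delta> ` {1..r}"
proof -
  have "mlt t \<noteq> 0 \<longleftrightarrow> poly (indicial_poly L) (\<rho> 1 + of_nat t) = 0"
    using indicial_nonzero by (simp add: mlt_def order_root)
  also have "\<dots> \<longleftrightarrow> \<rho> 1 + of_nat t \<in> \<rho> ` {1..r}"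
    using cls by (simp add: exponent_class_def)
  also have "\<dots> \<longleftrightarrow> t \<in> \<delta> ` {1..r}"
  proof
    assume "\<rho> 1 + of_nat t \<in> \<rho> ` {1..r}"
    then obtain k where k: "k \<in> {1..r}" "\<rho> 1 + of_nat t = \<rho> k" by auto
    with \<rho>_eq_\<delta>[OF k(1)] have "of_nat t = (of_nat (\<delta> k) :: 'k)" by (metis add_left_cancel)
    with k(1) show "t \<in> \<delta> ` {1..r}" by auto
  next
    assume "t \<in> \<delta> ` {1..r}"
    then obtain k where k: "k \<in> {1..r}" "t = \<delta> k" by auto
    with \<rho>_eq_\<delta>[OF k(1)] show "\<rho> 1 + of_nat t \<in> \<rho> ` {1..r}" by (metis imageI)
  qed
  finally show ?thesis .
qed

lemma exp_mult_eq: "k \<in> {1..r} \<Longrightarrow> exp_mult L \<rho> k = mlt (\<delta> k)"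
  using \<rho>_eq_\<delta>[of k] by (simp add: exp_mult_def mlt_def)

text \<open>No root lies strictly between consecutive exponents, so the cumulative multiplicity
  stays at n_k until the next one, and forever if k = r.\<close>

lemma N_eq_mult_sum:
  assumes "k \<in> {1..r}" "\<delta> k \<le> d" "k < r \<Longrightarrow> d < \<delta> (Suc k)"
  shows "N d = mult_sum L \<rho> k"
proof -
  have "mult_sum L \<rho> k = (\<Sum>j\<in>{1..k}. mlt (\<delta> j))"
    unfolding mult_sum_def using assms by (intro sum.cong) (auto simp: exp_mult_eq)
  also have "\<dots> = sum mlt (\<delta> ` {1..k})"
    using inj_on_\<delta> assms(1) by (subst sum.reindex) (auto intro: inj_on_subset)
  also have "\<dots> = sum mlt {..d}"
  proof (rule sum.mono_neutral_left)
    show "\<delta> ` {1..k} \<subseteq> {..d}"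
    proof
      fix t assume "t \<in> \<delta> ` {1..k}"
      then obtain j where "j \<in> {1..k}" "t = \<delta> j" by blast
      with \<delta>_le[of j k] assms(1,2) show "t \<in> {..d}" by simp
    qed
    show "\<forall>i\<in>{..d} - \<delta> ` {1..k}. mlt i = 0"
    proof (rule ballI, rule ccontr)
      fix i assume i: "i \<in> {..d} - \<delta> ` {1..k}" "mlt i \<noteq> 0"
      then obtain j where j: "j \<in> {1..r}" "i = \<delta> j"
        using mlt_nonzero_iff[of i] by blast
      have "\<not> j \<le> k" using i(1) j by auto
      then have "\<delta> (Suc k) \<le> \<delta> j" using j(1) by (intro \<delta>_le) auto
      moreover have "k < r" using \<open>\<not> j \<le> k\<close> j(1) by auto
      ultimately show False using assms(3) j(2) i(1) by simp
    qed
  qed auto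
  finally show ?thesis by (simp add: N_def)
qed

lemma N_\<delta>: "k \<in> {1..r} \<Longrightarrow> N (\<delta> k) = mult_sum L \<rho> k"
  by (rule N_eq_mult_sum) (auto intro: \<delta>_Suc)

lemma N_mono: "c \<le> d \<Longrightarrow> N c \<le> N d"
  unfolding N_def by (intro sum_mono2) auto

text \<open>As \<delta> 1 = 0, there is a last exponent not beyond d.\<close>

lemma obtain_interval:
  obtains k where "k \<in> {1..r}" "\<delta> k \<le> d" "k < r \<Longrightarrow> d < \<delta> (Suc k)"
proof -
  define k where "k = Max {k\<in>{1..r}. \<delta> k \<le> d}"
  have fin: "finite {k\<in>{1..r}. \<delta> k \<le> d}" by auto
  have "1 \<in> {k\<in>{1..r}. \<delta> k \<le> d}" using r_ge_1 \<delta>_1 by auto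
  then have "k \<in> {k\<in>{1..r}. \<delta> k \<le> d}"
    unfolding k_def using fin by (intro Max_in) auto
  moreover have "d < \<delta> (Suc k)" if "k < r"
  proof (rule ccontr)
    assume "\<not> d < \<delta> (Suc k)"
    with that have "Suc k \<in> {k\<in>{1..r}. \<delta> k \<le> d}" by simp
    from Max_ge[OF fin this, folded k_def] show False by simp
  qed
  ultimately show ?thesis using that by auto
qed

lemma N_le: "N d \<le> mult_sum L \<rho> r"
proof -
  have "N d \<le> N (max d (\<delta> r))" by (rule N_mono) auto
  also have "\<dots> = mult_sum L \<rho> r"
    using r_ge_1 by (intro N_eq_mult_sum) auto
  finally show ?thesis .
qed

lemma N_split: "N d = mlt d + (if d = 0 then 0 else N (d - 1))"
  by (cases d) (auto simp: N_def)

end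

section \<open>The spaces as support conditions\<close>

locale exponents_ring = coeff_ring A + exponents L \<rho> r
  for A :: "'k::field_char_0 fps set" and L :: "'k diffop" and \<rho> :: "nat \<Rightarrow> 'k" and r :: nat
begin

lemma Ox_subset:
  assumes "\<And>d' i. d \<le> d' \<Longrightarrow> i < m \<Longrightarrow> S d' i"
  shows "Ox A (\<rho> 1) (\<rho> 1 + of_nat d) m \<subseteq> supp_space A S"
proof
  fix h assume "h \<in> Ox A (\<rho> 1) (\<rho> 1 + of_nat d) m"
  then obtain g where g: "\<forall>i<m. g i \<in> A"
    and h: "h = (\<Sum>i<m. monom (fps_to_fls (g i) * xpow (\<rho> 1) (\<rho> 1 + of_nat d)) i)"
    by (auto simp: Ox_def)
  have c: "coeff h i = fps_to_fls (if i < m then g i * fps_X ^ d else 0)" for i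
    by (simp only: h coeff_Ox_elem)
  show "h \<in> supp_space A S"
  proof (rule supp_spaceI)
    show "\<exists>g\<in>A. coeff h i = fps_to_fls g" for i
      unfolding c using g A_0 A_X_power_mult by auto
    show "fls_nth (coeff h i) (int d') = 0" if "\<not> S d' i" for d' i
      using that assms[of d' i] by (auto simp: c fps_X_power_mult_right_nth)
  qed
qed

lemma Ox_memI:
  assumes "\<And>i. i < m \<Longrightarrow> g i \<in> A" "h = (\<Sum>i<m. monom (fps_to_fls (g i) * xpow b s) i)"
  shows "h \<in> Ox A b s m"
  unfolding Ox_def using assms by blast

text \<open>The parameter c treats \<open>space_F\<close> (c = 0) and \<open>space_Fx\<close> (c =
  1) together; the conjunct \<open>c \<le> d\<close> guards the truncated subtraction. The sum over
  k is not direct, so the converse inclusion has to choose a decomposition.\<close>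

lemma sum_Ox_eq_supp_space:
  "{\<Sum>k=1..r. h k | h. \<forall>k\<in>{1..r}. h k \<in> Ox A (\<rho> 1) (\<rho> k + of_nat c) (mult_sum L \<rho> k)}
     = supp_space A (\<lambda>d i. c \<le> d \<and> i < N (d - c))" (is "?X = supp_space A ?S")
proof (intro equalityI subsetI)
  have \<rho>: "\<rho> k + of_nat c = \<rho> 1 + of_nat (\<delta> k + c)" if "k \<in> {1..r}" for k
    using \<rho>_eq_\<delta>[OF that] by simp
  {
    fix f assume "f \<in> ?X"
    then obtain h where h: "f = (\<Sum>k=1..r. h k)"
      "\<And>k. k \<in> {1..r} \<Longrightarrow> h k \<in> Ox A (\<rho> 1) (\<rho> k + of_nat c) (mult_sum L \<rho> k)" by blast
    have "Ox A (\<rho> 1) (\<rho> k + of_nat c) (mult_sum L \<rho> k) \<subseteq> supp_space A ?S" if k: "k \<in> {1..r}" for k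
      unfolding \<rho>[OF k]
    proof (rule Ox_subset)
      fix d i assume "\<delta> k + c \<le> d" "i < mult_sum L \<rho> k"
      moreover from this have "\<delta> k \<le> d - c" by linarith
      ultimately show "c \<le> d \<and> i < N (d - c)"
        using N_mono[of "\<delta> k" "d - c"] by (simp add: N_\<delta>[OF k])
    qed
    then show "f \<in> supp_space A ?S"
      unfolding h(1) using h(2) by (intro supp_space_sum) blast
  }
  fix f assume f: "f \<in> supp_space A ?S"
  \<comment> \<open>The first k whose summand admits z^i. The entire series multiplying z^i is put
    into that summand.\<close>
  define \<kappa> where "\<kappa> i = (LEAST k. 1 \<le> k \<and> i < mult_sum L \<rho> k)" for i
  define g where "g k i = (if \<kappa> i = k then fps_shift (\<delta> k + c) (fls_regpart (coeff f i)) else 0)" for k i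
  define h where "h k = (\<Sum>i<mult_sum L \<rho> k. monom (fps_to_fls (g k i) * xpow (\<rho> 1) (\<rho> k + of_nat c)) i)" for k
  have "h k \<in> Ox A (\<rho> 1) (\<rho> k + of_nat c) (mult_sum L \<rho> k)" for k
    by (rule Ox_memI[OF _ h_def]) (auto simp: g_def A_0 intro: A_fps_shift supp_spaceD(2)[OF f])
  moreover have "f = (\<Sum>k=1..r. h k)"
  proof (rule poly_eqI)
    fix i
    have "coeff (h k) i = fps_to_fls (if i < mult_sum L \<rho> k then g k i * fps_X ^ (\<delta> k + c) else 0)"
      if "k \<in> {1..r}" for k
      unfolding h_def \<rho>[OF that] by (rule coeff_Ox_elem)
    then have *: "coeff (\<Sum>k=1..r. h k) i = (\<Sum>k=1..r.
        fps_to_fls (if i < mult_sum L \<rho> k then g k i * fps_X ^ (\<delta> k + c) else 0))"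
      by (simp only: coeff_sum cong: sum.cong)
    show "coeff f i = coeff (\<Sum>k=1..r. h k) i"
    proof (cases "i < mult_sum L \<rho> r")
      case True
      then have "1 \<le> r \<and> i < mult_sum L \<rho> r" using r_ge_1 by simp
      from LeastI[of "\<lambda>k. 1 \<le> k \<and> i < mult_sum L \<rho> k", OF this] Least_le[of "\<lambda>k. 1 \<le> k \<and> i < mult_sum L \<rho> k", OF this]
      have \<kappa>: "\<kappa> i \<in> {1..r}" "i < mult_sum L \<rho> (\<kappa> i)"
        by (auto simp: \<kappa>_def)
      \<comment> \<open>Before the exponent number \<open>\<kappa> i\<close> the power z^i is not
        yet admissible, so its coefficient is divisible by the power of x that the chosen summand
        requires.\<close>
      have z: "fls_regpart (coeff f i) $ d = 0" if d: "d < \<delta> (\<kappa> i) + c" for d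
      proof (cases "c \<le> d")
        case True
        obtain k where k: "k \<in> {1..r}" "\<delta> k \<le> d - c" "k < r \<Longrightarrow> d - c < \<delta> (Suc k)"
          using obtain_interval[of "d - c"] by blast
        have "\<delta> k < \<delta> (\<kappa> i)" using k(2) d True by simp
        then have "k < \<kappa> i"
          using \<delta>_le[of "\<kappa> i" k] \<kappa>(1) k(1) by (meson atLeastAtMost_iff not_le)
        from not_less_Least[OF this[unfolded \<kappa>_def]] k(1) have "\<not> i < mult_sum L \<rho> k" by simp
        with N_eq_mult_sum[OF k] have "\<not> i < N (d - c)" by simp
        then show ?thesis using supp_spaceD(3)[OF f, of d i] by simp
      next
        case False
        then show ?thesis using supp_spaceD(3)[OF f, of d i] by simp
      qed
      have "coeff (\<Sum>k=1..r. h k) i = (\<Sum>k=1..r. if k = \<kappa> i then coeff f i else 0)"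
        unfolding * 
      proof (intro sum.cong refl)
        fix k assume "k \<in> {1..r}"
        show "fps_to_fls (if i < mult_sum L \<rho> k then g k i * fps_X ^ (\<delta> k + c) else 0) =
               (if k = \<kappa> i then coeff f i else 0)"
          using \<kappa> fps_shift_times_X_power[OF z] supp_space_coeff[OF f, of i] by (auto simp: g_def)
      qed
      also have "\<dots> = coeff f i" using \<kappa>(1) by simp
      finally show ?thesis ..
    next
      case False
      have "\<not> i < mult_sum L \<rho> k" if "k \<in> {1..r}" for k
        using False N_le[of "\<delta> k"] N_\<delta>[OF that] by simp
      then have "coeff (\<Sum>k=1..r. h k) i = 0"
        unfolding * by (intro sum.neutral ballI) simp
      moreover have "fls_regpart (coeff f i) = 0"
      proof (rule fps_ext)
        fix d
        have "\<not> i < N (d - c)" using False N_le[of "d - c"] by simp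
        then show "fls_regpart (coeff f i) $ d = 0 $ d" using supp_spaceD(3)[OF f, of d i] by simp
      qed
      ultimately show ?thesis using supp_space_coeff[OF f, of i] by simp
    qed
  qed
  ultimately show "f \<in> ?X" by blast
qed

lemma space_F_eq: "space_F A L \<rho> r = supp_space A (\<lambda>d i. i < N d)"
  using sum_Ox_eq_supp_space[of 0] by (simp add: space_F_def)

lemma space_Fx_eq: "space_Fx A L \<rho> r = supp_space A (\<lambda>d i. 1 \<le> d \<and> i < N (d - 1))"
  using sum_Ox_eq_supp_space[of 1] by (simp add: space_Fx_def)

lemma monom_in_supp_space:
  assumes "S d i"
  shows "monom (fls_const a * xpow (\<rho> 1) (\<rho> 1 + of_nat d)) i \<in> supp_space A S"
proof (rule supp_spaceI)
  have c: "coeff (monom (fls_const a * xpow (\<rho> 1) (\<rho> 1 + of_nat d)) i) i'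
      = fps_to_fls (if i' = i then fps_const a * fps_X ^ d else 0)" for i'
    by (auto simp: xpow_of_nat fls_times_fps_to_fls)
  show "\<exists>g\<in>A. coeff (monom (fls_const a * xpow (\<rho> 1) (\<rho> 1 + of_nat d)) i) i' = fps_to_fls g" for i'
    unfolding c using A_X_power_mult[OF A_const] A_0 by auto
  show "fls_nth (coeff (monom (fls_const a * xpow (\<rho> 1) (\<rho> 1 + of_nat d)) i) i') (int d') = 0"
    if "\<not> S d' i'" for d' i'
    unfolding c using assms that by (auto simp: fps_X_power_nth)
qed

lemma fls_nth_coeff_monom_xpow:
  "fls_nth (coeff (monom (fls_const a * xpow (\<rho> 1) (\<rho> 1 + of_nat d)) i) i') (int d')
     = (if i' = i \<and> d' = d then a else 0)"
  by (auto simp: xpow_of_nat fps_X_power_nth)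

text \<open>The three families sit at offsets equal to some \<open>\<delta> k\<close>, strictly
  between two exponents, and beyond the last one. In the latter two cases \<open>mlt d\<close> is 0,
  so i has no lower bound.\<close>

lemma space_H_subset: "space_H A L \<rho> r \<subseteq> supp_space A (\<lambda>d i. mlt d \<le> i \<and> i < N d)" (is "_ \<subseteq> supp_space A ?S")
proof
  fix f assume "f \<in> space_H A L \<rho> r"
  then obtain a c h where f: "f = (\<Sum>k=2..r. \<Sum>i\<in>{exp_mult L \<rho> k..<mult_sum L \<rho> k}.
          monom (fls_const (a k i) * xpow (\<rho> 1) (\<rho> k)) i)
      + (\<Sum>k\<in>{1..<r}. \<Sum>e\<in>{1..<nat (int_diff (\<rho> (k + 1)) (\<rho> k))}. \<Sum>i<mult_sum L \<rho> k.
          monom (fls_const (c k e i) * xpow (\<rho> 1) (\<rho> k + of_nat e)) i)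
      + h" and h: "h \<in> Ox A (\<rho> 1) (\<rho> r + 1) (mult_sum L \<rho> r)"
    unfolding space_H_def by blast
  have "h \<in> supp_space A ?S"
  proof -
    have eq: "\<rho> r + 1 = \<rho> 1 + of_nat (\<delta> r + 1)"
      using \<rho>_eq_\<delta>[of r] r_ge_1 by simp
    have "Ox A (\<rho> 1) (\<rho> 1 + of_nat (\<delta> r + 1)) (mult_sum L \<rho> r) \<subseteq> supp_space A ?S"
    proof (rule Ox_subset)
      fix d i assume d: "\<delta> r + 1 \<le> d" "i < mult_sum L \<rho> r"
      have "d \<notin> \<delta> ` {1..r}" using \<delta>_le[of _ r] d by fastforce
      then have "mlt d = 0" using mlt_nonzero_iff by blast
      moreover have "N d = mult_sum L \<rho> r" using d r_ge_1 by (intro N_eq_mult_sum) auto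
      ultimately show "mlt d \<le> i \<and> i < N d" using d by simp
    qed
    with h show ?thesis unfolding eq by blast
  qed
  moreover have "monom (fls_const (a k i) * xpow (\<rho> 1) (\<rho> k)) i \<in> supp_space A ?S"
    if "k \<in> {2..r}" "i \<in> {exp_mult L \<rho> k..<mult_sum L \<rho> k}" for k i
  proof -
    have k: "k \<in> {1..r}" using that by auto
    show ?thesis
      unfolding \<rho>_eq_\<delta>[OF k] using that N_\<delta>[OF k] exp_mult_eq[OF k] by (intro monom_in_supp_space) simp
  qed
  moreover have "monom (fls_const (c k e i) * xpow (\<rho> 1) (\<rho> k + of_nat e)) i \<in> supp_space A ?S"
    if k: "k \<in> {1..<r}" and e: "e \<in> {1..<nat (int_diff (\<rho> (k + 1)) (\<rho> k))}" and i: "i < mult_sum L \<rho> k" for k e i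
  proof -
    have k': "k \<in> {1..r}" using k by auto
    have e': "1 \<le> e" "\<delta> k + e < \<delta> (Suc k)" using e \<delta>_Suc[OF k] by auto
    have "N (\<delta> k + e) = mult_sum L \<rho> k"
      using e' k by (intro N_eq_mult_sum) auto
    moreover have "\<delta> k + e \<notin> \<delta> ` {1..r}"
    proof
      assume "\<delta> k + e \<in> \<delta> ` {1..r}"
      then obtain j where j: "j \<in> {1..r}" "\<delta> k + e = \<delta> j" by blast
      have "j \<le> k \<or> Suc k \<le> j" by linarith
      then show False using \<delta>_le[of j k] \<delta>_le[of "Suc k" j] j e' k by auto
    qed
    then have "mlt (\<delta> k + e) = 0" using mlt_nonzero_iff by blast
    moreover have "\<rho> k + of_nat e = \<rho> 1 + of_nat (\<delta> k + e)" using \<rho>_eq_\<delta>[OF k'] by simp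
    ultimately show ?thesis using i monom_in_supp_space[of ?S "\<delta> k + e" i]
      by (simp del: of_nat_add One_nat_def)
  qed
  ultimately show "f \<in> supp_space A ?S"
    unfolding f by (intro supp_space_add supp_space_sum) auto
qed

text \<open>Each coefficient of f is handed to the family that owns its offset; comparing
  coefficients shows that every admissible monomial is produced exactly once.\<close>

lemma space_H_supset: "supp_space A (\<lambda>d i. mlt d \<le> i \<and> i < N d) \<subseteq> space_H A L \<rho> r" (is "supp_space A ?S \<subseteq> _")
proof
  fix f assume f: "f \<in> supp_space A ?S"
  let ?f = "\<lambda>d i. fls_nth (coeff f i) (int d)"
  define a where "a k i = ?f (\<delta> k) i" for k i
  define c where "c k e i = ?f (\<delta> k + e) i" for k e i
  define h where "h = (\<Sum>i<mult_sum L \<rho> r. monom (fps_to_fls (fps_shift (\<delta> r + 1) (fls_regpart (coeff f i)))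
      * xpow (\<rho> 1) (\<rho> r + 1)) i)"
  define s1 where "s1 = (\<Sum>k=2..r. \<Sum>i\<in>{exp_mult L \<rho> k..<mult_sum L \<rho> k}.
          monom (fls_const (a k i) * xpow (\<rho> 1) (\<rho> k)) i)"
  define s2 where "s2 = (\<Sum>k\<in>{1..<r}. \<Sum>e\<in>{1..<nat (int_diff (\<rho> (k + 1)) (\<rho> k))}. \<Sum>i<mult_sum L \<rho> k.
          monom (fls_const (c k e i) * xpow (\<rho> 1) (\<rho> k + of_nat e)) i)"
  have h: "h \<in> Ox A (\<rho> 1) (\<rho> r + 1) (mult_sum L \<rho> r)"
    by (rule Ox_memI[OF _ h_def]) (auto intro: A_fps_shift supp_spaceD(2)[OF f])
  then have inH: "s1 + s2 + h \<in> space_H A L \<rho> r"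
    unfolding space_H_def s1_def s2_def by blast
  \<comment> \<open>Used for the negative exponents, where both sides vanish.\<close>
  from space_H_subset inH have sp: "s1 + s2 + h \<in> supp_space A ?S" by blast
  have "f = s1 + s2 + h"
  proof (intro poly_eqI fls_eqI)
    fix i D
    show "fls_nth (coeff f i) D = fls_nth (coeff (s1 + s2 + h) i) D"
    proof (cases "D < 0")
      case True
      show ?thesis using supp_spaceD(1)[OF f True] supp_spaceD(1)[OF sp True] by (metis coeff_slice)
    next
      case False
      then obtain d where D: "D = int d" by (metis nonneg_int_cases not_less)
      obtain k where k: "k \<in> {1..r}" "\<delta> k \<le> d" "k < r \<Longrightarrow> d < \<delta> (Suc k)"
        using obtain_interval[of d] by blast
      have N: "N d = mult_sum L \<rho> k" by (rule N_eq_mult_sum[OF k])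
      \<comment> \<open>The interval between consecutive exponents containing d determines k, so
        each sum over exponents reduces to at most one index.\<close>
      have uniq: "j = k" if "j \<in> {1..r}" "\<delta> j \<le> d" "j < r \<Longrightarrow> d < \<delta> (Suc j)" for j
      proof (rule ccontr)
        assume "j \<noteq> k"
        then consider "Suc j \<le> k" | "Suc k \<le> j" by linarith
        then show False
          using that k \<delta>_le[of "Suc j" k] \<delta>_le[of "Suc k" j] by cases auto
      qed
      have uniq0: "j = k" if "j \<in> {1..r}" "\<delta> j = d" for j
        using uniq[of j] that \<delta>_Suc(1)[of j] by auto
      have s1: "fls_nth (coeff s1 i) D = (if d = \<delta> k \<and> 2 \<le> k \<and> exp_mult L \<rho> k \<le> i \<and> i < N d then ?f d i else 0)"
      proof -
        have "fls_nth (coeff s1 i) D = (\<Sum>j=2..r. \<Sum>i'\<in>{exp_mult L \<rho> j..<mult_sum L \<rho> j}.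
           if i = i' \<and> d = \<delta> j then a j i' else 0)"
          unfolding s1_def D coeff_sum fls_nth_sum
        proof (intro sum.cong refl)
          fix j i' assume "j \<in> {2..r}"
          then have "j \<in> {1..r}" by auto
          then show "fls_nth (coeff (monom (fls_const (a j i') * xpow (\<rho> 1) (\<rho> j)) i') i) (int d) =
              (if i = i' \<and> d = \<delta> j then a j i' else 0)"
            using \<rho>_eq_\<delta>[of j] fls_nth_coeff_monom_xpow by metis
        qed
        also have "\<dots> = (\<Sum>j=2..r. if j = k then 
            (if d = \<delta> k \<and> exp_mult L \<rho> k \<le> i \<and> i < N d then ?f d i else 0) else 0)"
        proof (intro sum.cong refl)
          fix j assume j: "j \<in> {2..r}"
          show "(\<Sum>i'\<in>{exp_mult L \<rho> j..<mult_sum L \<rho> j}. if i = i' \<and> d = \<delta> j then a j i' else 0)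
            = (if j = k then (if d = \<delta> k \<and> exp_mult L \<rho> k \<le> i \<and> i < N d then ?f d i else 0) else 0)"
          proof (cases "d = \<delta> j")
            case True
            then have "j = k" using uniq0[of j] j by auto
            then show ?thesis using True N by (simp add: a_def)
          qed auto
        qed
        also have "\<dots> = (if d = \<delta> k \<and> 2 \<le> k \<and> exp_mult L \<rho> k \<le> i \<and> i < N d then ?f d i else 0)"
          using k(1) by (subst sum.delta) auto
        finally show ?thesis .
      qed
      have s2: "fls_nth (coeff s2 i) D = (if \<delta> k < d \<and> k < r \<and> i < N d then ?f d i else 0)"
      proof -
        have "fls_nth (coeff s2 i) D = (\<Sum>j\<in>{1..<r}. \<Sum>e\<in>{1..<\<delta> (Suc j) - \<delta> j}. \<Sum>i'<mult_sum L \<rho> j.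
           if i = i' \<and> d = \<delta> j + e then c j e i' else 0)"
          unfolding s2_def D coeff_sum fls_nth_sum
        proof (intro sum.cong refl)
          fix j assume "j \<in> {1..<r}"
          then show "{1..<nat (int_diff (\<rho> (j + 1)) (\<rho> j))} = {1..<\<delta> (Suc j) - \<delta> j}"
            using \<delta>_Suc(2) by simp
        next
          fix j i' e assume "j \<in> {1..<r}"
          then have "j \<in> {1..r}" by auto
          from \<rho>_eq_\<delta>[OF this] have "\<rho> j + of_nat e = \<rho> 1 + of_nat (\<delta> j + e)" by simp
          then show "fls_nth (coeff (monom (fls_const (c j e i') * xpow (\<rho> 1) (\<rho> j + of_nat e)) i') i) (int d) =
              (if i = i' \<and> d = \<delta> j + e then c j e i' else 0)"
            using fls_nth_coeff_monom_xpow by metis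
        qed
        also have "\<dots> = (\<Sum>j\<in>{1..<r}. if j = k then 
            (if \<delta> k < d \<and> i < N d then ?f d i else 0) else 0)"
        proof (intro sum.cong refl)
          fix j assume j: "j \<in> {1..<r}"
          show "(\<Sum>e\<in>{1..<\<delta> (Suc j) - \<delta> j}. \<Sum>i'<mult_sum L \<rho> j. if i = i' \<and> d = \<delta> j + e then c j e i' else 0)
            = (if j = k then (if \<delta> k < d \<and> i < N d then ?f d i else 0) else 0)"
          proof (cases "\<delta> j < d \<and> d < \<delta> (Suc j)")
            case True
            then have jk: "j = k" using uniq[of j] j by auto
            have "(\<Sum>e\<in>{1..<\<delta> (Suc j) - \<delta> j}. \<Sum>i'<mult_sum L \<rho> j. if i = i' \<and> d = \<delta> j + e then c j e i' else 0)
              = (\<Sum>e\<in>{1..<\<delta> (Suc j) - \<delta> j}. if e = d - \<delta> j then (if i < N d then ?f d i else 0) else 0)"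
            proof (intro sum.cong refl)
              fix e
              have "d = \<delta> j + e \<longleftrightarrow> e = d - \<delta> j" using True by auto
              then show "(\<Sum>i'<mult_sum L \<rho> j. if i = i' \<and> d = \<delta> j + e then c j e i' else 0)
                = (if e = d - \<delta> j then (if i < N d then ?f d i else 0) else 0)"
                using True N jk by (auto simp: c_def)
            qed
            also have "\<dots> = (if i < N d then ?f d i else 0)" using True by auto
            finally show ?thesis using True jk by simp
          next
            case False
            then have "(\<Sum>e\<in>{1..<\<delta> (Suc j) - \<delta> j}. \<Sum>i'<mult_sum L \<rho> j. if i = i' \<and> d = \<delta> j + e then c j e i' else 0) = 0"
              by (intro sum.neutral ballI) auto
            moreover have "\<not> (j = k \<and> \<delta> k < d)" using False k j by auto
            ultimately show ?thesis by auto
          qed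
        qed
        also have "\<dots> = (if \<delta> k < d \<and> k < r \<and> i < N d then ?f d i else 0)"
          using k(1) by (subst sum.delta) auto
        finally show ?thesis .
      qed
      have h: "fls_nth (coeff h i) D = (if \<delta> r < d \<and> i < N d then ?f d i else 0)"
      proof -
        have "\<rho> r + 1 = \<rho> 1 + of_nat (\<delta> r + 1)"
          using \<rho>_eq_\<delta>[of r] r_ge_1 by simp
        then have "coeff h i = fps_to_fls (if i < mult_sum L \<rho> r
            then fps_shift (\<delta> r + 1) (fls_regpart (coeff f i)) * fps_X ^ (\<delta> r + 1) else 0)"
          unfolding h_def by (simp only: coeff_Ox_elem)
        then have "fls_nth (coeff h i) D = (if \<delta> r < d \<and> i < mult_sum L \<rho> r then ?f d i else 0)"
          by (auto simp: D fps_X_power_mult_right_nth simp del: power_Suc)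
        moreover have "N d = mult_sum L \<rho> r" if "\<delta> r < d"
          using that r_ge_1 by (intro N_eq_mult_sum) auto
        ultimately show ?thesis by auto
      qed
      have "?f d i = 0" if "\<not> (mlt d \<le> i \<and> i < N d)"
        using supp_spaceD(3)[OF f, of d i] that by simp
      moreover have "mlt d = exp_mult L \<rho> k" if "d = \<delta> k"
        using that exp_mult_eq[OF k(1)] by simp
      \<comment> \<open>At the first exponent n_1 = m_1, so the range m_1 \<le> i < n_1 is empty;
        this is why the first sum in \<open>space_H\<close> may start at k = 2.\<close>
      moreover have "N d = mlt d" if "d = \<delta> k" "\<not> 2 \<le> k"
      proof -
        have "k = 1" using that k(1) by simp
        then show ?thesis using that(1) \<delta>_1 N_split[of d] by simp
      qed
      moreover have "\<not> \<delta> r < d" if "k < r"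
        using k(3)[OF that] \<delta>_le[of "Suc k" r] that by simp
      moreover have "\<delta> r < d \<longleftrightarrow> \<delta> k < d" if "\<not> k < r"
        using that k(1) by (metis atLeastAtMost_iff le_antisym not_less)
      ultimately have "?f d i = fls_nth (coeff s1 i) D + fls_nth (coeff s2 i) D + fls_nth (coeff h i) D"
        unfolding s1 s2 h using k(2) by (cases "k < r"; cases "d = \<delta> k") auto
      then show ?thesis by (simp add: D)
    qed
  qed
  with inH show "f \<in> space_H A L \<rho> r" by simp
qed

lemma space_H_eq: "space_H A L \<rho> r = supp_space A (\<lambda>d i. mlt d \<le> i \<and> i < N d)"
  using space_H_subset space_H_supset by blast

end

section \<open>The formal theory\<close>

lemma shifted_D_add_right: "shifted_D q s (f + g) = shifted_D q s f + shifted_D q s g"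
  and shifted_D_diff_right: "shifted_D q s (f' - g') = shifted_D q s f' - shifted_D q s g'"
  and shifted_D_smult_right: "shifted_D q s (smult c f'') = smult c (shifted_D q s f'')"
  by (simp_all add: shifted_D_def series_D_add_right series_D_diff_right series_D_smult_right)

lemma supp_space_memI:
  assumes "\<And>d. d < 0 \<Longrightarrow> slice d h = 0" "\<And>i. fls_regpart (coeff h i) \<in> A"
    "\<And>d i. \<not> S d i \<Longrightarrow> coeff (slice (int d) h) i = 0"
  shows "h \<in> supp_space A S"
  using assms unfolding supp_space_def by blast

context exponents
begin

declare One_nat_def [simp del]

definition unit_part :: "nat \<Rightarrow> 'k fps" where
  "unit_part d = fps_shift (mlt d) (fps_of_poly (indicial_poly L \<circ>\<^sub>p [:\<rho> 1 + of_nat d, 1:]))"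

text \<open>The right inverse of $\chi(\rho_1 + d + \partial_z)$ whose values are divisible by
  $z^{m(d)}$; \<open>unit_part d\<close> is $\chi(\rho_1 + d + t) / t^{m(d)}$.\<close>

definition G :: "nat \<Rightarrow> 'k poly \<Rightarrow> 'k poly" where
  "G d p = (poly_integral ^^ mlt d) (series_D (inverse (unit_part d)) p)"

text \<open>Formulated for arbitrary sequences of polynomials, so that it can appear in a recursion
  before any series exists. The sum starts at e = 1 because L_0 cancels the part of L with e =
  0.\<close>

definition T_slice :: "nat \<Rightarrow> (nat \<Rightarrow> 'k poly) \<Rightarrow> 'k poly" where
  "T_slice d p = - (\<Sum>e=1..d. shifted_D (chi L e) (\<rho> 1 + of_nat (d - e)) (p (d - e)))"

text \<open>Substituting \<rho> 1 + d + t for the variable turns the linear factor of the indicial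
  polynomial at \<rho> 1 + d into t. As the order of the root is exact, the cofactor has nonzero
  constant term.\<close>

lemma unit_part_0: "unit_part d $ 0 \<noteq> 0"
  and X_power_mult_unit_part:
    "fps_of_poly (indicial_poly L \<circ>\<^sub>p [:\<rho> 1 + of_nat d, 1:]) = fps_X ^ mlt d * unit_part d"
proof -
  define s where "s = \<rho> 1 + of_nat d"
  obtain q where q: "indicial_poly L = [:- s, 1:] ^ mlt d * q" "\<not> [:- s, 1:] dvd q"
    using order_decomp[OF indicial_nonzero, of s] by (auto simp: mlt_def s_def)
  have "[:- s, 1:] ^ n \<circ>\<^sub>p [:s, 1:] = [:0, 1:] ^ n" for n
    by (induction n) (simp_all add: pcompose_1 pcompose_mult pcompose_pCons del: mult_pCons_left)
  then have *: "fps_of_poly (indicial_poly L \<circ>\<^sub>p [:s, 1:]) = fps_X ^ mlt d * fps_of_poly (q \<circ>\<^sub>p [:s, 1:])"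
    by (simp add: q(1) pcompose_mult fps_of_poly_mult fps_of_poly_power)
  then have u: "unit_part d = fps_of_poly (q \<circ>\<^sub>p [:s, 1:])"
    unfolding unit_part_def s_def[symmetric] *
    by (simp only: mult.commute[of "fps_X ^ _"] fps_shift_times_fps_X_power')
  with * show "fps_of_poly (indicial_poly L \<circ>\<^sub>p [:\<rho> 1 + of_nat d, 1:]) = fps_X ^ mlt d * unit_part d"
    by (simp add: s_def)
  have "coeff (q \<circ>\<^sub>p [:s, 1:]) 0 = poly q s"
    by (simp add: poly_pcompose flip: poly_0_coeff_0)
  then show "unit_part d $ 0 \<noteq> 0"
    using q(2) by (simp add: u poly_eq_0_iff_dvd)
qed

lemma shifted_D_indicial: "shifted_D (indicial_poly L) (\<rho> 1 + of_nat d) p = series_D (unit_part d) ((pderiv ^^ mlt d) p)"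
  by (simp add: shifted_D_def X_power_mult_unit_part mult.commute[of "fps_X ^ _"] series_D_mult_left series_D_X_power)

lemma unit_part_inverse: "unit_part d * inverse (unit_part d) = 1" "inverse (unit_part d) * unit_part d = 1"
  using unit_part_0[of d] by (simp_all add: inverse_mult_eq_1 inverse_mult_eq_1')

lemma shifted_D_indicial_G: "shifted_D (indicial_poly L) (\<rho> 1 + of_nat d) (G d p) = p"
  by (simp add: shifted_D_indicial G_def unit_part_inverse flip: series_D_mult_left)

text \<open>Once the unit is removed, only \<open>pderiv ^^ mlt d\<close> is left, and its kernel
  consists of the polynomials of degree below \<open>mlt d\<close>.\<close>

lemma G_shifted_D_indicial_inj:
  assumes "shifted_D (indicial_poly L) (\<rho> 1 + of_nat d) p = 0" "\<And>i. i < mlt d \<Longrightarrow> coeff p i = 0"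
  shows "p = 0"
proof -
  have "series_D (inverse (unit_part d) * unit_part d) ((pderiv ^^ mlt d) p) = 0"
    using assms(1) by (simp add: shifted_D_indicial series_D_mult_left)
  then have *: "(pderiv ^^ mlt d) p = 0" by (simp add: unit_part_inverse)
  show ?thesis
  proof (rule poly_eqI)
    fix i
    show "coeff p i = coeff 0 i"
    proof (cases "i < mlt d")
      case False
      define j where "j = i - mlt d"
      have "coeff ((pderiv ^^ mlt d) p) j = 0" using * by simp
      \<comment> \<open>The factor that z^i acquires under \<open>mlt d\<close> derivatives; it is
        nonzero in characteristic 0.\<close>
      moreover have "pochhammer (of_nat (Suc j)) (mlt d) \<noteq> (0 :: 'k)"
        by (metis of_nat_0_less_iff of_nat_eq_0_iff pochhammer_of_nat pochhammer_pos less_irrefl zero_less_Suc)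
      ultimately show ?thesis
        using False by (simp add: coeff_pderiv_pow j_def)
    qed (simp add: assms)
  qed
qed

text \<open>The derivatives lower the degree bound N(d) by \<open>mlt d\<close>, leaving N(d-1), or
  0 when d = 0; the unit does not raise it again.\<close>

lemma shifted_D_indicial_range:
  assumes "\<And>i. i \<ge> N d \<Longrightarrow> coeff p i = 0" "\<not> (1 \<le> d \<and> i < N (d - 1))"
  shows "coeff (shifted_D (indicial_poly L) (\<rho> 1 + of_nat d) p) i = 0"
proof -
  have "coeff ((pderiv ^^ mlt d) p) i = 0" if "\<not> (1 \<le> d \<and> i < N (d - 1))" for i
    using assms(1)[of "i + mlt d"] that N_split[of d]
    by (auto simp: coeff_pderiv_pow split: if_splits)
  then show ?thesis
    unfolding shifted_D_indicial using assms(2)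
    by (intro coeff_series_D_eq_0[of "if d = 0 then 0 else N (d - 1)"]) (auto split: if_splits)
qed

lemma coeff_G_low: "i < mlt d \<Longrightarrow> coeff (G d p) i = 0"
  by (simp add: G_def coeff_poly_integral_pow_low)

text \<open>Integrating \<open>mlt d\<close> times raises the degree bound N(d-1) of p to exactly
  N(d).\<close>

lemma coeff_G_high:
  assumes "\<And>i. \<not> (1 \<le> d \<and> i < N (d - 1)) \<Longrightarrow> coeff p i = 0" "i \<ge> N d"
  shows "coeff (G d p) i = 0"
  unfolding G_def
proof (rule coeff_poly_integral_pow_high)
  show "N d - mlt d + mlt d \<le> i" using assms(2) N_split[of d] by auto
  show "coeff (series_D (inverse (unit_part d)) p) i = 0" if "N d - mlt d \<le> i" for i
  proof (rule coeff_series_D_eq_0[OF _ that])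
    show "coeff p j = 0" if "N d - mlt d \<le> j" for j
      using that N_split[of d] by (intro assms(1)) (auto split: if_splits)
  qed
qed

lemma G_0 [simp]: "G d 0 = 0"
proof (rule poly_eqI)
  fix i show "coeff (G d 0) i = coeff 0 i"
  proof (cases "i < mlt d")
    case False
    then show ?thesis unfolding G_def by (simp add: coeff_poly_integral_pow_high[of 0])
  qed (simp add: coeff_G_low)
qed

text \<open>Uniqueness of the preimage with vanishing low coefficients. Linearity of
  \<open>G\<close> follows from it without touching the formula.\<close>

lemma G_eqI:
  assumes "shifted_D (indicial_poly L) (\<rho> 1 + of_nat d) q = p" "\<And>i. i < mlt d \<Longrightarrow> coeff q i = 0"
  shows "q = G d p"
proof -
  have "q - G d p = 0"
  proof (rule G_shifted_D_indicial_inj)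
    show "shifted_D (indicial_poly L) (\<rho> 1 + of_nat d) (q - G d p) = 0"
      by (simp only: shifted_D_diff_right assms(1) shifted_D_indicial_G diff_self)
    show "coeff (q - G d p) i = 0" if "i < mlt d" for i
      using that by (simp add: assms(2) coeff_G_low)
  qed
  then show ?thesis by simp
qed

lemma G_add: "G d (p + q) = G d p + G d q"
  by (rule G_eqI[symmetric]) (simp_all add: coeff_G_low shifted_D_indicial_G shifted_D_add_right)

lemma G_smult: "G d (smult c p) = smult c (G d p)"
  by (rule G_eqI[symmetric]) (simp_all add: coeff_G_low shifted_D_indicial_G shifted_D_smult_right)

lemma T_slice_add: "T_slice d (\<lambda>d. p d + q d) = T_slice d p + T_slice d q"
  by (simp add: T_slice_def shifted_D_add_right sum.distrib)

lemma T_slice_smult: "T_slice d (\<lambda>d. smult c (p d)) = smult c (T_slice d p)"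
  by (simp add: T_slice_def shifted_D_smult_right smult_sum_right)

text \<open>Strict causality: it turns the fixed point equation into a recursion and lets the n-th
  power of S_0 T kill all slices below n.\<close>

lemma T_slice_cong: "(\<And>e. e < d \<Longrightarrow> p e = q e) \<Longrightarrow> T_slice d p = T_slice d q"
  unfolding T_slice_def by (intro arg_cong[of _ _ uminus] sum.cong) auto

text \<open>Only slices d - e with e \<ge> 1 enter, and since N is increasing all of them obey the
  bound N(d-1).\<close>

lemma coeff_T_slice_high:
  assumes "\<And>d i. i \<ge> N d \<Longrightarrow> coeff (p d) i = 0" "\<not> (1 \<le> d \<and> i < N (d - 1))"
  shows "coeff (T_slice d p) i = 0"
proof (cases "d = 0")
  case False
  have "coeff (shifted_D (chi L e) (\<rho> 1 + of_nat (d - e)) (p (d - e))) i = 0" if "e \<in> {1..d}" for e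
  proof (rule coeff_shifted_D_eq_0)
    show "N (d - 1) \<le> i" using assms(2) False by auto
    show "coeff (p (d - e)) j = 0" if "N (d - 1) \<le> j" for j
    proof (rule assms(1))
      have "N (d - e) \<le> N (d - 1)" using \<open>e \<in> {1..d}\<close> by (intro N_mono) auto
      with that show "N (d - e) \<le> j" by simp
    qed
  qed
  then show ?thesis by (simp add: T_slice_def coeff_sum)
qed (simp add: T_slice_def)

lemma slice_op_L0:
  assumes "\<forall>d<0. slice d h = 0"
  shows "d < 0 \<Longrightarrow> slice d (op_L0 L \<rho> h) = 0"
    and "slice (int n) (op_L0 L \<rho> h) = shifted_D (indicial_poly L) (\<rho> 1 + of_nat n) (slice (int n) h)"
proof -
  have low: "coeff (initial_form L) j $ i = 0" if "i < j" for i j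
    using that by (simp add: coeff_initial_form[OF shift_0] fps_X_power_nth)
  show "slice d (op_L0 L \<rho> h) = 0" if "d < 0"
    unfolding op_L0_def using assms[rule_format] low that by (rule slice_act_neg)
  have "slice (int n) (op_L0 L \<rho> h)
     = (\<Sum>e\<le>n. shifted_D (chi (initial_form L) e) (\<rho> 1 + of_nat (n - e)) (slice (int (n - e)) h))"
    unfolding op_L0_def using assms[rule_format] low by (rule slice_act)
  also have "\<dots> = (\<Sum>e\<in>{0}. shifted_D (chi (initial_form L) e) (\<rho> 1 + of_nat (n - e)) (slice (int (n - e)) h))"
    by (intro sum.mono_neutral_right) (auto simp: chi_initial_form[OF shift_0])
  finally show "slice (int n) (op_L0 L \<rho> h) = shifted_D (indicial_poly L) (\<rho> 1 + of_nat n) (slice (int n) h)"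
    by (simp add: chi_initial_form[OF shift_0])
qed

lemma slice_op_T:
  assumes "\<forall>d<0. slice d h = 0"
  shows "d < 0 \<Longrightarrow> slice d (op_T L \<rho> h) = 0"
    and "slice (int n) (op_T L \<rho> h) = T_slice n (\<lambda>d. slice (int d) h)"
proof -
  note low = shift_eq_0D_below[OF L_nonzero shift_0]
  have "slice d (op_L L \<rho> h) = 0" if "d < 0" for d
    unfolding op_L_def using assms[rule_format] low that by (rule slice_act_neg)
  then show "slice d (op_T L \<rho> h) = 0" if "d < 0"
    using slice_op_L0(1)[OF assms] that by (simp add: op_T_def slice_diff)
  have "slice (int n) (op_L L \<rho> h)
     = (\<Sum>e\<le>n. shifted_D (chi L e) (\<rho> 1 + of_nat (n - e)) (slice (int (n - e)) h))"
    unfolding op_L_def using assms[rule_format] low by (rule slice_act)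
  also have "{..n} = insert 0 {1..n}" by auto
  finally show "slice (int n) (op_T L \<rho> h) = T_slice n (\<lambda>d. slice (int d) h)"
    unfolding op_T_def slice_diff slice_op_L0(2)[OF assms]
    by (simp add: T_slice_def indicial_poly_eq_chi)
qed

end

text \<open>Reassembles a sequence of polynomials in z into a polynomial over series; this requires
  the degree bound m to be common to all slices.\<close>

definition of_slices :: "nat \<Rightarrow> (nat \<Rightarrow> 'k::field_char_0 poly) \<Rightarrow> 'k fls poly" where
  "of_slices m p = (\<Sum>i<m. monom (fps_to_fls (Abs_fps (\<lambda>d. coeff (p d) i))) i)"

lemma of_slices:
  assumes "\<forall>d. \<forall>i\<ge>m. coeff (p d) i = 0"
  shows "d < 0 \<Longrightarrow> slice d (of_slices m p) = 0"
    and "slice (int n) (of_slices m p) = p n"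
    and "fls_regpart (coeff (of_slices m p) i) = Abs_fps (\<lambda>d. coeff (p d) i)"
proof -
  have "Abs_fps (\<lambda>d. coeff (p d) i) = 0" if "i \<ge> m" for i
    by (rule fps_ext) (simp add: assms that)
  then have *: "coeff (of_slices m p) i = fps_to_fls (Abs_fps (\<lambda>d. coeff (p d) i))" for i
    by (auto simp: of_slices_def coeff_sum)
  show "slice d (of_slices m p) = 0" if "d < 0"
    by (rule poly_eqI) (use that in \<open>simp add: *\<close>)
  show "slice (int n) (of_slices m p) = p n"
    by (rule poly_eqI) (simp add: *)
  show "fls_regpart (coeff (of_slices m p) i) = Abs_fps (\<lambda>d. coeff (p d) i)"
    by (simp add: *)
qed

lemma ex_course_of_values:
  fixes \<Phi> :: "(nat \<Rightarrow> 'a) \<Rightarrow> nat \<Rightarrow> 'a"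
  assumes "\<And>d p q. (\<And>e. e < d \<Longrightarrow> p e = q e) \<Longrightarrow> \<Phi> p d = \<Phi> q d"
  shows "\<exists>p. \<forall>d. p d = \<Phi> p d"
proof -
  have "adm_wf less_than \<Phi>"
    unfolding adm_wf_def
  proof (intro allI impI)
    fix p q :: "nat \<Rightarrow> 'a" and d
    assume "\<forall>e. (e, d) \<in> less_than \<longrightarrow> p e = q e"
    then show "\<Phi> p d = \<Phi> q d" by (intro assms) simp
  qed
  from wfrec_fixpoint[OF wf_less_than this]
  have "wfrec less_than \<Phi> d = \<Phi> (wfrec less_than \<Phi>) d" for d
    by (rule fun_cong)
  then show ?thesis by blast
qed

text \<open>In the metric of Laurent series, agreement at all exponents below n means distance at
  most 2^-n.\<close>

lemma LIMSEQ_fls: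
  fixes s :: "nat \<Rightarrow> 'k::field fls"
  assumes "\<And>n d. d < int n \<Longrightarrow> fls_nth (s n - l) d = 0"
  shows "s \<longlonglongrightarrow> l"
proof (rule metric_LIMSEQ_I)
  fix e :: real assume "e > 0"
  then obtain n0 where n0: "inverse (2 ^ n0) < e"
    using real_arch_pow_inv[of e "1/2"] by (auto simp: power_one_over field_simps)
  have "dist (s n) l < e" if "n \<ge> n0" for n
  proof (cases "s n = l")
    case False
    then have sub: "fls_subdegree (s n - l) \<ge> int n"
      using assms[of _ n] by (intro fls_subdegree_geI) auto
    then have "dist (s n) l = inverse (2 ^ nat (fls_subdegree (s n - l)))"
      using False by (simp add: dist_fls_def)
    also have "\<dots> \<le> inverse (2 ^ n0)"
      using sub that by (intro le_imp_inverse_le power_increasing) auto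
    finally show ?thesis using n0 by simp
  qed (use \<open>e > 0\<close> in simp)
  then show "\<exists>no. \<forall>n\<ge>no. dist (s n) l < e" by blast
qed

text \<open>The assumptions isolate what depends on the coefficient ring: that L and L_0, then S_0,
  and finally the solution of w = f + S_0 T w stay within \<open>A\<close>. In the last one p is the
  sequence of slices of w, which the recursion provides for any \<open>A\<close>; only membership of
  the assembled series is at stake.\<close>

locale normalization = exponents_ring A L \<rho> r
  for A :: "'k::field_char_0 fps set" and L :: "'k diffop" and \<rho> :: "nat \<Rightarrow> 'k" and r :: nat +
  assumes act_closed:
      "h \<in> supp_space A (\<lambda>d i. i < N d) \<Longrightarrow> fls_regpart (coeff (op_L L \<rho> h) i) \<in> A"
      "h \<in> supp_space A (\<lambda>d i. i < N d) \<Longrightarrow> fls_regpart (coeff (op_L0 L \<rho> h) i) \<in> A"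
    and G_closed:
      "h \<in> supp_space A (\<lambda>d i. 1 \<le> d \<and> i < N (d - 1)) \<Longrightarrow>
         Abs_fps (\<lambda>d. coeff (G d (slice (int d) h)) i) \<in> A"
    and fixpoint_closed:
      "f \<in> supp_space A (\<lambda>d i. i < N d) \<Longrightarrow> (\<And>d i. i \<ge> N d \<Longrightarrow> coeff (p d) i = 0) \<Longrightarrow>
         (\<And>d. p d = slice (int d) f + G d (T_slice d p)) \<Longrightarrow> Abs_fps (\<lambda>d. coeff (p d) i) \<in> A"
begin

declare One_nat_def [simp del]

abbreviation "F \<equiv> space_F A L \<rho> r"
abbreviation "Fx \<equiv> space_Fx A L \<rho> r"
abbreviation "H \<equiv> space_H A L \<rho> r"
abbreviation "S0 \<equiv> op_S0 A L \<rho> r"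
abbreviation "T \<equiv> op_T L \<rho>"
abbreviation "u \<equiv> op_u A L \<rho> r"
abbreviation "v \<equiv> op_v A L \<rho> r"

lemma F_neg: "h \<in> F \<Longrightarrow> \<forall>d<0. slice d h = 0"
  unfolding space_F_eq by (simp add: supp_spaceD(1))

lemma slice_op_L0_F:
  "h \<in> F \<Longrightarrow> slice (int n) (op_L0 L \<rho> h) = shifted_D (indicial_poly L) (\<rho> 1 + of_nat n) (slice (int n) h)"
  using F_neg by (rule slice_op_L0(2))

lemma slice_T_F: "h \<in> F \<Longrightarrow> slice (int n) (T h) = T_slice n (\<lambda>d. slice (int d) h)"
  using F_neg by (rule slice_op_T(2))

lemma F_high: "h \<in> F \<Longrightarrow> i \<ge> N d \<Longrightarrow> coeff (slice (int d) h) i = 0"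
  unfolding space_F_eq by (rule supp_spaceD(3)) auto

lemma Fx_high: "h \<in> Fx \<Longrightarrow> \<not> (1 \<le> d \<and> i < N (d - 1)) \<Longrightarrow> coeff (slice (int d) h) i = 0"
  unfolding space_Fx_eq by (rule supp_spaceD(3)) auto

lemma H_subset_F: "H \<subseteq> F"
  unfolding space_H_eq space_F_eq by (rule supp_space_mono) auto

lemma Fx_subset_F: "Fx \<subseteq> F"
  unfolding space_Fx_eq space_F_eq
proof (rule supp_space_mono)
  fix d i assume "1 \<le> d \<and> i < N (d - 1)"
  then show "i < N d" using N_mono[of "d - 1" d] by simp
qed

lemma F_add: "f \<in> F \<Longrightarrow> g \<in> F \<Longrightarrow> f + g \<in> F"
  and F_diff: "f \<in> F \<Longrightarrow> g \<in> F \<Longrightarrow> f - g \<in> F"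
  and F_smult: "f \<in> F \<Longrightarrow> smult (fls_const c) f \<in> F"
  by (simp_all add: space_F_eq supp_space_add supp_space_diff supp_space_smult)

lemma op_L0_F: "op_L0 L \<rho> \<in> F \<rightarrow> Fx"
proof
  fix h assume h: "h \<in> F"
  show "op_L0 L \<rho> h \<in> Fx"
    unfolding space_Fx_eq
  proof (rule supp_space_memI)
    show "slice d (op_L0 L \<rho> h) = 0" if "d < 0" for d
      using F_neg[OF h] that by (rule slice_op_L0(1))
    show "fls_regpart (coeff (op_L0 L \<rho> h) i) \<in> A" for i
      using act_closed(2) h by (simp add: space_F_eq)
    show "coeff (slice (int d) (op_L0 L \<rho> h)) i = 0" if "\<not> (1 \<le> d \<and> i < N (d - 1))" for d i
      unfolding slice_op_L0_F[OF h] using F_high[OF h] that by (rule shifted_D_indicial_range)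
  qed
qed

lemma T_F: "T \<in> F \<rightarrow> Fx"
proof
  fix h assume h: "h \<in> F"
  have "fls_regpart (coeff (T h) i) \<in> A" for i
    using act_closed h by (simp add: op_T_def A_diff space_F_eq)
  then show "T h \<in> Fx"
    unfolding space_Fx_eq
  proof (rule supp_space_memI[rotated])
    show "slice d (T h) = 0" if "d < 0" for d
      using F_neg[OF h] that by (rule slice_op_T(1))
    show "coeff (slice (int d) (T h)) i = 0" if "\<not> (1 \<le> d \<and> i < N (d - 1))" for d i
      unfolding slice_T_F[OF h] using F_high[OF h] that by (rule coeff_T_slice_high)
  qed
qed

lemma op_L_F: "op_L L \<rho> \<in> F \<rightarrow> F"
proof
  fix h assume "h \<in> F"
  then have "op_L0 L \<rho> h - T h \<in> F"
    using op_L0_F T_F Fx_subset_F by (intro F_diff) auto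
  then show "op_L L \<rho> h \<in> F" by (simp add: op_T_def)
qed

lemma op_L0_to_F: "op_L0 L \<rho> \<in> F \<rightarrow> F"
  using op_L0_F Fx_subset_F by auto

text \<open>An explicit counterpart of \<open>op_S0\<close>, which is given only as an abstract
  inverse.\<close>

definition L0_inverse :: "'k fls poly \<Rightarrow> 'k fls poly" where
  "L0_inverse y = of_slices (mult_sum L \<rho> r) (\<lambda>d. G d (slice (int d) y))"

lemma L0_inverse:
  assumes "y \<in> Fx"
  shows "L0_inverse y \<in> H" "slice (int d) (L0_inverse y) = G d (slice (int d) y)" "op_L0 L \<rho> (L0_inverse y) = y"
proof -
  have high: "coeff (G d (slice (int d) y)) i = 0" if "i \<ge> N d" for d i
    using Fx_high[OF assms] that by (rule coeff_G_high)
  then have "\<forall>d. \<forall>i\<ge>mult_sum L \<rho> r. coeff (G d (slice (int d) y)) i = 0"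
    using N_le order_trans by blast
  note s = of_slices[of "mult_sum L \<rho> r" "\<lambda>d. G d (slice (int d) y)", OF this, folded L0_inverse_def]
  show "slice (int d) (L0_inverse y) = G d (slice (int d) y)" by (rule s(2))
  show "L0_inverse y \<in> H"
    unfolding space_H_eq
  proof (rule supp_space_memI)
    show "coeff (slice (int d) (L0_inverse y)) i = 0" if "\<not> (mlt d \<le> i \<and> i < N d)" for d i
      unfolding s(2) using that high coeff_G_low by (meson not_le)
    show "fls_regpart (coeff (L0_inverse y) i) \<in> A" for i
      unfolding s(3) using G_closed assms by (simp add: space_Fx_eq)
  qed (rule s(1))
  have neg: "\<forall>d<0. slice d (L0_inverse y) = 0" using s(1) by blast
  show "op_L0 L \<rho> (L0_inverse y) = y"
  proof (rule slice_eqI)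
    fix d
    show "slice d (op_L0 L \<rho> (L0_inverse y)) = slice d y"
    proof (cases "d < 0")
      case True
      then show ?thesis
        using slice_op_L0(1)[OF neg True] assms by (simp add: space_Fx_eq supp_spaceD(1))
    next
      case False
      then obtain n where "d = int n" by (metis nonneg_int_cases not_less)
      then show ?thesis
        by (simp add: slice_op_L0(2)[OF neg] s(2) shifted_D_indicial_G)
    qed
  qed
qed

text \<open>An element of \<open>H\<close> is recovered from its image by \<open>G\<close>, because
  its slices have no coefficients below \<open>mlt d\<close>.\<close>

lemma bij_op_L0: "bij_betw (op_L0 L \<rho>) H Fx"
proof (rule bij_betwI')
  fix h h' assume h: "h \<in> H" "h' \<in> H"
  show "(op_L0 L \<rho> h = op_L0 L \<rho> h') = (h = h')"
  proof
    assume eq: "op_L0 L \<rho> h = op_L0 L \<rho> h'"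
    show "h = h'"
    proof (rule slice_eqI)
      fix d
      show "slice d h = slice d h'"
      proof (cases "d < 0")
        case True
        then show ?thesis using h by (simp add: space_H_eq supp_spaceD(1))
      next
        case False
        then obtain n where d: "d = int n" by (metis nonneg_int_cases not_less)
        have "slice d g = G n (slice d (op_L0 L \<rho> g))" if "g \<in> H" for g
          unfolding d
        proof (rule G_eqI)
          show "shifted_D (indicial_poly L) (\<rho> 1 + of_nat n) (slice (int n) g) = slice (int n) (op_L0 L \<rho> g)"
            using that H_subset_F by (subst slice_op_L0_F) auto
          show "coeff (slice (int n) g) i = 0" if "i < mlt n" for i
            using that \<open>g \<in> H\<close> unfolding space_H_eq by (intro supp_spaceD(3)) auto
        qed
        then show ?thesis using h eq by metis
      qed
    qed
  qed simp
next
  show "op_L0 L \<rho> h \<in> Fx" if "h \<in> H" for h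
    using that op_L0_F H_subset_F by auto
  show "\<exists>h\<in>H. y = op_L0 L \<rho> h" if "y \<in> Fx" for y
    using L0_inverse[OF that] by metis
qed

lemma S0_eq: "y \<in> Fx \<Longrightarrow> S0 y = L0_inverse y"
  unfolding op_S0_def using L0_inverse bij_op_L0
  by (intro the_inv_into_f_eq) (auto simp: bij_betw_def)

lemma S0_F: "S0 \<in> Fx \<rightarrow> F"
  using S0_eq L0_inverse(1) H_subset_F by auto

lemma op_L0_S0: "\<forall>f\<in>Fx. op_L0 L \<rho> (S0 f) = f"
  using S0_eq L0_inverse(3) by simp

definition K :: "'k fls poly \<Rightarrow> 'k fls poly" where
  "K = S0 \<circ> T"

lemma u_eq: "u f = f - K f"
  by (simp add: op_u_def K_def)

lemma K_F: "f \<in> F \<Longrightarrow> K f \<in> F"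
  using T_F S0_eq L0_inverse(1) H_subset_F by (auto simp: Pi_iff K_def)

lemma slice_K: "f \<in> F \<Longrightarrow> slice (int d) (K f) = G d (T_slice d (\<lambda>d. slice (int d) f))"
  using T_F by (simp add: K_def Pi_iff S0_eq L0_inverse(2) slice_T_F)

lemma F_eqI: "f \<in> F \<Longrightarrow> g \<in> F \<Longrightarrow> (\<And>d. slice (int d) f = slice (int d) g) \<Longrightarrow> f = g"
  by (rule slice_eqI) (metis F_neg nonneg_int_cases not_less)

lemma K_add: "f \<in> F \<Longrightarrow> g \<in> F \<Longrightarrow> K (f + g) = K f + K g"
  by (rule F_eqI) (simp_all only: K_F F_add slice_K slice_add T_slice_add G_add)

lemma K_smult: "f \<in> F \<Longrightarrow> K (smult (fls_const c) f) = smult (fls_const c) (K f)"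
  by (rule F_eqI) (simp_all only: K_F F_smult slice_K slice_smult_const T_slice_smult G_smult)

lemma Kpow_F: "f \<in> F \<Longrightarrow> (K ^^ n) f \<in> F"
  by (induction n) (simp_all add: K_F)

lemma Kpow_Suc: "(K ^^ Suc n) f = K ((K ^^ n) f)"
  by simp

lemma Kpow_add: "f \<in> F \<Longrightarrow> g \<in> F \<Longrightarrow> (K ^^ n) (f + g) = (K ^^ n) f + (K ^^ n) g"
proof (induction n)
  case (Suc n)
  then show ?case by (simp only: Kpow_Suc K_add Kpow_F)
qed simp

text \<open>Slice d of \<open>K g\<close> depends only on earlier slices of g, so each application
  of \<open>K\<close> clears one more slice.\<close>

lemma slice_Kpow_0: "f \<in> F \<Longrightarrow> d < n \<Longrightarrow> slice (int d) ((K ^^ n) f) = 0"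
proof (induction n arbitrary: d)
  case (Suc n)
  have "T_slice d (\<lambda>d. slice (int d) ((K ^^ n) f)) = T_slice d (\<lambda>d. 0)"
    using Suc by (intro T_slice_cong) (simp add: Suc.IH)
  also have "\<dots> = 0" by (simp add: T_slice_def)
  finally show ?case
    using Suc.prems by (simp only: Kpow_Suc slice_K Kpow_F G_0)
qed simp

lemma u_F: "f \<in> F \<Longrightarrow> u f \<in> F"
  unfolding u_eq by (intro F_diff K_F)

text \<open>The slices of w come from recursion, the common degree bound from induction along it,
  and only then does \<open>fixpoint_closed\<close> place the assembled series in
  \<open>F\<close>.\<close>

lemma ex_fixpoint:
  assumes f: "f \<in> F"
  shows "\<exists>w\<in>F. w = f + K w"
proof -
  obtain p where p: "\<And>d. p d = slice (int d) f + G d (T_slice d p)"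
  proof -
    have "\<exists>p. \<forall>d. p d = slice (int d) f + G d (T_slice d p)"
    proof (rule ex_course_of_values)
      fix d :: nat and p q assume "\<And>e. e < d \<Longrightarrow> p e = (q e :: 'k poly)"
      then have "T_slice d p = T_slice d q" by (rule T_slice_cong)
      then show "slice (int d) f + G d (T_slice d p) = slice (int d) f + G d (T_slice d q)" by simp
    qed
    then show ?thesis using that by blast
  qed
  have high: "coeff (p d) i = 0" if "i \<ge> N d" for d i
    using that
  proof (induction d arbitrary: i rule: less_induct)
    case (less d)
    \<comment> \<open>\<open>coeff_T_slice_high\<close> wants the degree bound at all indices,
      whereas the induction hypothesis gives it below d; cutting p off at d does not change slice
      d.\<close>
    define q where "q e = (if e < d then p e else 0)" for e
    have "T_slice d p = T_slice d q" by (rule T_slice_cong) (simp add: q_def)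
    moreover have "coeff (T_slice d q) i = 0" if "\<not> (1 \<le> d \<and> i < N (d - 1))" for i
      by (rule coeff_T_slice_high[OF _ that]) (auto simp: q_def less.IH)
    ultimately have "coeff (G d (T_slice d p)) i = 0"
      using less.prems by (intro coeff_G_high) auto
    then show ?case
      using F_high[OF f less.prems] by (subst p) (simp del: coeff_slice)
  qed
  define w where "w = of_slices (mult_sum L \<rho> r) p"
  have "\<forall>d. \<forall>i\<ge>mult_sum L \<rho> r. coeff (p d) i = 0"
    using high N_le order_trans by blast
  note s = of_slices[of "mult_sum L \<rho> r" p, OF this, folded w_def]
  have "Abs_fps (\<lambda>d. coeff (p d) i) \<in> A" for i
    using f high p unfolding space_F_eq by (rule fixpoint_closed)
  then have w: "w \<in> F"
    unfolding space_F_eq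
    by (intro supp_space_memI) (simp_all add: s high not_less del: coeff_slice)
  moreover have "w = f + K w"
  proof (rule F_eqI)
    show "f + K w \<in> F" using f w by (intro F_add K_F)
    show "slice (int d) w = slice (int d) (f + K w)" for d
      using p[of d] by (simp only: slice_add slice_K[OF w] s)
  qed (rule w)
  ultimately show ?thesis by blast
qed

text \<open>Injectivity is uniqueness of the recursion: slice d of f is determined by slice d of
  \<open>u f\<close> and the earlier slices of f.\<close>

lemma bij_u: "bij_betw u F F"
proof (rule bij_betwI')
  fix f g assume fg: "f \<in> F" "g \<in> F"
  show "(u f = u g) = (f = g)"
  proof
    assume eq: "u f = u g"
    have *: "slice (int d) h = slice (int d) (u h) + G d (T_slice d (\<lambda>d. slice (int d) h))" if "h \<in> F" for d h
      by (simp add: u_eq slice_diff slice_K[OF that])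
    have "slice (int d) f = slice (int d) g" for d
    proof (induction d rule: less_induct)
      case (less d)
      have "T_slice d (\<lambda>d. slice (int d) f) = T_slice d (\<lambda>d. slice (int d) g)"
        by (rule T_slice_cong) (rule less)
      then show ?case using *[OF fg(1), of d] *[OF fg(2), of d] eq by simp
    qed
    with fg show "f = g" by (intro F_eqI)
  qed simp
next
  show "u f \<in> F" if "f \<in> F" for f using that by (rule u_F)
  show "\<exists>w\<in>F. f = u w" if "f \<in> F" for f
    using ex_fixpoint[OF that] unfolding u_eq by (metis add_diff_cancel_right')
qed

lemma v: 
  assumes "f \<in> F"
  shows "v f \<in> F" "v f = f + K (v f)"
proof -
  obtain w where w: "w \<in> F" "w = f + K w" using ex_fixpoint[OF assms] by blast
  have "u w = f" using w(2) unfolding u_eq by (metis add_diff_cancel_right')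
  then have "v f = w"
    unfolding op_v_def using w(1) bij_u by (intro the_inv_into_f_eq) (auto simp: bij_betw_def)
  with w show "v f \<in> F" "v f = f + K (v f)" by simp_all
qed

lemma Kpow_v:
  assumes "f \<in> F"
  shows "(K ^^ n) (v f) = (K ^^ n) f + (K ^^ Suc n) (v f)"
proof -
  have "(K ^^ n) (v f) = (K ^^ n) (f + K (v f))"
    using v(2)[OF assms] by simp
  also have "\<dots> = (K ^^ n) f + (K ^^ n) (K (v f))"
    using v(1)[OF assms] assms by (intro Kpow_add K_F)
  also have "(K ^^ n) (K (v f)) = (K ^^ Suc n) (v f)"
    by (simp add: funpow_swap1)
  finally show ?thesis .
qed

text \<open>Iterating v f = f + K (v f) leaves an exact remainder, whose slices below n
  vanish.\<close>

lemma v_partial_sum: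
  assumes "f \<in> F"
  shows "v f - (\<Sum>k<n. (K ^^ k) f) = (K ^^ n) (v f)"
proof (induction n)
  case (Suc n)
  have "v f - (\<Sum>k<Suc n. (K ^^ k) f) = (v f - (\<Sum>k<n. (K ^^ k) f)) - (K ^^ n) f"
    by simp
  also have "\<dots> = (K ^^ Suc n) (v f)"
    unfolding Suc.IH using Kpow_v[OF assms, of n] by (metis add_diff_cancel_left')
  finally show ?case .
qed simp

lemma xadic_sums_v:
  assumes "f \<in> F"
  shows "xadic_sums (\<lambda>k. (K ^^ k) f) (v f)"
  unfolding xadic_sums_def sums_def
proof (intro allI LIMSEQ_fls)
  fix i n d assume d: "d < int n"
  have "(\<Sum>k<n. (K ^^ k) f) - v f = - (K ^^ n) (v f)"
    by (simp only: v_partial_sum[OF assms, symmetric] minus_diff_eq)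
  then have "fls_nth ((\<Sum>k<n. coeff ((K ^^ k) f) i) - coeff (v f) i) d = - coeff (slice d ((K ^^ n) (v f))) i"
    by (metis coeff_diff coeff_minus coeff_slice coeff_sum fls_uminus_nth)
  also have "slice d ((K ^^ n) (v f)) = 0"
  proof (cases "d < 0")
    case True
    then show ?thesis using F_neg[OF Kpow_F[OF v(1)[OF assms]]] by simp
  next
    case False
    then obtain m where "d = int m" by (metis nonneg_int_cases not_less)
    with d show ?thesis using slice_Kpow_0[OF v(1)[OF assms], of m n] by simp
  qed
  finally show "fls_nth ((\<Sum>k<n. coeff ((K ^^ k) f) i) - coeff (v f) i) d = 0" by simp
qed

text \<open>Applying L_0 to v f = f + K (v f) turns the last term into T (v f); moved to the other
  side, it changes L_0 into L.\<close>

lemma op_L_v: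
  assumes "f \<in> F"
  shows "op_L L \<rho> (v f) = op_L0 L \<rho> f"
proof -
  note w = v[OF assms]
  have Kw: "op_L0 L \<rho> (K (v f)) = T (v f)"
    using T_F w(1) by (simp add: K_def Pi_iff S0_eq L0_inverse(3))
  have "op_L0 L \<rho> (f + K (v f)) = op_L0 L \<rho> f + op_L0 L \<rho> (K (v f))"
  proof (rule F_eqI)
    have 1: "op_L0 L \<rho> h \<in> F" if "h \<in> F" for h
      using that op_L0_F Fx_subset_F by auto
    show "op_L0 L \<rho> (f + K (v f)) \<in> F" "op_L0 L \<rho> f + op_L0 L \<rho> (K (v f)) \<in> F"
      using assms w(1) by (auto intro!: 1 F_add K_F)
    show "slice (int d) (op_L0 L \<rho> (f + K (v f))) = slice (int d) (op_L0 L \<rho> f + op_L0 L \<rho> (K (v f)))" for d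
      by (simp only: slice_add slice_op_L0_F F_add assms w(1) K_F shifted_D_add_right)
  qed
  then have "op_L0 L \<rho> (v f) = op_L0 L \<rho> f + T (v f)"
    using w(2) Kw by simp
  then show ?thesis by (simp add: op_T_def)
qed

lemma linear_automorphism_u: "linear_automorphism F u"
  unfolding linear_automorphism_def
  using bij_u by (simp add: u_eq K_add K_smult smult_diff_right)

end

section \<open>Geometric bounds\<close>

lemma fps_conv_radius_geometric:
  fixes g :: "complex fps"
  assumes "\<And>d. norm (g $ d) \<le> B * Q ^ d" "Q > 0"
  shows "ereal (1 / Q) \<le> fps_conv_radius g"
  unfolding fps_conv_radius_def
proof (rule conv_radius_geI_ex')
  fix s :: real assume s: "0 < s" "ereal s < ereal (1 / Q)"
  then have "Q * s < 1" using assms(2) by (simp add: field_simps)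
  then have "summable (\<lambda>d. B * (Q * s) ^ d)"
    using s assms(2) by (intro summable_mult summable_geometric) simp
  moreover have "norm (g $ d * of_real s ^ d) \<le> B * (Q * s) ^ d" for d
  proof -
    have "norm (g $ d) * s ^ d \<le> (B * Q ^ d) * s ^ d"
      using assms(1) s by (intro mult_right_mono) auto
    then show ?thesis using s by (simp add: norm_mult norm_power power_mult_distrib mult_ac)
  qed
  ultimately show "summable (\<lambda>d. g $ d * of_real s ^ d)"
    by (rule summable_comparison_test'[where N = 0])
qed

text \<open>On half of the guaranteed disc the terms are dominated by B / 2^d, so the bound depends
  neither on x nor on Q.\<close>

lemma norm_eval_fps_geometric:
  fixes g :: "complex fps"
  assumes "\<And>d. norm (g $ d) \<le> B * Q ^ d" "Q > 0" "norm x < 1 / (2 * Q)" "B \<ge> 0"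
  shows "norm (eval_fps g x) \<le> 2 * B"
proof -
  have le: "norm (g $ d * x ^ d) \<le> B * (1 / 2) ^ d" for d
  proof -
    have "norm (g $ d * x ^ d) \<le> (B * Q ^ d) * (1 / (2 * Q)) ^ d"
      unfolding norm_mult norm_power using assms
      by (intro mult_mono power_mono) auto
    also have "\<dots> = B * (1 / 2) ^ d" using assms(2) by (simp add: power_mult_distrib power_divide)
    finally show ?thesis .
  qed
  have sm: "(\<lambda>d. B * (1 / 2) ^ d) sums (B * (1 / (1 - 1 / 2)))"
    by (intro sums_mult geometric_sums) simp
  have "norm (eval_fps g x) \<le> (\<Sum>d. B * (1 / 2) ^ d)"
    unfolding eval_fps_def using le by (intro norm_suminf_le sums_summable[OF sm]) auto
  also have "\<dots> = 2 * B" using sums_unique[OF sm] by simp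
  finally show ?thesis .
qed

section \<open>Geometric growth of coefficient sequences\<close>

definition geom_bounded :: "(nat \<Rightarrow> real) \<Rightarrow> bool" where
  "geom_bounded a \<longleftrightarrow> (\<exists>B\<ge>0. \<exists>Q\<ge>1. \<forall>d. a d \<le> B * Q ^ d)"

lemma geom_boundedI: "(\<And>d. a d \<le> B * Q ^ d) \<Longrightarrow> Q \<ge> 1 \<Longrightarrow> B \<ge> 0 \<Longrightarrow> geom_bounded a"
  unfolding geom_bounded_def by blast

lemma geom_bounded_mono: "geom_bounded b \<Longrightarrow> (\<And>d. a d \<le> b d) \<Longrightarrow> geom_bounded a"
  unfolding geom_bounded_def by (meson order_trans)

lemma geom_bounded_const: "geom_bounded (\<lambda>d. c)"
  by (rule geom_boundedI[of _ "\<bar>c\<bar>" 1]) auto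

lemma geom_bounded_mult:
  assumes "geom_bounded a" "geom_bounded b" "\<And>d. a d \<ge> 0" "\<And>d. b d \<ge> 0"
  shows "geom_bounded (\<lambda>d. a d * b d)"
proof -
  obtain A Q B R where a: "A \<ge> 0" "Q \<ge> 1" "\<And>d. a d \<le> A * Q ^ d"
    and b: "B \<ge> 0" "R \<ge> 1" "\<And>d. b d \<le> B * R ^ d"
    using assms(1,2) unfolding geom_bounded_def by blast
  have "a d * b d \<le> (A * B) * (Q * R) ^ d" for d
  proof -
    have "a d * b d \<le> (A * Q ^ d) * (B * R ^ d)"
      using a b assms(3,4) by (intro mult_mono) auto
    then show ?thesis by (simp add: power_mult_distrib mult_ac)
  qed
  moreover have "Q * R \<ge> 1" using a b mult_mono[of 1 Q 1 R] by simp
  ultimately show ?thesis using a b by (intro geom_boundedI[of _ "A * B" "Q * R"]) auto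
qed

lemma geom_bounded_linear: "geom_bounded (\<lambda>d. 1 + real d)"
proof (rule geom_boundedI[of _ 1 2])
  show "1 + real d \<le> 1 * 2 ^ d" for d
    by (induction d) auto
qed auto

lemma geom_bounded_power:
  assumes "geom_bounded a" "\<And>d. a d \<ge> 0"
  shows "geom_bounded (\<lambda>d. a d ^ k)"
proof (induction k)
  case (Suc k)
  then have "geom_bounded (\<lambda>d. a d * a d ^ k)"
    using assms by (intro geom_bounded_mult) auto
  then show ?case by simp
qed (simp add: geom_bounded_const)

lemma geom_bounded_add:
  assumes "geom_bounded a" "geom_bounded b"
  shows "geom_bounded (\<lambda>d. a d + b d)"
proof -
  obtain A Q B R where a: "A \<ge> 0" "Q \<ge> 1" "\<And>d. a d \<le> A * Q ^ d"
    and b: "B \<ge> 0" "R \<ge> 1" "\<And>d. b d \<le> B * R ^ d"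
    using assms(1,2) unfolding geom_bounded_def by blast
  have "a d + b d \<le> (A + B) * (max Q R) ^ d" for d
  proof -
    have "a d + b d \<le> A * Q ^ d + B * R ^ d" using a b by (intro add_mono) auto
    also have "\<dots> \<le> A * (max Q R) ^ d + B * (max Q R) ^ d"
      using a b by (intro add_mono mult_left_mono power_mono) auto
    finally show ?thesis by (simp add: distrib_right)
  qed
  then show ?thesis using a b by (intro geom_boundedI[of _ "A + B" "max Q R"]) auto
qed

lemma geom_bounded_sum:
  "(\<And>x. x \<in> S \<Longrightarrow> geom_bounded (a x)) \<Longrightarrow> geom_bounded (\<lambda>d. \<Sum>x\<in>S. a x d)"
  by (induction S rule: infinite_finite_induct) (auto intro: geom_bounded_const geom_bounded_add)

lemma geom_bounded_shift:
  assumes "geom_bounded a"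
  shows "geom_bounded (\<lambda>d. a (j + d))"
proof -
  obtain A Q where a: "A \<ge> 0" "Q \<ge> 1" "\<And>d. a d \<le> A * Q ^ d"
    using assms(1) unfolding geom_bounded_def by blast
  have "a (j + d) \<le> (A * Q ^ j) * Q ^ d" for d
    using a(3)[of "j + d"] by (simp add: power_add mult_ac)
  then show ?thesis using a by (intro geom_boundedI[of _ "A * Q ^ j" Q]) auto
qed

text \<open>Each of the d + 1 products is at most A B max(Q,R)^d, and the factor d + 1 is itself
  geometrically bounded.\<close>

lemma geom_bounded_convolution:
  assumes "geom_bounded a" "geom_bounded b" "\<And>d. a d \<ge> 0" "\<And>d. b d \<ge> 0"
  shows "geom_bounded (\<lambda>d. \<Sum>e\<le>d. a e * b (d - e))"
proof -
  obtain A Q B R where a: "A \<ge> 0" "Q \<ge> 1" "\<And>d. a d \<le> A * Q ^ d"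
    and b: "B \<ge> 0" "R \<ge> 1" "\<And>d. b d \<le> B * R ^ d"
    using assms(1,2) unfolding geom_bounded_def by blast
  have "(\<Sum>e\<le>d. a e * b (d - e)) \<le> (1 + real d) * ((A * B) * (max Q R) ^ d)" for d
  proof -
    have "(\<Sum>e\<le>d. a e * b (d - e)) \<le> (\<Sum>e\<le>d. (A * B) * (max Q R) ^ d)"
    proof (rule sum_mono)
      fix e assume e: "e \<in> {..d}"
      have "a e * b (d - e) \<le> (A * (max Q R) ^ e) * (B * (max Q R) ^ (d - e))"
        using a b assms(3,4)
        by (intro mult_mono order_trans[OF a(3)] order_trans[OF b(3)] mult_left_mono power_mono) auto
      also have "\<dots> = (A * B) * (max Q R) ^ d"
        using e by (simp flip: power_add)
      finally show "a e * b (d - e) \<le> (A * B) * (max Q R) ^ d" .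
    qed
    then show ?thesis by (simp add: algebra_simps)
  qed
  moreover have "geom_bounded (\<lambda>d. (1 + real d) * ((A * B) * (max Q R) ^ d))"
    using a b by (intro geom_bounded_mult geom_bounded_linear geom_boundedI[of _ "A * B" "max Q R"]) auto
  ultimately show ?thesis by (rule geom_bounded_mono[rotated])
qed

text \<open>The terms of the series at a point inside the disc of convergence are bounded, which
  gives geometric growth. Membership in the ring of germs thus becomes a condition that can be
  checked on slices.\<close>

lemma hol_germs_iff: "g \<in> hol_germs \<longleftrightarrow> geom_bounded (\<lambda>d. norm (g $ d))"
proof
  assume "g \<in> hol_germs"
  then have "fps_conv_radius g > 0" by (simp add: hol_germs_eq)
  then obtain s where s: "0 < ereal s" "ereal s < fps_conv_radius g"
    using ereal_dense2 by blast
  then have "summable (\<lambda>d. g $ d * of_real s ^ d)"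
    unfolding fps_conv_radius_def by (intro summable_in_conv_radius) auto
  then have "Bseq (\<lambda>d. g $ d * of_real s ^ d)"
    using convergent_imp_Bseq convergentI summable_LIMSEQ_zero by blast
  then obtain B where B: "B > 0" "\<And>d. norm (g $ d * of_real s ^ d) \<le> B"
    by (auto elim: BseqE)
  have "norm (g $ d) \<le> B * (max 1 (1 / s)) ^ d" for d
  proof -
    have "norm (g $ d) \<le> B * (1 / s) ^ d"
      using B(2)[of d] s(1) by (simp add: norm_mult norm_power power_divide field_simps)
    also have "\<dots> \<le> B * (max 1 (1 / s)) ^ d"
      using B s by (intro mult_left_mono power_mono) auto
    finally show ?thesis .
  qed
  then show "geom_bounded (\<lambda>d. norm (g $ d))"
    using B by (intro geom_boundedI) auto
next
  assume "geom_bounded (\<lambda>d. norm (g $ d))"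
  then obtain B Q where "Q \<ge> 1" "\<And>d. norm (g $ d) \<le> B * Q ^ d"
    unfolding geom_bounded_def by blast
  then have "0 < ereal (1 / Q)" "ereal (1 / Q) \<le> fps_conv_radius g"
    using fps_conv_radius_geometric[of g B Q] by auto
  then have "0 < fps_conv_radius g" by (rule less_le_trans)
  then show "g \<in> hol_germs" by (simp add: hol_germs_eq)
qed

interpretation hol_germs: coeff_ring hol_germs
proof
  fix f g :: "complex fps" and c
  show "fps_const c \<in> hol_germs" by (simp add: hol_germs_eq)
  show "f - g \<in> hol_germs" if "f \<in> hol_germs" "g \<in> hol_germs"
    using that fps_conv_radius_diff[of f g] by (auto simp: hol_germs_eq min_def split: if_splits)
  show "fps_const c * f \<in> hol_germs" if "f \<in> hol_germs"
    using that fps_conv_radius_mult[of "fps_const c" f] by (auto simp: hol_germs_eq)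
  show "f * fps_X \<in> hol_germs" if "f \<in> hol_germs"
    using that fps_conv_radius_mult[of f "fps_X"] by (auto simp: hol_germs_eq)
  show "fps_shift 1 f \<in> hol_germs" if "f \<in> hol_germs"
    using that by (simp add: hol_germs_eq)
qed

section \<open>The norm of a slice and the size of the operators acting on it\<close>

definition coeff_norm :: "nat \<Rightarrow> complex poly \<Rightarrow> real" where
  "coeff_norm m p = (\<Sum>i<m. norm (coeff p i))"

lemma coeff_norm_nonneg [simp]: "coeff_norm m p \<ge> 0"
  by (simp add: coeff_norm_def sum_nonneg)

lemma coeff_norm_0 [simp]: "coeff_norm m 0 = 0"
  by (simp add: coeff_norm_def)

lemma coeff_norm_add: "coeff_norm m (p + q) \<le> coeff_norm m p + coeff_norm m q"
  unfolding coeff_norm_def sum.distrib[symmetric] coeff_add by (intro sum_mono norm_triangle_ineq)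

lemma coeff_norm_smult: "coeff_norm m (smult c p) = norm c * coeff_norm m p"
  by (simp add: coeff_norm_def norm_mult sum_distrib_left)

lemma coeff_norm_minus [simp]: "coeff_norm m (- p) = coeff_norm m p"
  by (simp add: coeff_norm_def)

lemma coeff_norm_sum: "coeff_norm m (sum f S) \<le> (\<Sum>x\<in>S. coeff_norm m (f x))"
proof (induction S rule: infinite_finite_induct)
  case (insert x S)
  then show ?case using coeff_norm_add[of m "f x" "sum f S"] by simp
qed auto

lemma norm_coeff_le_coeff_norm: "i < m \<Longrightarrow> norm (coeff p i) \<le> coeff_norm m p"
  unfolding coeff_norm_def by (rule member_le_sum) auto

text \<open>A bounded z-degree makes differentiation a bounded operator: the multipliers are at most
  m.\<close>

lemma coeff_norm_pderiv:
  assumes "\<And>i. i \<ge> m \<Longrightarrow> coeff p i = 0"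
  shows "coeff_norm m (pderiv p) \<le> real m * coeff_norm m p"
proof -
  have "coeff_norm m (pderiv p) = (\<Sum>i<m. real (Suc i) * norm (coeff p (Suc i)))"
    unfolding coeff_norm_def coeff_pderiv norm_mult norm_of_nat by simp
  also have "\<dots> \<le> (\<Sum>i<m. real m * norm (coeff p (Suc i)))"
    by (intro sum_mono mult_right_mono) auto
  also have "\<dots> = real m * (\<Sum>i<m. norm (coeff p (Suc i)))"
    by (simp add: sum_distrib_left)
  also have "(\<Sum>i<m. norm (coeff p (Suc i))) \<le> (\<Sum>i<Suc m. norm (coeff p i))"
    by (subst sum.lessThan_Suc_shift) simp
  also have "\<dots> = coeff_norm m p" using assms by (simp add: coeff_norm_def)
  finally show ?thesis by (simp add: mult_left_mono)
qed

lemma coeff_norm_pderiv_pow: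
  assumes "\<And>i. i \<ge> m \<Longrightarrow> coeff p i = 0"
  shows "coeff_norm m ((pderiv ^^ l) p) \<le> real m ^ l * coeff_norm m p"
proof (induction l)
  case (Suc l)
  have "coeff_norm m ((pderiv ^^ Suc l) p) \<le> real m * coeff_norm m ((pderiv ^^ l) p)"
    using assms by (simp, intro coeff_norm_pderiv) (simp add: coeff_pderiv_pow)
  also have "\<dots> \<le> real m * (real m ^ l * coeff_norm m p)"
    by (intro mult_left_mono Suc) auto
  finally show ?case by simp
qed simp

text \<open>Integration divides by i + 1 \<ge> 1, and a coefficient moved to index m or beyond is
  not counted by the norm.\<close>

lemma coeff_norm_poly_integral: "coeff_norm m (poly_integral p) \<le> coeff_norm m p"
proof (cases m)
  case (Suc k)
  have "coeff_norm (Suc k) (poly_integral p) = (\<Sum>i<k. norm (coeff p i / of_nat (Suc i)))"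
    unfolding coeff_norm_def by (subst sum.lessThan_Suc_shift) (simp add: coeff_poly_integral)
  also have "\<dots> \<le> (\<Sum>i<k. norm (coeff p i))"
  proof (rule sum_mono)
    fix i
    have "norm (coeff p i) / real (Suc i) \<le> norm (coeff p i) / 1"
      by (rule divide_left_mono) auto
    then show "norm (coeff p i / of_nat (Suc i)) \<le> norm (coeff p i)"
      by (simp add: norm_divide del: of_nat_Suc)
  qed
  also have "\<dots> \<le> coeff_norm (Suc k) p" by (simp add: coeff_norm_def)
  finally show ?thesis by (simp add: Suc)
qed (simp add: coeff_norm_def)

lemma coeff_norm_poly_integral_pow: "coeff_norm m ((poly_integral ^^ l) p) \<le> coeff_norm m p"
  by (induction l) (auto intro: order_trans[OF coeff_norm_poly_integral])

lemma coeff_norm_series_D: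
  assumes "\<And>i. i \<ge> m \<Longrightarrow> coeff p i = 0"
  shows "coeff_norm m (series_D w p) \<le> (\<Sum>l<m. norm (w $ l) * real m ^ l) * coeff_norm m p"
proof -
  have "coeff_norm m (series_D w p) \<le> (\<Sum>l<m. coeff_norm m (smult (w $ l) ((pderiv ^^ l) p)))"
    by (subst series_D_bound'[of m]) (use assms coeff_norm_sum in auto)
  also have "\<dots> \<le> (\<Sum>l<m. norm (w $ l) * (real m ^ l * coeff_norm m p))"
    unfolding coeff_norm_smult by (intro sum_mono mult_left_mono coeff_norm_pderiv_pow assms) auto
  finally show ?thesis by (simp only: sum_distrib_right mult.assoc)
qed

text \<open>A product of j operators, differentiation plus the scalar \<sigma> - l, each of norm at
  most |\<sigma> - l| + m.\<close>

lemma coeff_norm_shifted_D_falling_poly: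
  assumes "\<And>i. i \<ge> m \<Longrightarrow> coeff p i = 0" "\<And>l. l < j \<Longrightarrow> norm (\<sigma> - of_nat l) + real m \<le> R" "R \<ge> 0"
  shows "coeff_norm m (shifted_D (falling_poly j) \<sigma> p) \<le> R ^ j * coeff_norm m p"
  using assms(2)
proof (induction j)
  case 0
  then show ?case by (simp add: falling_poly_def)
next
  case (Suc j)
  let ?q = "shifted_D (falling_poly j) \<sigma> p"
  have "coeff_norm m (shifted_D (falling_poly (Suc j)) \<sigma> p) \<le> norm (\<sigma> - of_nat j) * coeff_norm m ?q + coeff_norm m (pderiv ?q)"
    unfolding shifted_D_falling_poly_Suc using coeff_norm_add coeff_norm_smult by metis
  also have "coeff_norm m (pderiv ?q) \<le> real m * coeff_norm m ?q"
    by (intro coeff_norm_pderiv coeff_shifted_D_eq_0[OF assms(1)])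
  finally have "coeff_norm m (shifted_D (falling_poly (Suc j)) \<sigma> p) \<le> (norm (\<sigma> - of_nat j) + real m) * coeff_norm m ?q"
    by (simp add: distrib_right)
  also have "\<dots> \<le> R * (R ^ j * coeff_norm m p)"
    using Suc.prems assms(3) by (intro mult_mono Suc.IH Suc.prems) auto
  finally show ?case by simp
qed

text \<open>The sum norm of \<open>chi M e\<close> in the basis of falling factorials.\<close>

definition chi_norm :: "complex diffop \<Rightarrow> nat \<Rightarrow> real" where
  "chi_norm M e = (\<Sum>j\<le>degree M. norm (coeff M j $ (j + e)))"

lemma chi_norm_nonneg [simp]: "chi_norm M e \<ge> 0"
  by (simp add: chi_norm_def sum_nonneg)

lemma geom_bounded_chi_norm:
  assumes "\<And>j. coeff M j \<in> hol_germs"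
  shows "geom_bounded (chi_norm M)"
  unfolding chi_norm_def using assms
  by (intro geom_bounded_sum geom_bounded_shift[of "\<lambda>i. norm (coeff M j $ i)" for j]) (simp add: hol_germs_iff)

text \<open>Chosen so that |b + t - l| + m \<le> \<open>growth M b m\<close> (1 + t) for all l below
  the order, which bounds every factor of a falling factorial at b + t. The summand 1 makes the
  powers of this bound increasing.\<close>

definition growth :: "complex diffop \<Rightarrow> complex \<Rightarrow> nat \<Rightarrow> real" where
  "growth M b m = norm b + degree M + m + 1"

lemma growth_ge_1: "growth M b m \<ge> 1"
  by (simp add: growth_def)

lemma coeff_norm_shifted_D_chi:
  assumes "\<And>i. i \<ge> m \<Longrightarrow> coeff p i = 0"
  shows "coeff_norm m (shifted_D (chi M e) (b + of_nat t) p)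
           \<le> chi_norm M e * (growth M b m * (1 + real t)) ^ degree M * coeff_norm m p"
proof -
  define R where "R = growth M b m * (1 + real t)"
  have R1: "R \<ge> 1" unfolding R_def using growth_ge_1[of M b m] mult_mono[of 1 "growth M b m" 1 "1 + real t"] by simp
  have "coeff_norm m (shifted_D (chi M e) (b + of_nat t) p)
     \<le> (\<Sum>j\<le>degree M. norm (coeff M j $ (j + e)) * coeff_norm m (shifted_D (falling_poly j) (b + of_nat t) p))"
    unfolding chi_def shifted_D_sum_left shifted_D_smult_left coeff_norm_smult[symmetric] by (rule coeff_norm_sum)
  also have "\<dots> \<le> (\<Sum>j\<le>degree M. norm (coeff M j $ (j + e)) * (R ^ degree M * coeff_norm m p))"
  proof (intro sum_mono mult_left_mono)
    fix j assume j: "j \<in> {..degree M}"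
    have "norm (b + of_nat t - of_nat l) + real m \<le> R" if "l < j" for l
    proof -
      have "norm (b + of_nat t - of_nat l) \<le> norm b + real t + real l"
        using norm_triangle_ineq4[of "b + of_nat t" "of_nat l"] norm_triangle_ineq[of b "of_nat t"] by simp
      also have "\<dots> + real m \<le> growth M b m + real t"
        using that j by (simp add: growth_def)
      also have "\<dots> \<le> R"
        using growth_ge_1[of M b m] mult_right_mono[of 1 "growth M b m" "real t"] by (simp add: R_def algebra_simps)
      finally show ?thesis by simp
    qed
    then have "coeff_norm m (shifted_D (falling_poly j) (b + of_nat t) p) \<le> R ^ j * coeff_norm m p"
      using R1 by (intro coeff_norm_shifted_D_falling_poly assms) auto
    also have "\<dots> \<le> R ^ degree M * coeff_norm m p"
      using R1 j by (intro mult_right_mono power_increasing) auto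
    finally show "coeff_norm m (shifted_D (falling_poly j) (b + of_nat t) p) \<le> R ^ degree M * coeff_norm m p" .
  qed auto
  finally show ?thesis
    by (simp add: chi_norm_def sum_distrib_right R_def mult.assoc)
qed

lemma geom_bounded_slices:
  assumes "h \<in> supp_space hol_germs S"
  shows "geom_bounded (\<lambda>d. coeff_norm m (slice (int d) h))"
  unfolding coeff_norm_def
proof (rule geom_bounded_sum)
  fix i
  have "geom_bounded (\<lambda>d. norm (fls_regpart (coeff h i) $ d))"
    using supp_spaceD(2)[OF assms] by (simp only: hol_germs_iff)
  then show "geom_bounded (\<lambda>d. norm (coeff (slice (int d) h) i))" by simp
qed

lemma geom_bounded_imp_hol_germs:
  assumes "geom_bounded (\<lambda>d. coeff_norm m (p d))" "\<And>d i. i \<ge> m \<Longrightarrow> coeff (p d) i = 0"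
  shows "Abs_fps (\<lambda>d. coeff (p d) i) \<in> hol_germs"
proof (cases "i < m")
  case True
  then show ?thesis
    unfolding hol_germs_iff by (intro geom_bounded_mono[OF assms(1)]) (simp add: norm_coeff_le_coeff_norm)
next
  case False
  then have "Abs_fps (\<lambda>d. coeff (p d) i) = 0" using assms(2) by (intro fps_ext) simp
  then show ?thesis using hol_germs.A_0 by simp
qed

text \<open>The slices of the image are convolutions of geometrically bounded sequences. The powers
  of 1 + t due to differentiation are harmless, as they occur once and not along a
  recursion.\<close>

lemma act_hol_germs:
  assumes h: "h \<in> supp_space hol_germs S" "\<And>d i. S d i \<Longrightarrow> i < m"
    and M: "\<And>j. coeff M j \<in> hol_germs" "\<And>i j. i < j \<Longrightarrow> coeff M j $ i = 0"
  shows "fls_regpart (coeff (act b M h) i) \<in> hol_germs"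
proof -
  have neg: "slice d h = 0" if "d < 0" for d using supp_spaceD(1)[OF h(1) that] .
  have high: "coeff (slice (int d) h) i = 0" if "m \<le> i" for d i
    using supp_spaceD(3)[OF h(1)] h(2) that by (meson not_le)
  define p where "p d = (\<Sum>e\<le>d. shifted_D (chi M e) (b + of_nat (d - e)) (slice (int (d - e)) h))" for d
  define X where "X t = (growth M b m * (1 + real t)) ^ degree M * coeff_norm m (slice (int t) h)" for t
  have "coeff_norm m (p d) \<le> (\<Sum>e\<le>d. chi_norm M e * X (d - e))" for d
  proof -
    have "coeff_norm m (p d) \<le> (\<Sum>e\<le>d. coeff_norm m (shifted_D (chi M e) (b + of_nat (d - e)) (slice (int (d - e)) h)))"
      unfolding p_def by (rule coeff_norm_sum)
    also have "\<dots> \<le> (\<Sum>e\<le>d. chi_norm M e * X (d - e))"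
      unfolding X_def mult.assoc[symmetric] by (intro sum_mono coeff_norm_shifted_D_chi high)
    finally show ?thesis .
  qed
  moreover have "geom_bounded (\<lambda>d. \<Sum>e\<le>d. chi_norm M e * X (d - e))"
    unfolding X_def using growth_ge_1[of M b m]
    by (intro geom_bounded_convolution geom_bounded_chi_norm M geom_bounded_mult geom_bounded_power
          geom_bounded_const geom_bounded_linear geom_bounded_slices[OF h(1)]) auto
  ultimately have "geom_bounded (\<lambda>d. coeff_norm m (p d))"
    by (rule geom_bounded_mono[rotated])
  moreover have "coeff (p d) i = 0" if "i \<ge> m" for d i
    unfolding p_def coeff_sum using that by (intro sum.neutral ballI coeff_shifted_D_eq_0[of m] high)
  ultimately have "Abs_fps (\<lambda>d. coeff (p d) i) \<in> hol_germs"
    by (rule geom_bounded_imp_hol_germs)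
  moreover have "fls_regpart (coeff (act b M h) i) = Abs_fps (\<lambda>d. coeff (p d) i)"
  proof (rule fps_ext)
    fix d
    have "slice (int d) (act b M h) = p d"
      unfolding p_def using neg M(2) by (rule slice_act)
    then show "fls_regpart (coeff (act b M h) i) $ d = Abs_fps (\<lambda>d. coeff (p d) i) $ d"
      by (simp flip: coeff_slice)
  qed
  ultimately show ?thesis by simp
qed

section \<open>Convergence\<close>

text \<open>The coefficient is the l-th Taylor coefficient of q at b + d, of order at most d^(n-l).
  Horner's scheme q = a + X q' supports the induction.\<close>

lemma tendsto_coeff_shifted_poly:
  fixes q :: "complex poly"
  assumes "degree q \<le> n"
  shows "(\<lambda>d. coeff (q \<circ>\<^sub>p [:b + of_nat d, 1:]) l / of_nat (Suc d) ^ n)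
           \<longlonglongrightarrow> (if l = 0 then coeff q n else 0)"
  using assms
proof (induction n arbitrary: q l)
  case 0
  then obtain c where "q = [:c:]" by (auto elim: degree_eq_zeroE)
  then show ?case by (cases l) auto
next
  case (Suc n)
  obtain a q' where q: "q = pCons a q'" by (cases q)
  then have deg: "degree q' \<le> n" using Suc.prems by (cases "q' = 0") auto
  have inv: "(\<lambda>d. 1 / of_nat (Suc d) :: complex) \<longlonglongrightarrow> 0"
    by (rule LIMSEQ_Suc[OF lim_1_over_n])
  have "(\<lambda>d. 1 + (b - 1) * (1 / of_nat (Suc d)) :: complex) \<longlonglongrightarrow> 1 + (b - 1) * 0"
    by (intro tendsto_intros inv)
  moreover have "1 + (b - 1) * (1 / of_nat (Suc d)) = (b + of_nat d) / of_nat (Suc d)" for d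
    by (simp add: field_simps del: of_nat_Suc) simp
  ultimately have lin: "(\<lambda>d. (b + of_nat d) / of_nat (Suc d)) \<longlonglongrightarrow> 1" by simp
  define W where "W l d = coeff (q' \<circ>\<^sub>p [:b + of_nat d, 1:]) l / of_nat (Suc d) ^ n" for l d
  have W: "W l \<longlonglongrightarrow> (if l = 0 then coeff q' n else 0)" for l
    using Suc.IH[OF deg, of l] by (simp add: W_def[abs_def])
  \<comment> \<open>The Horner step divided by (d+1)^(n+1): the factors 1/(d+1)^(n+1), (b+d)/(d+1)
    and 1/(d+1) tend to 0, 1 and 0.\<close>
  have "coeff (q \<circ>\<^sub>p [:b + of_nat d, 1:]) l / of_nat (Suc d) ^ Suc n
      = (if l = 0 then a else 0) * (1 / of_nat (Suc d)) ^ Suc n + (b + of_nat d) / of_nat (Suc d) * W l d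
        + 1 / of_nat (Suc d) * (case l of 0 \<Rightarrow> 0 | Suc l' \<Rightarrow> W l' d)" for d
  proof -
    define z s where "z = b + of_nat d" and "s = (of_nat (Suc d) :: complex)"
    have "s \<noteq> 0" unfolding s_def by (rule of_nat_neq_0)
    then show ?thesis
      unfolding z_def[symmetric] s_def[symmetric] W_def q
      by (cases l) (simp_all add: pcompose_pCons field_simps)
  qed
  moreover have "(\<lambda>d. (if l = 0 then a else 0) * (1 / of_nat (Suc d)) ^ Suc n + (b + of_nat d) / of_nat (Suc d) * W l d
        + 1 / of_nat (Suc d) * (case l of 0 \<Rightarrow> 0 | Suc l' \<Rightarrow> W l' d))
      \<longlonglongrightarrow> (if l = 0 then a else 0) * 0 ^ Suc n + 1 * (if l = 0 then coeff q' n else 0)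
          + 0 * (case l of 0 \<Rightarrow> 0 | Suc l' \<Rightarrow> if l' = 0 then coeff q' n else 0)"
    by (intro tendsto_add tendsto_mult tendsto_const tendsto_power inv lin W) (cases l; simp add: W)
  moreover have "(if l = 0 then a else 0) * 0 ^ Suc n + 1 * (if l = 0 then coeff q' n else 0)
          + 0 * (case l of 0 \<Rightarrow> 0 | Suc l' \<Rightarrow> if l' = 0 then coeff q' n else 0)
      = (if l = 0 then coeff q (Suc n) else 0)"
    by (simp add: q)
  ultimately show ?case by (simp only:)
qed

lemma sum_power_le_2:
  fixes x :: real
  assumes "0 \<le> x" "x \<le> 1 / 2"
  shows "(\<Sum>e=1..d. x ^ e) \<le> 2 * x"
proof -
  have "(\<Sum>e<d. x ^ e) \<le> 2" for d
  proof (induction d)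
    case (Suc d)
    have "(\<Sum>e<Suc d. x ^ e) = 1 + x * (\<Sum>e<d. x ^ e)"
      by (subst sum.lessThan_Suc_shift) (simp add: sum_distrib_left)
    also have "\<dots> \<le> 1 + (1 / 2) * 2"
      using assms Suc by (intro add_left_mono mult_mono) (auto intro: sum_nonneg)
    finally show ?case by simp
  qed simp
  then have "x * (\<Sum>e<d. x ^ e) \<le> x * 2"
    using assms by (intro mult_left_mono) auto
  moreover have "(\<Sum>e=1..d. x ^ e) = x * (\<Sum>e<d. x ^ e)"
    by (simp add: sum_distrib_left sum.shift_bounds_cl_Suc_ivl[symmetric] flip: power_Suc)
       (metis One_nat_def atLeast0LessThan sum.shift_bounds_Suc_ivl atLeastLessThanSuc_atLeastAtMost)
  ultimately show ?thesis by simp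
qed

locale holomorphic_exponents = exponents L \<rho> r
  for L :: "complex diffop" and \<rho> :: "nat \<Rightarrow> complex" and r :: nat +
  assumes hol: "coeff L j \<in> hol_germs" and regular: "regular_singularity L"
begin

declare One_nat_def [simp del]

abbreviation "m \<equiv> mult_sum L \<rho> r"
abbreviation "n \<equiv> degree L"

lemma degree_indicial: "degree (indicial_poly L) \<le> n"
  unfolding indicial_poly_eq_chi chi_def
  by (intro degree_sum_le) (auto intro!: order_trans[OF degree_smult_le] simp: degree_falling_poly)

text \<open>The form in which regularity reaches the estimates: c_nn is nonzero and is the top
  coefficient of the indicial polynomial.\<close>

lemma lead_indicial: "coeff (indicial_poly L) n \<noteq> 0"
proof -
  obtain j where "coeff L j $ j \<noteq> 0"
    using shift_eq_0D_ex[OF L_nonzero shift_0] by blast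
  then have "coeff (initial_form L) j \<noteq> 0"
    by (simp add: coeff_initial_form[OF shift_0])
  \<comment> \<open>For n = 0 the equality of degrees alone would not exclude a zero initial
    form.\<close>
  then have "initial_form L \<noteq> 0" by auto
  then have "coeff (initial_form L) n \<noteq> 0"
    using regular unfolding regular_singularity_def by (metis leading_coeff_0_iff)
  then have "coeff L n $ n \<noteq> 0"
    by (auto simp: coeff_initial_form[OF shift_0])
  then show ?thesis
    by (subst coeff_indicial_poly_top) (auto simp: coeff_eq_0)
qed

text \<open>Beyond the last exponent nothing is divided out, and \<open>unit_part d\<close> is the
  shifted indicial polynomial itself.\<close>

lemma tendsto_unit_part:
  "(\<lambda>d. unit_part d $ l / of_nat (Suc d) ^ n) \<longlonglongrightarrow> (if l = 0 then coeff (indicial_poly L) n else 0)"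
proof (rule Lim_transform_eventually[OF tendsto_coeff_shifted_poly[OF degree_indicial]])
  have "mlt d = 0" if "d > \<delta> r" for d
  proof (rule ccontr)
    assume "mlt d \<noteq> 0"
    then obtain j where "j \<in> {1..r}" "d = \<delta> j" using mlt_nonzero_iff by blast
    with \<delta>_le[of j r] that show False by simp
  qed
  then have "unit_part d = fps_of_poly (indicial_poly L \<circ>\<^sub>p [:\<rho> 1 + of_nat d, 1:])" if "d > \<delta> r" for d
    using that by (simp add: unit_part_def)
  then show "\<forall>\<^sub>F d in sequentially. coeff (indicial_poly L \<circ>\<^sub>p [:\<rho> 1 + of_nat d, 1:]) l / of_nat (Suc d) ^ n
      = unit_part d $ l / of_nat (Suc d) ^ n"
    by (intro eventually_sequentiallyI[of "Suc (\<delta> r)"]) simp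
qed

text \<open>Dividing the coefficients of the unit by (d+1)^n and multiplying those of its inverse by
  (d+1)^n preserves the recursion for the reciprocal series, so convergence passes through it by
  induction on l. The start l = 0 works because the limit in \<open>tendsto_unit_part\<close> is
  nonzero there.\<close>

lemma convergent_inverse_unit_part:
  "convergent (\<lambda>d. inverse (unit_part d) $ l * of_nat (Suc d) ^ n)"
proof (induction l rule: less_induct)
  case (less l)
  define W where "W i d = unit_part d $ i / of_nat (Suc d) ^ n" for i d
  define y where "y i d = inverse (unit_part d) $ i * of_nat (Suc d) ^ n" for i d
  have W: "convergent (W i)" for i
    unfolding W_def by (rule convergentI[OF tendsto_unit_part])
  have y0: "y 0 d = inverse (W 0 d)" for d
    by (simp add: y_def W_def divide_inverse mult.commute)
  have "(\<lambda>d. inverse (W 0 d)) \<longlonglongrightarrow> inverse (coeff (indicial_poly L) n)"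
    using tendsto_unit_part[of 0] lead_indicial unfolding W_def by (intro tendsto_inverse) auto
  then have c0: "convergent (y 0)"
    unfolding y0[abs_def] by (rule convergentI)
  show ?case
  proof (cases "l = 0")
    case True
    then show ?thesis using c0 by (simp add: y_def[abs_def])
  next
    case False
    have "y l d = - (y 0 d * (\<Sum>i=1..l. W i d * y (l - i) d))" for d
    proof -
      let ?u = "unit_part d" and ?v = "inverse (unit_part d)" and ?s = "of_nat (Suc d) ^ n :: complex"
      have "(?u * ?v) $ l = 0" using False by (simp add: unit_part_inverse)
      then have "0 = (\<Sum>i=0..l. ?u $ i * ?v $ (l - i))" by (simp add: fps_mult_nth)
      also have "{0..l} = insert 0 {1..l}" by auto
      finally have "?u $ 0 * ?v $ l = - (\<Sum>i=1..l. ?u $ i * ?v $ (l - i))"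
        by (simp add: eq_neg_iff_add_eq_0)
      then have "?v $ l = - (inverse (?u $ 0) * (\<Sum>i=1..l. ?u $ i * ?v $ (l - i)))"
        using unit_part_0[of d] by (simp add: field_simps)
      moreover have "(\<Sum>i=1..l. W i d * y (l - i) d) = (\<Sum>i=1..l. ?u $ i * ?v $ (l - i))"
        by (intro sum.cong) (auto simp: W_def y_def simp del: of_nat_Suc)
      ultimately show ?thesis by (simp add: y_def)
    qed
    then have "y l = (\<lambda>d. - (y 0 d * (\<Sum>i=1..l. W i d * y (l - i) d)))" by blast
    moreover have "convergent \<dots>"
    proof (intro convergent_minus_iff[THEN iffD1] convergent_mult c0 convergent_sum W)
      fix i assume "i \<in> {1..l}"
      then show "convergent (y (l - i))"
        using less[of "l - i"] False by (simp add: y_def[abs_def])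
    qed
    ultimately show ?thesis by (simp add: y_def[abs_def])
  qed
qed

text \<open>Convergent sequences are bounded, and only the coefficients l < m of the inverse series
  act on polynomials of degree below m, so finitely many bounds add up to C.\<close>

lemma ex_coeff_norm_G:
  "\<exists>C\<ge>0. \<forall>d p. (\<forall>i\<ge>m. coeff p i = 0) \<longrightarrow> coeff_norm m (G d p) * (1 + real d) ^ n \<le> C * coeff_norm m p"
proof -
  have "\<exists>B>0. \<forall>d. norm (inverse (unit_part d) $ l * of_nat (Suc d) ^ n) \<le> B" for l
    using convergent_imp_Bseq[OF convergent_inverse_unit_part[of l]] by (auto elim: BseqE)
  then obtain B where B: "\<And>l. B l > 0" "\<And>l d. norm (inverse (unit_part d) $ l * of_nat (Suc d) ^ n) \<le> B l"
    by metis
  define C where "C = (\<Sum>l<m. B l * real m ^ l)"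
  have "coeff_norm m (G d p) * (1 + real d) ^ n \<le> C * coeff_norm m p" if "\<forall>i\<ge>m. coeff p i = 0" for d p
  proof -
    have "coeff_norm m (G d p) \<le> coeff_norm m (series_D (inverse (unit_part d)) p)"
      unfolding G_def by (rule coeff_norm_poly_integral_pow)
    also have "\<dots> \<le> (\<Sum>l<m. norm (inverse (unit_part d) $ l) * real m ^ l) * coeff_norm m p"
      using that by (intro coeff_norm_series_D) auto
    finally have "coeff_norm m (G d p) * (1 + real d) ^ n
        \<le> (\<Sum>l<m. norm (inverse (unit_part d) $ l) * real m ^ l) * coeff_norm m p * (1 + real d) ^ n"
      by (rule mult_right_mono) auto
    also have "\<dots> = (\<Sum>l<m. (norm (inverse (unit_part d) $ l) * (1 + real d) ^ n) * real m ^ l) * coeff_norm m p"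
      by (simp add: sum_distrib_left sum_distrib_right mult_ac)
    also have "\<dots> \<le> C * coeff_norm m p"
      unfolding C_def
    proof (intro mult_right_mono sum_mono)
      fix l
      have "norm (of_nat (Suc d) ^ n :: complex) = (1 + real d) ^ n"
        by (simp only: norm_power norm_of_nat) simp
      then show "norm (inverse (unit_part d) $ l) * (1 + real d) ^ n \<le> B l"
        using B(2)[of d l] by (simp only: norm_mult)
    qed auto
    finally show ?thesis .
  qed
  moreover have "C \<ge> 0" unfolding C_def using B(1) by (intro sum_nonneg) (simp add: less_imp_le)
  ultimately show ?thesis by blast
qed

text \<open>Regularity enters here: the factor of order $d^n$ produced by $T$ is absorbed by the
  decay of order $d^{-n}$ of the inverse of $\chi(\rho_1 + d + \partial_z)$.\<close>

lemma ex_contraction: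
  "\<exists>Q0\<ge>1. \<forall>Q\<ge>Q0. \<forall>B\<ge>0. \<forall>p d. (\<forall>e. \<forall>i\<ge>N e. coeff (p e) i = 0) \<longrightarrow>
     (\<forall>e<d. coeff_norm m (p e) \<le> B * Q ^ e) \<longrightarrow> coeff_norm m (G d (T_slice d p)) \<le> B / 2 * Q ^ d"
proof -
  obtain C where C: "C \<ge> 0" "\<And>d p. (\<forall>i\<ge>m. coeff p i = 0) \<Longrightarrow> coeff_norm m (G d p) * (1 + real d) ^ n \<le> C * coeff_norm m p"
    using ex_coeff_norm_G by blast
  define g where "g = growth L (\<rho> 1) m"
  have g1: "g \<ge> 1" unfolding g_def by (rule growth_ge_1)
  obtain D R where D: "D \<ge> 0" "R \<ge> 1" "\<And>e. chi_norm L e \<le> D * R ^ e"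
    using geom_bounded_chi_norm[of L] hol unfolding geom_bounded_def by blast
  define c where "c = C * g ^ n * D"
  have c: "c \<ge> 0" unfolding c_def using C(1) D(1) g1 by simp
  \<comment> \<open>The summand 2 R makes the geometric series in R / Q at most 2 R / Q, and 4 c R
    then brings the total factor 2 c R / Q down to 1/2.\<close>
  define Q0 where "Q0 = 2 * R + 4 * c * R"
  have "coeff_norm m (G d (T_slice d p)) \<le> B / 2 * Q ^ d"
    if Q: "Q \<ge> Q0" and B: "B \<ge> 0" and high: "\<forall>e. \<forall>i\<ge>N e. coeff (p e) i = 0"
      and le: "\<forall>e<d. coeff_norm m (p e) \<le> B * Q ^ e" for Q B p d
  proof -
    have hm: "coeff (p e) i = 0" if "i \<ge> m" for e i
      using high N_le[of e] that by auto
    have Qpos: "Q > 0" "2 * R \<le> Q" "4 * c * R \<le> Q"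
      using Q D(2) c mult_nonneg_nonneg[of c R] unfolding Q0_def by linarith+
    have T_slice_high: "coeff (T_slice d p) i = 0" if "i \<ge> m" for i
      unfolding T_slice_def coeff_minus coeff_sum neg_equal_0_iff_equal using that hm
      by (intro sum.neutral ballI coeff_shifted_D_eq_0[of m]) auto
    have "coeff_norm m (T_slice d p) \<le> (\<Sum>e=1..d. coeff_norm m (shifted_D (chi L e) (\<rho> 1 + of_nat (d - e)) (p (d - e))))"
      unfolding T_slice_def coeff_norm_minus by (rule coeff_norm_sum)
    also have "\<dots> \<le> (\<Sum>e=1..d. (D * R ^ e) * (g * (1 + real d)) ^ n * (B * Q ^ (d - e)))"
    proof (rule sum_mono)
      fix e assume e: "e \<in> {1..d}"
      have "coeff_norm m (shifted_D (chi L e) (\<rho> 1 + of_nat (d - e)) (p (d - e)))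
          \<le> chi_norm L e * (g * (1 + real (d - e))) ^ n * coeff_norm m (p (d - e))"
        unfolding g_def using hm by (rule coeff_norm_shifted_D_chi)
      also have "\<dots> \<le> (D * R ^ e) * (g * (1 + real d)) ^ n * (B * Q ^ (d - e))"
        using e D g1 le B by (intro mult_mono power_mono mult_left_mono) auto
      finally show "coeff_norm m (shifted_D (chi L e) (\<rho> 1 + of_nat (d - e)) (p (d - e)))
          \<le> (D * R ^ e) * (g * (1 + real d)) ^ n * (B * Q ^ (d - e))" .
    qed
    also have "\<dots> = (\<Sum>e=1..d. D * (g * (1 + real d)) ^ n * B * Q ^ d * (R / Q) ^ e)"
    proof (intro sum.cong refl)
      fix e assume "e \<in> {1..d}"
      then have "Q ^ (d - e) = Q ^ d / Q ^ e" using Qpos by (simp add: power_diff)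
      then show "(D * R ^ e) * (g * (1 + real d)) ^ n * (B * Q ^ (d - e))
          = D * (g * (1 + real d)) ^ n * B * Q ^ d * (R / Q) ^ e"
        by (simp add: power_divide)
    qed
    also have "\<dots> = D * (g * (1 + real d)) ^ n * B * Q ^ d * (\<Sum>e=1..d. (R / Q) ^ e)"
      by (simp add: sum_distrib_left)
    also have "\<dots> \<le> D * (g * (1 + real d)) ^ n * B * Q ^ d * (2 * (R / Q))"
      using D g1 B Qpos by (intro mult_left_mono sum_power_le_2) (auto simp: field_simps)
    finally have T_slice: "coeff_norm m (T_slice d p) \<le> D * (g * (1 + real d)) ^ n * B * Q ^ d * (2 * (R / Q))" .
    have "coeff_norm m (G d (T_slice d p)) * (1 + real d) ^ n \<le> C * coeff_norm m (T_slice d p)"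
      by (rule C(2)) (use T_slice_high in blast)
    also have "\<dots> \<le> C * (D * (g * (1 + real d)) ^ n * B * Q ^ d * (2 * (R / Q)))"
      using T_slice C(1) by (rule mult_left_mono)
    also have "\<dots> = (2 * c * R / Q) * (B * Q ^ d) * (1 + real d) ^ n"
      by (simp add: c_def power_mult_distrib)
    also have "\<dots> \<le> (1 / 2) * (B * Q ^ d) * (1 + real d) ^ n"
      using Qpos B by (intro mult_right_mono) (auto simp: field_simps)
    finally show ?thesis
      by (simp add: mult_le_cancel_right)
  qed
  moreover have "Q0 \<ge> 1" unfolding Q0_def using D(2) c mult_nonneg_nonneg[of c R] by linarith
  ultimately show ?thesis by blast
qed

text \<open>The bound 2 B reproduces itself: B comes from f, and the contraction contributes half of
  2 B.\<close>

lemma fixpoint_bound: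
  assumes Q: "\<forall>B\<ge>0. \<forall>p d. (\<forall>e. \<forall>i\<ge>N e. coeff (p e) i = 0) \<longrightarrow>
     (\<forall>e<d. coeff_norm m (p e) \<le> B * Q ^ e) \<longrightarrow> coeff_norm m (G d (T_slice d p)) \<le> B / 2 * Q ^ d"
    and f: "\<And>d. coeff_norm m (f d) \<le> B * Q ^ d" "B \<ge> 0"
    and p: "\<And>d i. i \<ge> N d \<Longrightarrow> coeff (p d) i = 0" "\<And>d. p d = f d + G d (T_slice d p)"
  shows "coeff_norm m (p d) \<le> 2 * B * Q ^ d"
proof (induction d rule: less_induct)
  case (less d)
  have "coeff_norm m (G d (T_slice d p)) \<le> 2 * B / 2 * Q ^ d"
    using Q f(2) p(1) less by (metis (no_types, lifting) mult_nonneg_nonneg zero_le_numeral)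
  then have "coeff_norm m (f d) + coeff_norm m (G d (T_slice d p)) \<le> 2 * B * Q ^ d"
    using f(1)[of d] by simp
  then show ?case
    using coeff_norm_add[of m "f d" "G d (T_slice d p)"] p(2)[of d] by simp
qed

sublocale normalization hol_germs L \<rho> r
proof unfold_locales
  have lt: "i < m" if "i < N d" for d i
    using that N_le[of d] by simp
  fix h f :: "complex fls poly" and i
  show "fls_regpart (coeff (op_L L \<rho> h) i) \<in> hol_germs" if "h \<in> supp_space hol_germs (\<lambda>d i. i < N d)"
    unfolding op_L_def
    using that lt hol shift_eq_0D_below[OF L_nonzero shift_0] by (rule act_hol_germs)
  show "fls_regpart (coeff (op_L0 L \<rho> h) i) \<in> hol_germs" if "h \<in> supp_space hol_germs (\<lambda>d i. i < N d)"
    unfolding op_L0_def using that lt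
  proof (rule act_hol_germs)
    show "coeff (initial_form L) j \<in> hol_germs" for j
      unfolding coeff_initial_form[OF shift_0] by (intro hol_germs.A_X_power_mult hol_germs.A_const)
    show "coeff (initial_form L) j $ i = 0" if "i < j" for i j
      using that by (simp add: coeff_initial_form[OF shift_0] fps_X_power_nth)
  qed
  show "Abs_fps (\<lambda>d. coeff (G d (slice (int d) h)) i) \<in> hol_germs"
    if h: "h \<in> supp_space hol_germs (\<lambda>d i. 1 \<le> d \<and> i < N (d - 1))"
  proof (rule geom_bounded_imp_hol_germs)
    obtain C where C: "C \<ge> 0" "\<And>d p. (\<forall>i\<ge>m. coeff p i = 0) \<Longrightarrow> coeff_norm m (G d p) * (1 + real d) ^ n \<le> C * coeff_norm m p"
      using ex_coeff_norm_G by blast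
    have high: "coeff (slice (int d) h) i = 0" if "\<not> (1 \<le> d \<and> i < N (d - 1))" for d i
      using h that by (rule supp_spaceD(3))
    have "coeff_norm m (G d (slice (int d) h)) \<le> C * coeff_norm m (slice (int d) h)" for d
    proof -
      have "\<forall>i\<ge>m. coeff (slice (int d) h) i = 0" using high N_le[of "d - 1"] by auto
      then have "coeff_norm m (G d (slice (int d) h)) * (1 + real d) ^ n \<le> C * coeff_norm m (slice (int d) h)"
        by (rule C(2))
      moreover have "coeff_norm m (G d (slice (int d) h)) * 1 \<le> coeff_norm m (G d (slice (int d) h)) * (1 + real d) ^ n"
        by (intro mult_left_mono) auto
      ultimately show ?thesis by simp
    qed
    then show "geom_bounded (\<lambda>d. coeff_norm m (G d (slice (int d) h)))"
      using C(1) by (intro geom_bounded_mono[OF geom_bounded_mult[OF geom_bounded_const geom_bounded_slices[OF h]]]) auto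
    show "coeff (G d (slice (int d) h)) i = 0" if "m \<le> i" for d i
      by (rule coeff_G_high) (use high N_le[of d] that in auto)
  qed
  show "Abs_fps (\<lambda>d. coeff (p d) i) \<in> hol_germs"
    if f: "f \<in> supp_space hol_germs (\<lambda>d i. i < N d)" and high: "\<And>d i. N d \<le> i \<Longrightarrow> coeff (p d) i = 0"
      and p: "\<And>d. p d = slice (int d) f + G d (T_slice d p)" for p
  proof (rule geom_bounded_imp_hol_germs)
    obtain Q0 where Q0: "Q0 \<ge> 1" "\<forall>Q\<ge>Q0. \<forall>B\<ge>0. \<forall>p d. (\<forall>e. \<forall>i\<ge>N e. coeff (p e) i = 0) \<longrightarrow>
        (\<forall>e<d. coeff_norm m (p e) \<le> B * Q ^ e) \<longrightarrow> coeff_norm m (G d (T_slice d p)) \<le> B / 2 * Q ^ d"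
      using ex_contraction by blast
    obtain B Q1 where B: "B \<ge> 0" "Q1 \<ge> 1" "\<And>d. coeff_norm m (slice (int d) f) \<le> B * Q1 ^ d"
      using geom_bounded_slices[OF f, of m] unfolding geom_bounded_def by blast
    \<comment> \<open>f brings its own Q1 and the contraction needs at least Q0; both bounds survive
      enlarging Q.\<close>
    define Q where "Q = max Q0 Q1"
    have le: "coeff_norm m (slice (int d) f) \<le> B * Q ^ d" for d
      using B by (intro order_trans[OF B(3)] mult_left_mono power_mono) (auto simp: Q_def)
    have "coeff_norm m (p d) \<le> (2 * B) * Q ^ d" for d
      by (rule fixpoint_bound[where f = "\<lambda>d. slice (int d) f", OF _ le B(1) high p])
        (use Q0(2) in \<open>simp add: Q_def\<close>)
    then show "geom_bounded (\<lambda>d. coeff_norm m (p d))"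
      using B Q0(1) by (intro geom_boundedI[of _ "2 * B" Q]) (auto simp: Q_def)
    show "coeff (p d) i = 0" if "m \<le> i" for d i
      using N_le[of d] that by (intro high) simp
  qed
qed

text \<open>The remainder after N terms is K^N (v f), whose norm halves at each step. The starting
  bound is available because v f already lies in \<open>F\<close>.\<close>

lemma germ_sums_v:
  assumes f: "f \<in> F"
  shows "germ_sums (\<lambda>k. (K ^^ k) f) (v f)"
proof -
  note w = v(1)[OF f]
  obtain Q0 where Q0: "Q0 \<ge> 1" "\<forall>Q\<ge>Q0. \<forall>B\<ge>0. \<forall>p d. (\<forall>e. \<forall>i\<ge>N e. coeff (p e) i = 0) \<longrightarrow>
      (\<forall>e<d. coeff_norm m (p e) \<le> B * Q ^ e) \<longrightarrow> coeff_norm m (G d (T_slice d p)) \<le> B / 2 * Q ^ d"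
    using ex_contraction by blast
  obtain B1 Q1 where B1: "B1 \<ge> 0" "Q1 \<ge> 1" "\<And>d. coeff_norm m (slice (int d) f) \<le> B1 * Q1 ^ d"
    using geom_bounded_slices[of f _ m] f unfolding geom_bounded_def space_F_eq by blast
  obtain B2 Q2 where B2: "B2 \<ge> 0" "Q2 \<ge> 1" "\<And>d. coeff_norm m (slice (int d) (v f)) \<le> B2 * Q2 ^ d"
    using geom_bounded_slices[of "v f" _ m] w unfolding geom_bounded_def space_F_eq by blast
  \<comment> \<open>One Q and one B for both f and v f put all terms and all remainders on a common
    disc.\<close>
  define Q where "Q = max Q0 (max Q1 Q2)"
  define B where "B = max B1 B2"
  have Q: "Q \<ge> 1" "Q > 0" and B: "B \<ge> 0" using Q0(1) B1(1) by (auto simp: Q_def B_def)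
  have le1: "coeff_norm m (slice (int d) f) \<le> B * Q ^ d" for d
    using B1 by (intro order_trans[OF B1(3)] mult_mono power_mono) (auto simp: Q_def B_def)
  have le2: "coeff_norm m (slice (int d) (v f)) \<le> B * Q ^ d" for d
    using B2 by (intro order_trans[OF B2(3)] mult_mono power_mono) (auto simp: Q_def B_def)
  have pow: "coeff_norm m (slice (int d) ((K ^^ k) g)) \<le> B / 2 ^ k * Q ^ d"
    if g: "g \<in> F" "\<And>d. coeff_norm m (slice (int d) g) \<le> B * Q ^ d" for k d g
  proof (induction k arbitrary: d)
    case (Suc k)
    have high: "\<forall>e. \<forall>i\<ge>N e. coeff (slice (int e) ((K ^^ k) g)) i = 0"
      using F_high[OF Kpow_F[OF g(1)]] by blast
    have "coeff_norm m (G d (T_slice d (\<lambda>d. slice (int d) ((K ^^ k) g)))) \<le> B / 2 ^ k / 2 * Q ^ d"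
      by (rule Q0(2)[rule_format, of Q "B / 2 ^ k" "\<lambda>d. slice (int d) ((K ^^ k) g)"])
        (use B high Suc.IH in \<open>auto simp: Q_def\<close>)
    then show ?case by (simp add: Kpow_Suc slice_K Kpow_F g(1) del: funpow.simps coeff_slice)
  qed (use g in simp)
  have coeffs: "norm (fls_regpart (coeff ((K ^^ k) g) i) $ d) \<le> B / 2 ^ k * Q ^ d"
    if g: "g \<in> F" "\<And>d. coeff_norm m (slice (int d) g) \<le> B * Q ^ d" for k d g i
  proof (cases "i < m")
    case True
    from norm_coeff_le_coeff_norm[OF this, of "slice (int d) ((K ^^ k) g)"] pow[OF g, of d k]
    show ?thesis by simp
  next
    case False
    then have "coeff (slice (int d) ((K ^^ k) g)) i = 0"
      using N_le[of d] by (intro F_high Kpow_F g(1)) simp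
    then show ?thesis using B Q by simp
  qed
  define E where "E g i x = eval_fps (fls_regpart (coeff g i)) x" for g i and x :: complex
  have rad: "ereal (1 / Q) \<le> fps_conv_radius (fls_regpart (coeff ((K ^^ k) g) i))"
    if g: "g \<in> F" "\<And>d. coeff_norm m (slice (int d) g) \<le> B * Q ^ d" for k g i
    using coeffs[OF g] Q(2) by (rule fps_conv_radius_geometric)
  \<comment> \<open>Half of the radius 1 / Q of guaranteed convergence, where the bound on values is
    uniform in x.\<close>
  define s where "s = 1 / (2 * Q)"
  have s: "s > 0" "s \<le> 1 / Q" using Q by (auto simp: s_def field_simps)
  \<comment> \<open>The exact remainder formula, now for values; evaluation is additive here because
    every series involved converges at x.\<close>
  have diff: "E (v f) i x - (\<Sum>k<N. E ((K ^^ k) f) i x) = E ((K ^^ N) (v f)) i x"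
    if x: "norm x < s" for i x N
  proof (induction N)
    case (Suc N)
    have "E ((K ^^ N) (v f)) i x
        = eval_fps (fls_regpart (coeff ((K ^^ N) f) i) + fls_regpart (coeff ((K ^^ Suc N) (v f)) i)) x"
      by (simp only: E_def Kpow_v[OF f, of N] coeff_add fls_regpart_plus)
    also have "\<dots> = E ((K ^^ N) f) i x + E ((K ^^ Suc N) (v f)) i x"
      unfolding E_def
    proof (rule eval_fps_add)
      have "ereal (norm x) < ereal (1 / Q)" using x s(2) by simp
      then show "ereal (norm x) < fps_conv_radius (fls_regpart (coeff ((K ^^ N) f) i))"
        "ereal (norm x) < fps_conv_radius (fls_regpart (coeff ((K ^^ Suc N) (v f)) i))"
        using rad[OF f le1] rad[OF w le2] less_le_trans by blast+
    qed
    finally show ?case using Suc by (simp del: funpow.simps add: algebra_simps)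
  qed simp
  have unif: "uniform_limit (ball 0 s) (\<lambda>N x. \<Sum>k<N. E ((K ^^ k) f) i x) (E (v f) i) sequentially" for i
  proof (rule uniform_limitI)
    fix \<epsilon> :: real assume "\<epsilon> > 0"
    have "(\<lambda>N. 2 * B * (1 / 2) ^ N) \<longlonglongrightarrow> 2 * B * 0"
      by (intro tendsto_intros LIMSEQ_power_zero) auto
    then have "\<forall>\<^sub>F N in sequentially. 2 * B * (1 / 2) ^ N < \<epsilon>"
      using \<open>\<epsilon> > 0\<close> by (simp add: order_tendstoD(2))
    then show "\<forall>\<^sub>F N in sequentially. \<forall>x\<in>ball 0 s. dist (\<Sum>k<N. E ((K ^^ k) f) i x) (E (v f) i x) < \<epsilon>"
    proof eventually_elim
      case (elim N)
      show ?case
      proof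
        fix x :: complex assume "x \<in> ball 0 s"
        then have x: "norm x < s" by simp
        have "dist (\<Sum>k<N. E ((K ^^ k) f) i x) (E (v f) i x) = norm (E ((K ^^ N) (v f)) i x)"
          by (simp only: dist_norm norm_minus_commute[of "sum _ _"] diff[OF x])
        also have "\<dots> \<le> 2 * (B / 2 ^ N)"
          unfolding E_def using coeffs[OF w le2] Q(2) x[unfolded s_def]
          by (rule norm_eval_fps_geometric) (use B in simp)
        also have "\<dots> < \<epsilon>" using elim by (simp add: power_one_over divide_simps)
        finally show "dist (\<Sum>k<N. E ((K ^^ k) f) i x) (E (v f) i x) < \<epsilon>" .
      qed
    qed
  qed
  have le: "ereal s \<le> ereal (1 / Q)" using s(2) by simp
  have "ereal s \<le> fps_conv_radius (fls_regpart (coeff ((K ^^ k) f) i))" for k i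
    using le rad[OF f le1] by (rule order_trans)
  moreover have "ereal s \<le> fps_conv_radius (fls_regpart (coeff (v f) i))" for i
    using le rad[OF w le2, of 0 i] unfolding funpow_0 by (rule order_trans)
  ultimately show ?thesis using s(1) unif unfolding germ_sums_def E_def by blast
qed

end

text \<open>Over all power series the closure conditions are trivial and no estimate enters, which
  is why the formal statement covers irregular singularities.\<close>

lemma normalization_UNIV:
  assumes "exponents L \<rho> r"
  shows "normalization UNIV L \<rho> r"
proof -
  interpret exponents L \<rho> r by fact
  show ?thesis by unfold_locales auto
qed

theorem theorem2p15:
  shows
    "(\<forall>(L :: complex diffop) (\<rho> :: nat \<Rightarrow> complex) (r :: nat).
        L \<noteq> 0 \<and> (\<forall>j. coeff L j \<in> hol_germs) \<and> shift L = 0 \<and>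
        exponent_class L \<rho> r \<and> regular_singularity L \<longrightarrow>
        (let F = space_F hol_germs L \<rho> r; Fx = space_Fx hol_germs L \<rho> r;
             H = space_H hol_germs L \<rho> r; S0 = op_S0 hol_germs L \<rho> r; T = op_T L \<rho>;
             u = op_u hol_germs L \<rho> r; v = op_v hol_germs L \<rho> r
         in H \<subseteq> F \<and> op_L L \<rho> \<in> F \<rightarrow> F \<and> op_L0 L \<rho> \<in> F \<rightarrow> F \<and>
            bij_betw (op_L0 L \<rho>) H Fx \<and>
            S0 \<in> Fx \<rightarrow> F \<and> (\<forall>f\<in>Fx. op_L0 L \<rho> (S0 f) = f) \<and>
            T \<in> F \<rightarrow> Fx \<and>
            linear_automorphism F u \<and>
            (\<forall>f\<in>F. xadic_sums (\<lambda>k. ((S0 \<circ> T) ^^ k) f) (v f) \<and>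
                   germ_sums (\<lambda>k. ((S0 \<circ> T) ^^ k) f) (v f)) \<and>
            (\<forall>f\<in>F. op_L L \<rho> (v f) = op_L0 L \<rho> f)))
     \<and>
     (\<forall>(L :: 'k::{alg_closed_field, field_char_0} diffop) (\<rho> :: nat \<Rightarrow> 'k) (r :: nat).
        L \<noteq> 0 \<and> shift L = 0 \<and> exponent_class L \<rho> r \<longrightarrow>
        (let F = space_F UNIV L \<rho> r; Fx = space_Fx UNIV L \<rho> r;
             H = space_H UNIV L \<rho> r; S0 = op_S0 UNIV L \<rho> r; T = op_T L \<rho>;
             u = op_u UNIV L \<rho> r; v = op_v UNIV L \<rho> r
         in H \<subseteq> F \<and> op_L L \<rho> \<in> F \<rightarrow> F \<and> op_L0 L \<rho> \<in> F \<rightarrow> F \<and>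
            bij_betw (op_L0 L \<rho>) H Fx \<and>
            S0 \<in> Fx \<rightarrow> F \<and> (\<forall>f\<in>Fx. op_L0 L \<rho> (S0 f) = f) \<and>
            T \<in> F \<rightarrow> Fx \<and>
            linear_automorphism F u \<and>
            (\<forall>f\<in>F. xadic_sums (\<lambda>k. ((S0 \<circ> T) ^^ k) f) (v f)) \<and>
            (\<forall>f\<in>F. op_L L \<rho> (v f) = op_L0 L \<rho> f)))"
proof (intro conjI allI impI)
  fix L :: "complex diffop" and \<rho> :: "nat \<Rightarrow> complex" and r :: nat
  assume *: "L \<noteq> 0 \<and> (\<forall>j. coeff L j \<in> hol_germs) \<and> shift L = 0 \<and>
        exponent_class L \<rho> r \<and> regular_singularity L"
  interpret holomorphic_exponents L \<rho> r
    by unfold_locales (use * in blast)+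
  show "let F = space_F hol_germs L \<rho> r; Fx = space_Fx hol_germs L \<rho> r;
             H = space_H hol_germs L \<rho> r; S0 = op_S0 hol_germs L \<rho> r; T = op_T L \<rho>;
             u = op_u hol_germs L \<rho> r; v = op_v hol_germs L \<rho> r
         in H \<subseteq> F \<and> op_L L \<rho> \<in> F \<rightarrow> F \<and> op_L0 L \<rho> \<in> F \<rightarrow> F \<and>
            bij_betw (op_L0 L \<rho>) H Fx \<and>
            S0 \<in> Fx \<rightarrow> F \<and> (\<forall>f\<in>Fx. op_L0 L \<rho> (S0 f) = f) \<and>
            T \<in> F \<rightarrow> Fx \<and>
            linear_automorphism F u \<and>
            (\<forall>f\<in>F. xadic_sums (\<lambda>k. ((S0 \<circ> T) ^^ k) f) (v f) \<and>
                   germ_sums (\<lambda>k. ((S0 \<circ> T) ^^ k) f) (v f)) \<and>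
            (\<forall>f\<in>F. op_L L \<rho> (v f) = op_L0 L \<rho> f)"
    unfolding Let_def
    using H_subset_F op_L_F op_L0_to_F bij_op_L0 S0_F op_L0_S0 T_F linear_automorphism_u
      xadic_sums_v[unfolded K_def] germ_sums_v[unfolded K_def] op_L_v by blast
next
  fix L :: "'k diffop" and \<rho> :: "nat \<Rightarrow> 'k" and r :: nat
  assume *: "L \<noteq> 0 \<and> shift L = 0 \<and> exponent_class L \<rho> r"
  then have "exponents L \<rho> r" by unfold_locales auto
  then interpret normalization UNIV L \<rho> r by (rule normalization_UNIV)
  show "let F = space_F UNIV L \<rho> r; Fx = space_Fx UNIV L \<rho> r;
             H = space_H UNIV L \<rho> r; S0 = op_S0 UNIV L \<rho> r; T = op_T L \<rho>;
             u = op_u UNIV L \<rho> r; v = op_v UNIV L \<rho> r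
         in H \<subseteq> F \<and> op_L L \<rho> \<in> F \<rightarrow> F \<and> op_L0 L \<rho> \<in> F \<rightarrow> F \<and>
            bij_betw (op_L0 L \<rho>) H Fx \<and>
            S0 \<in> Fx \<rightarrow> F \<and> (\<forall>f\<in>Fx. op_L0 L \<rho> (S0 f) = f) \<and>
            T \<in> F \<rightarrow> Fx \<and>
            linear_automorphism F u \<and>
            (\<forall>f\<in>F. xadic_sums (\<lambda>k. ((S0 \<circ> T) ^^ k) f) (v f)) \<and>
            (\<forall>f\<in>F. op_L L \<rho> (v f) = op_L0 L \<rho> f)"
    unfolding Let_def
    using H_subset_F op_L_F op_L0_to_F bij_op_L0 S0_F op_L0_S0 T_F linear_automorphism_u
      xadic_sums_v[unfolded K_def] op_L_v by blast
qed

end
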